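(* Let $\mathcal S$ be a standard class. Let $(X_0,X_1)$ be an interpolation couple of K\"othe function spaces generating the interpolation scale $(X_\theta)$; let $0<\theta<1$, assume that $X_\theta$ is reflexive, and let $\Omega_\theta$ be the induced centralizer on $X_\theta$. If $\Omega_\theta$ is not disjointly singular, then there exist a subspace $W\subset X_\theta$ spanned by a sequence of disjointly supported vectors and a constant $K$ such that for all $n\in\mathbb N$ $$\left|\log\frac{M_{X_0,\mathcal S}(n)}{M_{X_1,\mathcal S}(n)}\right| M_{W,\mathcal S}(n)\le K\,M_{X_0,\mathcal S}(n)^{1-\theta}M_{X_1,\mathcal S}(n)^{\theta}.$$
   Context: Scalars are complex. A K\"othe function space $X$ over a ($\sigma$-finite) measure space is a Banach space of classes of measurable functions, contained in the space $L_0$ of all measurable functions, such that $|f|\le|g|$, $f\in L_0$, $g\in X$ imply $f\in X$, $\|f\|\le\|g\|$. Spaces with a $1$-unconditional basis are regarded as K\"othe function spaces on $\mathbb N$. The closed span $W$ of an infinite sequence of nonzero disjointly supported vectors is regarded as a space with $1$-unconditional basis given by the (normalized) sequence. A standard class $\mathcal S$ is a class of finite families ($n$-tuples) of elements of K\"othe function spaces (respectively, of spaces with $1$-unconditional bases) $X$ such that: (i) whenever $(x_i)\in\mathcal S$ and $\mathrm{supp}\,z_i\subset\mathrm{supp}\,x_i$ for all $i$, then $(z_i)\in\mathcal S$; (ii) if $W$ is a subspace of $X$ generated by disjoint vectors (respectively, by successive vectors) and $(x_i)$ is an $n$-tuple of elements of $W$ which belongs to $\mathcal S$ as a family in $W$,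 then it also belongs to $\mathcal S$ as a family in $X$. (Examples: finite families of disjointly supported vectors in K\"othe spaces; families $n<\mathrm{supp}\,x_1<\dots<\mathrm{supp}\,x_n$ in spaces with $1$-unconditional basis.) For a space $X$, $M_{X,\mathcal S}(n)=\sup\{\|x_1+\dots+x_n\|:(x_j)_{j=1}^n\in\mathcal S,\ x_j\in X,\ \|x_j\|\le1\}$. Complex interpolation: let $\mathbb S=\{z\in\mathbb C:0\le\mathrm{Re}\,z\le1\}$, $\Sigma=X_0+X_1$; $\mathcal H$ is the Banach space of functions $g:\mathbb S\to\Sigma$ which are $\Sigma$-bounded, $\Sigma$-continuous on $\mathbb S$, analytic in the interior, with $t\mapsto g(j+it)\in X_j$ bounded and continuous for $j=0,1$, normed by $\sup\{\|g(j+it)\|_{X_j}\}$. $X_\theta=\{g(\theta):g\in\mathcal H\}$ with the quotient norm. The induced centralizer is $\Omega_\theta(x)=B_\theta(x)'(\theta)\in L_0$, where $B_\theta:X_\theta\to\mathcal H$ is a homogeneous map with $B_\theta(x)(\theta)=x$, $\|B_\theta(x)\|_{\mathcal H}\le C\|x\|$, chosen so that $B_\theta(ux)=uB_\theta(x)$ for every measurable $u$ with values in $\{-1,1\}$, and $\mathrm{supp}\,B_\theta(x)(z)\subset\mathrm{supp}\,x$. Different choices change $\Omega_\theta$ by a bounded map $X_\theta\to X_\theta$. $\Omega:X\to L_0$ is trivial on a subspace $W$ if there are a linear map $\ell:W\to L_0$ and a constant $C$ with $\Omega x-\ell x\in X$, $\|\Omega x-\ell x\|\le C\|x\|$ for all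 $x\in W$; it is disjointly singular if it is not trivial on the closed span of any infinite sequence of nonzero disjointly supported vectors. *)

theory Defs
  imports "HOL-Analysis.Analysis"
begin

section \<open>Koethe function spaces\<close>

text \<open>
  A space of (classes of) functions is given by the set of all representatives together with a
  seminorm on it. Almost everywhere equal functions are never identified; instead, spaces are
  saturated under almost everywhere equality and statements about elements of \<open>L\<^sub>0\<close> are read
  almost everywhere. The values of \<open>nrm X\<close> outside \<open>carr X\<close> are irrelevant.
\<close>

record 'a fspace =
  carr :: "('a \<Rightarrow> complex) set"
  nrm :: "('a \<Rightarrow> complex) \<Rightarrow> real"

definition ae_eq :: "'a measure \<Rightarrow> ('a \<Rightarrow> complex) \<Rightarrow> ('a \<Rightarrow> complex) \<Rightarrow> bool" where
  "ae_eq M f g \<longleftrightarrow> (AE t in M. f t = g t)"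

definition supp_subset :: "'a measure \<Rightarrow> ('a \<Rightarrow> complex) \<Rightarrow> ('a \<Rightarrow> complex) \<Rightarrow> bool" where
  "supp_subset M f g \<longleftrightarrow> (AE t in M. f t \<noteq> 0 \<longrightarrow> g t \<noteq> 0)"

definition linear_subspace :: "('a \<Rightarrow> complex) set \<Rightarrow> bool" where
  "linear_subspace V \<longleftrightarrow>
     (\<lambda>_. 0) \<in> V \<and>
     (\<forall>f\<in>V. \<forall>g\<in>V. (\<lambda>t. f t + g t) \<in> V) \<and>
     (\<forall>c. \<forall>f\<in>V. (\<lambda>t. c * f t) \<in> V)"

text \<open>The ideal property, with the inequality read almost everywhere, forces \<open>carr X\<close> to be
  saturated under almost everywhere equality and \<open>nrm X\<close> to be well defined on classes.\<close>

definition koethe_space :: "'a measure \<Rightarrow> 'a fspace \<Rightarrow> bool" where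
  "koethe_space M X \<longleftrightarrow>
     sigma_finite_measure M \<and>
     carr X \<subseteq> borel_measurable M \<and>
     linear_subspace (carr X) \<and>
     (\<forall>f\<in>carr X. 0 \<le> nrm X f \<and> (nrm X f = 0 \<longleftrightarrow> ae_eq M f (\<lambda>_. 0))) \<and>
     (\<forall>c. \<forall>f\<in>carr X. nrm X (\<lambda>t. c * f t) = cmod c * nrm X f) \<and>
     (\<forall>f\<in>carr X. \<forall>g\<in>carr X. nrm X (\<lambda>t. f t + g t) \<le> nrm X f + nrm X g) \<and>
     (\<forall>f\<in>borel_measurable M. \<forall>g\<in>carr X. (AE t in M. cmod (f t) \<le> cmod (g t)) \<longrightarrow>
        f \<in> carr X \<and> nrm X f \<le> nrm X g) \<and>
     (\<forall>f. (\<forall>n. f n \<in> carr X) \<and>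
          (\<forall>e>0. \<exists>N::nat. \<forall>m\<ge>N. \<forall>n\<ge>N. nrm X (\<lambda>t. f m t - f n t) < e) \<longrightarrow>
        (\<exists>g\<in>carr X. (\<lambda>n. nrm X (\<lambda>t. f n t - g t)) \<longlonglongrightarrow> 0))"

text \<open>A space with a 1-unconditional basis, identified with its space of coefficient sequences.\<close>

definition unconditional_basis_space :: "nat measure \<Rightarrow> nat fspace \<Rightarrow> bool" where
  "unconditional_basis_space M X \<longleftrightarrow>
     M = count_space UNIV \<and> koethe_space M X \<and>
     (\<forall>k. (\<lambda>i. if i = k then 1 else 0) \<in> carr X) \<and>
     (\<forall>x\<in>carr X. (\<lambda>N. nrm X (\<lambda>i. x i - (if i < N then x i else 0))) \<longlonglongrightarrow> 0)"

text \<open>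
  The dual consists of the bounded linear functionals on \<open>carr X\<close>, extended by 0 to all functions
  so that each functional has a unique representative. It is again a space of functions, hence
  \<open>dual (dual X)\<close> is the bidual.
\<close>

definition dual :: "'a fspace \<Rightarrow> ('a \<Rightarrow> complex) fspace" where
  "dual X =
     \<lparr> carr = {\<phi>. (\<forall>f. f \<notin> carr X \<longrightarrow> \<phi> f = 0) \<and>
                 (\<forall>f\<in>carr X. \<forall>g\<in>carr X. \<phi> (\<lambda>t. f t + g t) = \<phi> f + \<phi> g) \<and>
                 (\<forall>c. \<forall>f\<in>carr X. \<phi> (\<lambda>t. c * f t) = c * \<phi> f) \<and>
                 (\<exists>C. \<forall>f\<in>carr X. cmod (\<phi> f) \<le> C * nrm X f)},
       nrm = (\<lambda>\<phi>. Sup {cmod (\<phi> f) | f. f \<in> carr X \<and> nrm X f \<le> 1}) \<rparr>"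

definition reflexive_space :: "'a fspace \<Rightarrow> bool" where
  "reflexive_space X \<longleftrightarrow>
     (\<forall>\<Phi>\<in>carr (dual (dual X)). \<exists>f\<in>carr X. \<forall>\<phi>\<in>carr (dual X). \<Phi> \<phi> = \<phi> f)"


section \<open>Subspaces spanned by disjointly supported vectors\<close>

definition disjoint_seq :: "'a measure \<Rightarrow> 'a fspace \<Rightarrow> (nat \<Rightarrow> 'a \<Rightarrow> complex) \<Rightarrow> bool" where
  "disjoint_seq M X u \<longleftrightarrow>
     (\<forall>k. u k \<in> carr X \<and> \<not> ae_eq M (u k) (\<lambda>_. 0)) \<and>
     (\<forall>j k. j \<noteq> k \<longrightarrow> (AE t in M. u j t = 0 \<or> u k t = 0))"

definition successive_seq :: "nat measure \<Rightarrow> nat fspace \<Rightarrow> (nat \<Rightarrow> nat \<Rightarrow> complex) \<Rightarrow> bool" where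
  "successive_seq M X u \<longleftrightarrow>
     (\<forall>k. u k \<in> carr X \<and> \<not> ae_eq M (u k) (\<lambda>_. 0)) \<and>
     (\<forall>j k s t. j < k \<and> u j s \<noteq> 0 \<and> u k t \<noteq> 0 \<longrightarrow> s < t)"

definition closed_span :: "'a fspace \<Rightarrow> (nat \<Rightarrow> 'a \<Rightarrow> complex) \<Rightarrow> ('a \<Rightarrow> complex) set" where
  "closed_span X u =
     {x \<in> carr X. \<forall>e>0. \<exists>(N::nat) c. nrm X (\<lambda>t. x t - (\<Sum>k<N. c k * u k t)) < e}"

definition expands :: "'a fspace \<Rightarrow> (nat \<Rightarrow> 'a \<Rightarrow> complex) \<Rightarrow> (nat \<Rightarrow> complex) \<Rightarrow> ('a \<Rightarrow> complex) \<Rightarrow> bool"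
  where "expands X u a x \<longleftrightarrow> x \<in> carr X \<and>
     (\<lambda>N. nrm X (\<lambda>t. x t - (\<Sum>k<N. a k * (u k t / complex_of_real (nrm X (u k)))))) \<longlonglongrightarrow> 0"

text \<open>
  The closed span of \<open>u\<close>, regarded as a space on \<open>\<nat>\<close> through the coefficients with respect to the
  normalized sequence. The element chosen by \<open>SOME\<close> is unique up to almost everywhere equality.
\<close>

definition span_space :: "'a fspace \<Rightarrow> (nat \<Rightarrow> 'a \<Rightarrow> complex) \<Rightarrow> nat fspace" where
  "span_space X u =
     \<lparr> carr = {a. \<exists>x. expands X u a x}, nrm = (\<lambda>a. nrm X (SOME x. expands X u a x)) \<rparr>"


section \<open>Standard classes\<close>

text \<open>\<open>S M X\<close> is the set of finite families that belong to the class as families in the space \<open>X\<close>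
  over \<open>M\<close>. Below, \<open>K\<close> is the kind of spaces on which the class is defined and \<open>G\<close> the kind of
  sequences generating the subspaces \<open>W\<close>.\<close>

type_synonym 'a family_class = "'a measure \<Rightarrow> 'a fspace \<Rightarrow> ('a \<Rightarrow> complex) list set"

definition class_on :: "('a measure \<Rightarrow> 'a fspace \<Rightarrow> bool) \<Rightarrow> 'a family_class \<Rightarrow> bool" where
  "class_on K S \<longleftrightarrow> (\<forall>M X. K M X \<longrightarrow> S M X \<subseteq> lists (carr X))"

text \<open>Membership passes to smaller supports, also between two spaces over the same measure space.\<close>

definition support_hereditary :: "('a measure \<Rightarrow> 'a fspace \<Rightarrow> bool) \<Rightarrow> 'a family_class \<Rightarrow> bool" where
  "support_hereditary K S \<longleftrightarrow>
     (\<forall>M X Y xs zs. K M X \<and> K M Y \<and> xs \<in> S M X \<and> zs \<in> lists (carr Y) \<and>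
        list_all2 (supp_subset M) zs xs \<longrightarrow> zs \<in> S M Y)"

definition lifts_from_spans ::
  "('a measure \<Rightarrow> 'a fspace \<Rightarrow> bool) \<Rightarrow>
   ('a measure \<Rightarrow> 'a fspace \<Rightarrow> (nat \<Rightarrow> 'a \<Rightarrow> complex) \<Rightarrow> bool) \<Rightarrow>
   'a family_class \<Rightarrow> nat family_class \<Rightarrow> bool" where
  "lifts_from_spans K G S T \<longleftrightarrow>
     (\<forall>M X u as xs. K M X \<and> G M X u \<and> as \<in> T (count_space UNIV) (span_space X u) \<and>
        list_all2 (expands X u) as xs \<longrightarrow> xs \<in> S M X)"

text \<open>
  A standard class for Koethe function spaces ranges over spaces on arbitrary measure spaces. Here
  it is given by its restrictions \<open>S\<close> to the measure spaces over the type \<open>'a\<close> and \<open>T\<close> to those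
  over \<open>nat\<close>, where the subspaces \<open>W\<close> live.
\<close>

definition standard_class :: "'a family_class \<Rightarrow> nat family_class \<Rightarrow> bool" where
  "standard_class S T \<longleftrightarrow>
     class_on koethe_space S \<and> class_on koethe_space T \<and>
     support_hereditary koethe_space S \<and> support_hereditary koethe_space T \<and>
     lifts_from_spans koethe_space disjoint_seq S T \<and>
     lifts_from_spans koethe_space disjoint_seq T T"

definition standard_basis_class :: "nat family_class \<Rightarrow> bool" where
  "standard_basis_class T \<longleftrightarrow>
     class_on unconditional_basis_space T \<and>
     support_hereditary unconditional_basis_space T \<and>
     lifts_from_spans unconditional_basis_space successive_seq T T"

text \<open>All norms are nonnegative, so inserting 0 only fixes the supremum over the empty set.\<close>

definition growth :: "'a fspace \<Rightarrow> ('a \<Rightarrow> complex) list set \<Rightarrow> nat \<Rightarrow> real" where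
  "growth X F n =
     Sup (insert 0 {nrm X (\<lambda>t. \<Sum>x\<leftarrow>xs. x t) | xs.
        xs \<in> F \<and> length xs = n \<and> (\<forall>x\<in>set xs. x \<in> carr X \<and> nrm X x \<le> 1)})"


section \<open>Complex interpolation\<close>

text \<open>Two Koethe function spaces over the same measure space embed continuously into \<open>L\<^sub>0\<close>
  and therefore always form an interpolation couple.\<close>

definition sum_space :: "'a fspace \<Rightarrow> 'a fspace \<Rightarrow> 'a fspace" where
  "sum_space X0 X1 =
     \<lparr> carr = {(\<lambda>t. a t + b t) | a b. a \<in> carr X0 \<and> b \<in> carr X1},
       nrm = (\<lambda>f. Inf {nrm X0 a + nrm X1 b | a b.
                a \<in> carr X0 \<and> b \<in> carr X1 \<and> f = (\<lambda>t. a t + b t)}) \<rparr>"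

definition strip :: "complex set" where
  "strip = {z. 0 \<le> Re z \<and> Re z \<le> 1}"

definition bounded_in :: "'a fspace \<Rightarrow> 'b set \<Rightarrow> ('b \<Rightarrow> 'a \<Rightarrow> complex) \<Rightarrow> bool" where
  "bounded_in X A g \<longleftrightarrow> (\<forall>z\<in>A. g z \<in> carr X) \<and> (\<exists>C. \<forall>z\<in>A. nrm X (g z) \<le> C)"

definition continuous_in ::
  "'a fspace \<Rightarrow> 'b::topological_space set \<Rightarrow> ('b \<Rightarrow> 'a \<Rightarrow> complex) \<Rightarrow> bool" where
  "continuous_in X A g \<longleftrightarrow>
     (\<forall>z\<in>A. ((\<lambda>w. nrm X (\<lambda>t. g w t - g z t)) \<longlongrightarrow> 0) (at z within A))"

definition complex_deriv_in ::
  "'a fspace \<Rightarrow> (complex \<Rightarrow> 'a \<Rightarrow> complex) \<Rightarrow> ('a \<Rightarrow> complex) \<Rightarrow> complex \<Rightarrow> bool" where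
  "complex_deriv_in X g d z \<longleftrightarrow> d \<in> carr X \<and>
     ((\<lambda>w. nrm X (\<lambda>t. (g w t - g z t) / (w - z) - d t)) \<longlongrightarrow> 0) (at z)"

definition calderon :: "'a fspace \<Rightarrow> 'a fspace \<Rightarrow> (complex \<Rightarrow> 'a \<Rightarrow> complex) set" where
  "calderon X0 X1 =
     {g. bounded_in (sum_space X0 X1) strip g \<and>
         continuous_in (sum_space X0 X1) strip g \<and>
         (\<forall>z\<in>interior strip. \<exists>d. complex_deriv_in (sum_space X0 X1) g d z) \<and>
         bounded_in X0 UNIV (\<lambda>t::real. g (Complex 0 t)) \<and>
         continuous_in X0 UNIV (\<lambda>t::real. g (Complex 0 t)) \<and>
         bounded_in X1 UNIV (\<lambda>t::real. g (Complex 1 t)) \<and>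
         continuous_in X1 UNIV (\<lambda>t::real. g (Complex 1 t))}"

definition calderon_norm :: "'a fspace \<Rightarrow> 'a fspace \<Rightarrow> (complex \<Rightarrow> 'a \<Rightarrow> complex) \<Rightarrow> real" where
  "calderon_norm X0 X1 g =
     (SUP t::real. max (nrm X0 (g (Complex 0 t))) (nrm X1 (g (Complex 1 t))))"

text \<open>Changing a member of \<open>calderon X0 X1\<close> at one point on a null set yields another member of the
  same norm, so the equations between functions below do not depend on representatives.\<close>

definition interp_space :: "'a fspace \<Rightarrow> 'a fspace \<Rightarrow> real \<Rightarrow> 'a fspace" where
  "interp_space X0 X1 \<theta> =
     \<lparr> carr = {g (complex_of_real \<theta>) | g. g \<in> calderon X0 X1},
       nrm = (\<lambda>x. Inf {calderon_norm X0 X1 g | g.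
                g \<in> calderon X0 X1 \<and> g (complex_of_real \<theta>) = x}) \<rparr>"

definition interp_selector ::
  "'a measure \<Rightarrow> 'a fspace \<Rightarrow> 'a fspace \<Rightarrow> real \<Rightarrow>
   (('a \<Rightarrow> complex) \<Rightarrow> complex \<Rightarrow> 'a \<Rightarrow> complex) \<Rightarrow> bool" where
  "interp_selector M X0 X1 \<theta> B \<longleftrightarrow>
     (let X = interp_space X0 X1 \<theta> in
      (\<forall>x\<in>carr X. B x \<in> calderon X0 X1 \<and> ae_eq M (B x (complex_of_real \<theta>)) x) \<and>
      (\<exists>C. \<forall>x\<in>carr X. calderon_norm X0 X1 (B x) \<le> C * nrm X x) \<and>
      (\<forall>x\<in>carr X. \<forall>y\<in>carr X. ae_eq M x y \<longrightarrow> (\<forall>z\<in>strip. ae_eq M (B x z) (B y z))) \<and>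
      (\<forall>c. \<forall>x\<in>carr X. \<forall>z\<in>strip. ae_eq M (B (\<lambda>t. c * x t) z) (\<lambda>t. c * B x z t)) \<and>
      (\<forall>w\<in>borel_measurable M. (\<forall>t\<in>space M. w t \<in> {-1, 1}) \<longrightarrow>
         (\<forall>x\<in>carr X. \<forall>z\<in>strip. ae_eq M (B (\<lambda>t. w t * x t) z) (\<lambda>t. w t * B x z t))) \<and>
      (\<forall>x\<in>carr X. \<forall>z\<in>strip. supp_subset M (B x z) x))"

definition induced_centralizer ::
  "'a measure \<Rightarrow> 'a fspace \<Rightarrow> 'a fspace \<Rightarrow> real \<Rightarrow> (('a \<Rightarrow> complex) \<Rightarrow> 'a \<Rightarrow> complex) \<Rightarrow> bool" where
  "induced_centralizer M X0 X1 \<theta> \<Omega> \<longleftrightarrow>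
     (\<exists>B. interp_selector M X0 X1 \<theta> B \<and>
        (\<forall>x\<in>carr (interp_space X0 X1 \<theta>).
           complex_deriv_in (sum_space X0 X1) (B x) (\<Omega> x) (complex_of_real \<theta>)))"


section \<open>Triviality and singularity\<close>

definition trivial_on ::
  "'a measure \<Rightarrow> 'a fspace \<Rightarrow> (('a \<Rightarrow> complex) \<Rightarrow> 'a \<Rightarrow> complex) \<Rightarrow> ('a \<Rightarrow> complex) set \<Rightarrow> bool" where
  "trivial_on M X \<Omega> W \<longleftrightarrow>
     (\<exists>l C. l \<in> W \<rightarrow> borel_measurable M \<and>
        (\<forall>x\<in>W. \<forall>y\<in>W. ae_eq M x y \<longrightarrow> ae_eq M (l x) (l y)) \<and>
        (\<forall>x\<in>W. \<forall>y\<in>W. ae_eq M (l (\<lambda>t. x t + y t)) (\<lambda>t. l x t + l y t)) \<and>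
        (\<forall>c. \<forall>x\<in>W. ae_eq M (l (\<lambda>t. c * x t)) (\<lambda>t. c * l x t)) \<and>
        (\<forall>x\<in>W. (\<lambda>t. \<Omega> x t - l x t) \<in> carr X \<and>
                nrm X (\<lambda>t. \<Omega> x t - l x t) \<le> C * nrm X x))"

definition disjointly_singular ::
  "'a measure \<Rightarrow> 'a fspace \<Rightarrow> (('a \<Rightarrow> complex) \<Rightarrow> 'a \<Rightarrow> complex) \<Rightarrow> bool" where
  "disjointly_singular M X \<Omega> \<longleftrightarrow>
     (\<forall>u. disjoint_seq M X u \<longrightarrow> \<not> trivial_on M X \<Omega> (closed_span X u))"

end

theory Submission
  imports Defs "HOL-Complex_Analysis.Conformal_Mappings"
begin

text \<open>
  Let \<open>B\<close> be the selector of the Calderon space and \<open>x\<^sub>1, \<dots>, x\<^sub>n\<close> a family of the class in the unit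
  ball of \<open>X\<^sub>\<theta>\<close>. On the boundary lines the families \<open>B(x\<^sub>i)(z)\<close> belong to the class, so
  \<open>exp (L (z - \<theta>)) \<Sum> B(x\<^sub>i)(z)\<close> with \<open>L = ln (M\<^sub>0 / M\<^sub>1)\<close> has norm at most
  \<open>C M\<^sub>0 powr (1 - \<theta>) M\<^sub>1 powr \<theta>\<close>. At \<open>\<theta>\<close> it takes the same value as \<open>B(\<Sum> x\<^sub>i)\<close>, hence the
  derivatives at \<open>\<theta>\<close> differ by an element of \<open>X\<^sub>\<theta>\<close>:
  \<open>\<parallel>\<Sum> \<Omega>(x\<^sub>i) + L \<Sum> x\<^sub>i - \<Omega>(\<Sum> x\<^sub>i)\<parallel> \<le> C M\<^sub>0 powr (1 - \<theta>) M\<^sub>1 powr \<theta>\<close>.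

  If \<open>\<Omega>\<close> is trivial on the span of disjoint vectors, then averaging the linear map over sign changes
  makes it preserve supports. The differences \<open>\<Omega>(x\<^sub>i) - l(x\<^sub>i)\<close> then form, up to scaling, a family of
  the class, so that their sum is bounded by the same quantity, and the terms in \<open>l\<close> cancel. What
  remains is the bound for \<open>L \<Sum> x\<^sub>i\<close>. For spaces with a basis, a gliding hump argument replaces the
  disjoint vectors by successive ones.

  Vector-valued holomorphy is reduced to the scalar case by the Hahn--Banach theorem.
\<close>

section \<open>Seminormed function spaces\<close>

text \<open>A class is known only through supports: a family may move to another space as long as no
  support grows. \<open>B\<close> respects supports by assumption, whereas a linear map
  approximating \<open>\<Omega>\<close> takes values in L0 with arbitrary supports; without the
  averaging, the errors \<open>\<Omega> x - l x\<close> need not form a family of the class.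

  The value of \<open>L\<close> is forced. The exponential factor has modulus
  \<open>exp (- L \<theta>)\<close> on the left line and \<open>exp (L (1 - \<theta>))\<close> on
  the right one, and \<open>L\<close> is the number for which the two weighted bounds coincide. The
  derivative of the factor at \<open>\<theta>\<close> is \<open>L\<close>, which is how the
  logarithm enters.

  The derivative at \<open>\<theta>\<close> of a function vanishing there is a value of the quotient
  by \<open>z - \<theta>\<close>; this costs \<open>1 / min \<theta> (1 - \<theta>)\<close>, the
  inverse distance to the boundary.

  Functions are never identified almost everywhere. The identities for \<open>B\<close> hold for
  each \<open>z\<close> outside a null set that depends on \<open>z\<close>, so they are
  differentiated only after applying functionals on X0 + X1, which do not see null sets. Successive
  vectors are needed for bases because lifting from spans is guaranteed only for those.\<close>

lemma suminf_tail_tendsto_zero: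
  fixes c :: "nat \<Rightarrow> real"
  assumes "summable c" shows "(\<lambda>N. \<Sum>n. c (n + N)) \<longlonglongrightarrow> 0"
proof -
  have "(\<Sum>n. c (n + N)) = suminf c - (\<Sum>n<N. c n)" for N
    using assms by (simp add: suminf_minus_initial_segment)
  moreover have "(\<lambda>N. suminf c - (\<Sum>n<N. c n)) \<longlonglongrightarrow> suminf c - suminf c"
    using summable_LIMSEQ[OF assms] by (intro tendsto_intros)
  ultimately show ?thesis by simp
qed

text \<open>The part of the Koethe axioms that mentions no measure. Sums, interpolation spaces and
  spans are shown to be seminormed first, so that the norm calculus is available when their
  remaining axioms are proved.\<close>

locale seminormed =
  fixes X :: "'a fspace"
  assumes subspace: "linear_subspace (carr X)"
    and nrm_nonneg [simp]: "f \<in> carr X \<Longrightarrow> 0 \<le> nrm X f"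
    and nrm_cmult: "f \<in> carr X \<Longrightarrow> nrm X (\<lambda>t. c * f t) = cmod c * nrm X f"
    and nrm_add: "\<lbrakk>f \<in> carr X; g \<in> carr X\<rbrakk> \<Longrightarrow> nrm X (\<lambda>t. f t + g t) \<le> nrm X f + nrm X g"
begin

lemma zero_carr [simp]: "(\<lambda>_. 0) \<in> carr X"
  using subspace by (simp add: linear_subspace_def)

lemma add_carr [simp]: "\<lbrakk>f \<in> carr X; g \<in> carr X\<rbrakk> \<Longrightarrow> (\<lambda>t. f t + g t) \<in> carr X"
  using subspace by (simp add: linear_subspace_def)

lemma cmult_carr [simp]: "f \<in> carr X \<Longrightarrow> (\<lambda>t. c * f t) \<in> carr X"
  using subspace by (simp add: linear_subspace_def)

lemma uminus_carr [simp]: "f \<in> carr X \<Longrightarrow> (\<lambda>t. - f t) \<in> carr X"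
  using cmult_carr[of f "-1"] by simp

lemma diff_carr [simp]: "\<lbrakk>f \<in> carr X; g \<in> carr X\<rbrakk> \<Longrightarrow> (\<lambda>t. f t - g t) \<in> carr X"
  using add_carr[of f "\<lambda>t. - g t"] by simp

lemma divide_carr [simp]: "f \<in> carr X \<Longrightarrow> (\<lambda>t. f t / c) \<in> carr X"
  using cmult_carr[of f "inverse c"] by (simp add: field_simps)

lemma sum_carr [simp]: "(\<And>k. k \<in> A \<Longrightarrow> f k \<in> carr X) \<Longrightarrow> (\<lambda>t. \<Sum>k\<in>A. f k t) \<in> carr X"
  by (induction A rule: infinite_finite_induct) auto

lemma sum_list_carr [simp]: "set xs \<subseteq> carr X \<Longrightarrow> (\<lambda>t. \<Sum>x\<leftarrow>xs. x t) \<in> carr X"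
  by (induction xs) auto

lemma nrm_zero [simp]: "nrm X (\<lambda>_. 0) = 0"
  using nrm_cmult[of "\<lambda>_. 0" 0] by simp

lemma nrm_uminus: "f \<in> carr X \<Longrightarrow> nrm X (\<lambda>t. - f t) = nrm X f"
  using nrm_cmult[of f "-1"] by simp

lemma nrm_divide: "f \<in> carr X \<Longrightarrow> nrm X (\<lambda>t. f t / c) = nrm X f / cmod c"
  using nrm_cmult[of f "inverse c"] by (simp add: divide_inverse norm_inverse mult.commute)

lemma nrm_diff: "\<lbrakk>f \<in> carr X; g \<in> carr X\<rbrakk> \<Longrightarrow> nrm X (\<lambda>t. f t - g t) \<le> nrm X f + nrm X g"
  using nrm_add[of f "\<lambda>t. - g t"] by (simp add: nrm_uminus)

lemma nrm_diff_commute: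
  "\<lbrakk>f \<in> carr X; g \<in> carr X\<rbrakk> \<Longrightarrow> nrm X (\<lambda>t. f t - g t) = nrm X (\<lambda>t. g t - f t)"
  using nrm_uminus[of "\<lambda>t. f t - g t"] by simp

lemma nrm_diff_triangle:
  assumes "f \<in> carr X" "g \<in> carr X" "h \<in> carr X"
  shows "nrm X (\<lambda>t. f t - h t) \<le> nrm X (\<lambda>t. f t - g t) + nrm X (\<lambda>t. g t - h t)"
  using nrm_add[of "\<lambda>t. f t - g t" "\<lambda>t. g t - h t"] assms by simp

lemma nrm_le_add_diff:
  assumes "f \<in> carr X" "g \<in> carr X"
  shows "nrm X f \<le> nrm X g + nrm X (\<lambda>t. f t - g t)"
  using nrm_add[of g "\<lambda>t. f t - g t"] assms by simp

lemma nrm_sum: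
  "(\<And>k. k \<in> A \<Longrightarrow> f k \<in> carr X) \<Longrightarrow> nrm X (\<lambda>t. \<Sum>k\<in>A. f k t) \<le> (\<Sum>k\<in>A. nrm X (f k))"
proof (induction A rule: infinite_finite_induct)
  case (insert a A)
  have "nrm X (\<lambda>t. \<Sum>k\<in>insert a A. f k t) = nrm X (\<lambda>t. f a t + (\<Sum>k\<in>A. f k t))"
    using insert by simp
  also have "\<dots> \<le> nrm X (f a) + nrm X (\<lambda>t. \<Sum>k\<in>A. f k t)"
    using insert by (intro nrm_add) auto
  finally show ?case using insert by force
qed auto

lemma nrm_sum_list:
  "\<lbrakk>set xs \<subseteq> carr X; \<And>x. x \<in> set xs \<Longrightarrow> nrm X x \<le> c\<rbrakk> \<Longrightarrow>
     nrm X (\<lambda>t. \<Sum>x\<leftarrow>xs. x t) \<le> of_nat (length xs) * c"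
proof (induction xs)
  case (Cons x xs)
  have "nrm X (\<lambda>t. \<Sum>y\<leftarrow>(x # xs). y t) \<le> nrm X x + nrm X (\<lambda>t. \<Sum>y\<leftarrow>xs. y t)"
    using Cons.prems nrm_add[of x "\<lambda>t. \<Sum>y\<leftarrow>xs. y t"] by simp
  also have "\<dots> \<le> c + of_nat (length xs) * c"
    using Cons by (intro add_mono) auto
  finally show ?case by (simp add: algebra_simps)
qed auto

lemma tendsto_nrm_diff:
  assumes "\<And>n. f n \<in> carr X" "g \<in> carr X" "h \<in> carr X"
    and "(\<lambda>n. nrm X (\<lambda>t. f n t - g t)) \<longlonglongrightarrow> 0"
  shows "(\<lambda>n. nrm X (\<lambda>t. f n t - h t)) \<longlonglongrightarrow> nrm X (\<lambda>t. g t - h t)"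
proof (rule LIM_zero_cancel, rule Lim_null_comparison[OF _ assms(4)])
  have "\<bar>nrm X (\<lambda>t. f n t - h t) - nrm X (\<lambda>t. g t - h t)\<bar> \<le> nrm X (\<lambda>t. f n t - g t)" for n
    using nrm_diff_triangle[of "f n" g h] nrm_diff_triangle[of g "f n" h] assms(1-3)
      nrm_diff_commute[of g "f n"] by simp
  then show "\<forall>\<^sub>F n in sequentially. norm (nrm X (\<lambda>t. f n t - h t) - nrm X (\<lambda>t. g t - h t))
      \<le> nrm X (\<lambda>t. f n t - g t)"
    by simp
qed

definition complete_space :: bool where
  "complete_space \<longleftrightarrow>
     (\<forall>f. (\<forall>n. f n \<in> carr X) \<and>
          (\<forall>e>0. \<exists>N::nat. \<forall>m\<ge>N. \<forall>n\<ge>N. nrm X (\<lambda>t. f m t - f n t) < e) \<longrightarrow>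
        (\<exists>g\<in>carr X. (\<lambda>n. nrm X (\<lambda>t. f n t - g t)) \<longlonglongrightarrow> 0))"

text \<open>A subsequence with geometrically small increments turns a Cauchy sequence into a
  telescoping series, and a Cauchy sequence with a convergent subsequence converges. The series form
  suits norms defined as infima: a nearly optimal representative can be chosen for each term
  separately.\<close>

lemma complete_spaceI:
  assumes series: "\<And>f. \<lbrakk>\<And>n. f n \<in> carr X; \<And>n. nrm X (f n) \<le> (1/2)^n\<rbrakk> \<Longrightarrow>
      \<exists>g\<in>carr X. (\<lambda>N. nrm X (\<lambda>t. g t - (\<Sum>n<N. f n t))) \<longlonglongrightarrow> 0"
  shows complete_space
  unfolding complete_space_def
proof (intro allI impI, elim conjE)
  fix f :: "nat \<Rightarrow> 'a \<Rightarrow> complex"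
  assume f: "\<forall>n. f n \<in> carr X"
    and C: "\<forall>e>0. \<exists>N::nat. \<forall>m\<ge>N. \<forall>n\<ge>N. nrm X (\<lambda>t. f m t - f n t) < e"
  have "\<forall>i. \<exists>N. \<forall>m\<ge>N. \<forall>n\<ge>N. nrm X (\<lambda>t. f m t - f n t) < (1/2)^i"
    using C by simp
  then obtain K where K: "\<And>i m n. \<lbrakk>m \<ge> K i; n \<ge> K i\<rbrakk> \<Longrightarrow> nrm X (\<lambda>t. f m t - f n t) < (1/2)^i"
    by metis
  \<comment> \<open>Summing the thresholds makes them monotone while keeping
    \<open>k i \<ge> K i\<close>.\<close>
  define k where "k i = (\<Sum>j\<le>i. K j)" for i
  have kK: "k i \<ge> K i" for i
    unfolding k_def by (rule member_le_sum) auto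
  have k_Suc: "k (Suc i) \<ge> k i" for i
    unfolding k_def by simp
  have "\<exists>g\<in>carr X. (\<lambda>N. nrm X (\<lambda>t. g t - (\<Sum>i<N. f (k (Suc i)) t - f (k i) t))) \<longlonglongrightarrow> 0"
  proof (rule series)
    show "nrm X (\<lambda>t. f (k (Suc i)) t - f (k i) t) \<le> (1/2)^i" for i
      using K[of i "k (Suc i)" "k i"] kK[of i] k_Suc[of i] by simp
  qed (use f in auto)
  then obtain g where g: "g \<in> carr X"
    and lim: "(\<lambda>N. nrm X (\<lambda>t. g t - (\<Sum>i<N. f (k (Suc i)) t - f (k i) t))) \<longlonglongrightarrow> 0"
    by blast
  define h where "h t = g t + f (k 0) t" for t
  have h: "h \<in> carr X" unfolding h_def using f g by simp
  have tele: "(\<Sum>i<N. f (k (Suc i)) t - f (k i) t) = f (k N) t - f (k 0) t" for N t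
    by (rule sum_lessThan_telescope)
  have "(\<lambda>t. g t - (\<Sum>i<N. f (k (Suc i)) t - f (k i) t)) = (\<lambda>t. h t - f (k N) t)" for N
    unfolding tele by (simp add: h_def algebra_simps)
  then have lim': "(\<lambda>N. nrm X (\<lambda>t. h t - f (k N) t)) \<longlonglongrightarrow> 0"
    using lim by simp
  have "(\<lambda>n. nrm X (\<lambda>t. f n t - h t)) \<longlonglongrightarrow> 0"
  proof (rule LIMSEQ_I)
    fix e :: real assume "0 < e"
    obtain N where N: "\<And>n. n \<ge> N \<Longrightarrow> nrm X (\<lambda>t. h t - f (k n) t) < e / 2"
      using LIMSEQ_D[OF lim', of "e/2"] \<open>0 < e\<close> by (auto simp: f h)
    have "(\<lambda>i. (1/2::real)^i) \<longlonglongrightarrow> 0" by (rule LIMSEQ_realpow_zero) auto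
    then obtain i0 where i0: "(1/2::real)^i0 < e / 2"
      using LIMSEQ_D[of "\<lambda>i. (1/2::real)^i" 0 "e/2"] \<open>0 < e\<close> by auto
    define i where "i = max i0 N"
    have "nrm X (\<lambda>t. f n t - h t) < e" if "n \<ge> k i" for n
    proof -
      have "(1/2::real)^i \<le> (1/2)^i0" by (rule power_decreasing) (auto simp: i_def)
      moreover have "nrm X (\<lambda>t. f n t - f (k i) t) < (1/2)^i"
        using K[of i n "k i"] kK[of i] that by simp
      moreover have "nrm X (\<lambda>t. f (k i) t - h t) < e / 2"
        using N[of i] nrm_diff_commute[of h "f (k i)"] f h by (simp add: i_def)
      moreover have "nrm X (\<lambda>t. f n t - h t) \<le> nrm X (\<lambda>t. f n t - f (k i) t) + nrm X (\<lambda>t. f (k i) t - h t)"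
        using f h by (intro nrm_diff_triangle) auto
      ultimately show ?thesis using i0 by linarith
    qed
    then show "\<exists>no. \<forall>n\<ge>no. norm (nrm X (\<lambda>t. f n t - h t) - 0) < e"
      by (intro exI[of _ "k i"]) (simp add: f h)
  qed
  then show "\<exists>g\<in>carr X. (\<lambda>n. nrm X (\<lambda>t. f n t - g t)) \<longlonglongrightarrow> 0"
    using h by blast
qed

lemma complete_spaceD:
  assumes complete_space "\<And>n. f n \<in> carr X"
    "\<And>e. e > 0 \<Longrightarrow> \<exists>N::nat. \<forall>m\<ge>N. \<forall>n\<ge>N. nrm X (\<lambda>t. f m t - f n t) < e"
  shows "\<exists>g\<in>carr X. (\<lambda>n. nrm X (\<lambda>t. f n t - g t)) \<longlonglongrightarrow> 0"
  using assms unfolding complete_space_def by blast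

text \<open>The explicit tail bound is the point: it depends only on \<open>c\<close>, hence is
  uniform when the series depends on a point of the strip.\<close>

lemma complete_space_series:
  assumes complete_space and f: "\<And>n. f n \<in> carr X" and le: "\<And>n. nrm X (f n) \<le> c n" and c: "summable c"
  shows "\<exists>g\<in>carr X. \<forall>N. nrm X (\<lambda>t. g t - (\<Sum>n<N. f n t)) \<le> (\<Sum>n. c (n + N))"
proof -
  have c0: "c n \<ge> 0" for n using nrm_nonneg[OF f] le[of n] order_trans by blast
  have diff_le: "nrm X (\<lambda>t. (\<Sum>n<m. f n t) - (\<Sum>n<N. f n t)) \<le> (\<Sum>n. c (n + N))" if "N \<le> m" for N m
  proof -
    have eq: "(\<Sum>n<m. f n t) - (\<Sum>n<N. f n t) = (\<Sum>n\<in>{N..<m}. f n t)" for t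
      using that by (simp add: sum_diff_nat_ivl atLeast0LessThan[symmetric] del: atLeast0LessThan)
    have "nrm X (\<lambda>t. \<Sum>n\<in>{N..<m}. f n t) \<le> (\<Sum>n\<in>{N..<m}. nrm X (f n))"
      using f by (intro nrm_sum) auto
    also have "\<dots> \<le> (\<Sum>n\<in>{N..<m}. c n)" using le by (intro sum_mono) auto
    also have "\<dots> = (\<Sum>n<m-N. c (n + N))"
      using that by (intro sum.reindex_bij_witness[of _ "\<lambda>n. n + N" "\<lambda>n. n - N"]) auto
    also have "\<dots> \<le> (\<Sum>n. c (n + N))"
      using c c0 by (intro sum_le_suminf) (auto simp: summable_iff_shift)
    finally show ?thesis using eq by simp
  qed
  have "\<exists>g\<in>carr X. (\<lambda>m. nrm X (\<lambda>t. (\<Sum>n<m. f n t) - g t)) \<longlonglongrightarrow> 0"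
  proof (rule complete_spaceD[OF assms(1)])
    fix e :: real assume "e > 0"
    then obtain N where N: "(\<Sum>n. c (n + N)) < e/2"
      using order_tendstoD(2)[OF suminf_tail_tendsto_zero[OF c], of "e/2"]
      by (auto simp: eventually_sequentially)
    have "nrm X (\<lambda>t. (\<Sum>n<m. f n t) - (\<Sum>n<n'. f n t)) < e" if "m \<ge> N" "n' \<ge> N" for m n'
      using nrm_diff_triangle[of "\<lambda>t. \<Sum>n<m. f n t" "\<lambda>t. \<Sum>n<N. f n t" "\<lambda>t. \<Sum>n<n'. f n t"]
        nrm_diff_commute[of "\<lambda>t. \<Sum>n<N. f n t" "\<lambda>t. \<Sum>n<n'. f n t"]
        diff_le[OF that(1)] diff_le[OF that(2)] N f by simp
    then show "\<exists>N. \<forall>m\<ge>N. \<forall>n'\<ge>N. nrm X (\<lambda>t. (\<Sum>n<m. f n t) - (\<Sum>n<n'. f n t)) < e" by blast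
  qed (use f in auto)
  then obtain g where g: "g \<in> carr X" and lim: "(\<lambda>m. nrm X (\<lambda>t. (\<Sum>n<m. f n t) - g t)) \<longlonglongrightarrow> 0"
    by blast
  have "nrm X (\<lambda>t. g t - (\<Sum>n<N. f n t)) \<le> (\<Sum>n. c (n + N))" for N
  proof (rule LIMSEQ_le_const2)
    show "(\<lambda>m. nrm X (\<lambda>t. (\<Sum>n<m. f n t) - (\<Sum>n<N. f n t))) \<longlonglongrightarrow> nrm X (\<lambda>t. g t - (\<Sum>n<N. f n t))"
      by (rule tendsto_nrm_diff) (use f g lim in auto)
  qed (use diff_le in blast)
  with g show ?thesis by blast
qed

end


section \<open>The Hahn--Banach theorem\<close>

text \<open>Homogeneity is asked only as an inequality for positive factors. Applied to
  \<open>r\<close> and \<open>1/r\<close> it becomes an equality, and the inequality is easy to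
  preserve under infima.\<close>

definition sublinear_on :: "('a \<Rightarrow> complex) set \<Rightarrow> (('a \<Rightarrow> complex) \<Rightarrow> real) \<Rightarrow> bool" where
  "sublinear_on V q \<longleftrightarrow>
     (\<forall>f\<in>V. \<forall>g\<in>V. q (\<lambda>t. f t + g t) \<le> q f + q g) \<and>
     (\<forall>f\<in>V. \<forall>r>0. q (\<lambda>t. of_real r * f t) \<le> r * q f)"

text \<open>The device from the proof of Hahn-Banach by minimal sublinear functionals: it lowers
  \<open>q\<close> until it is linear along \<open>y\<close>. The value 0 off \<open>V\<close> lets
  functionals that agree on \<open>V\<close> be equal as functions, so that minimality yields an
  equation.\<close>

definition push_down :: "('a \<Rightarrow> complex) set \<Rightarrow> (('a \<Rightarrow> complex) \<Rightarrow> real) \<Rightarrow> ('a \<Rightarrow> complex) \<Rightarrow>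
    ('a \<Rightarrow> complex) \<Rightarrow> real" where
  "push_down V q y f =
     (if f \<in> V then INF s\<in>{0..}. q (\<lambda>t. f t + of_real s * y t) - s * q y else 0)"

context
  fixes V :: "('a \<Rightarrow> complex) set"
  assumes V: "linear_subspace V"
begin

lemma V_closed:
  "(\<lambda>_. 0) \<in> V" "f \<in> V \<Longrightarrow> g \<in> V \<Longrightarrow> (\<lambda>t. f t + g t) \<in> V" "f \<in> V \<Longrightarrow> (\<lambda>t. c * f t) \<in> V"
  "f \<in> V \<Longrightarrow> (\<lambda>t. - f t) \<in> V"
proof -
  show "(\<lambda>_. 0) \<in> V" "f \<in> V \<Longrightarrow> g \<in> V \<Longrightarrow> (\<lambda>t. f t + g t) \<in> V"
    and *: "\<And>c. f \<in> V \<Longrightarrow> (\<lambda>t. c * f t) \<in> V"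
    using V by (auto simp: linear_subspace_def)
  show "f \<in> V \<Longrightarrow> (\<lambda>t. - f t) \<in> V" using *[of "-1"] by simp
qed

lemma sublinear_on_mult:
  assumes "sublinear_on V q" "f \<in> V" "r \<ge> 0"
  shows "q (\<lambda>t. of_real r * f t) = r * q f"
proof -
  have le: "q (\<lambda>t. of_real r * f t) \<le> r * q f" if "f \<in> V" "r > 0" for f r
    using assms(1) that by (auto simp: sublinear_on_def)
  show ?thesis
  proof (cases "r = 0")
    case True
    \<comment> \<open>The factors 2 and 1/2 at the zero function give
      \<open>q 0 \<le> 2 * q 0\<close> and \<open>q 0 \<le> q 0 / 2\<close>, hence
      \<open>q 0 = 0\<close>.\<close>
    show ?thesis
      using le[of "\<lambda>_. 0" 2] le[of "\<lambda>_. 0" "1/2"] True V_closed by simp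
  next
    case False
    then have r: "r > 0" using assms by simp
    have "q f \<le> (1/r) * q (\<lambda>t. of_real r * f t)"
      using le[of "\<lambda>t. of_real r * f t" "1/r"] r assms V_closed by simp
    then show ?thesis using le[OF assms(2) r] r by (simp add: field_simps)
  qed
qed

lemma sublinear_on_add:
  "\<lbrakk>sublinear_on V q; f \<in> V; g \<in> V\<rbrakk> \<Longrightarrow> q (\<lambda>t. f t + g t) \<le> q f + q g"
  by (simp add: sublinear_on_def)

lemma sublinear_on_ge:
  assumes "sublinear_on V q" "f \<in> V"
  shows "- q (\<lambda>t. - f t) \<le> q f"
proof -
  have "q (\<lambda>t. f t + - f t) \<le> q f + q (\<lambda>t. - f t)"
    using assms V_closed(4)[of f] by (intro sublinear_on_add) auto
  then show ?thesis using sublinear_on_mult[OF assms(1), of f 0] assms by simp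
qed

text \<open>The infimum is finite because
  \<open>s * q y = q (s y) \<le> q (f + s y) + q (- f)\<close>. It stays sublinear because the
  parameters follow the arguments: \<open>s1 + s2\<close> serves a sum and \<open>r * s\<close> a
  multiple. The three inequalities are the choices \<open>s = 0\<close> and
  \<open>s = 1\<close>.\<close>

lemma push_down:
  assumes q: "sublinear_on V q" and y: "y \<in> V"
  shows "sublinear_on V (push_down V q y)" (is ?a)
    and "\<And>f. f \<in> V \<Longrightarrow> push_down V q y f \<le> q f"
    and "push_down V q y (\<lambda>t. - y t) \<le> - q y" (is ?c)
    and "\<And>f. f \<in> V \<Longrightarrow> push_down V q y f \<le> q (\<lambda>t. f t + y t) - q y"
proof -
  let ?h = "\<lambda>f s. q (\<lambda>t. f t + of_real s * y t) - s * q y"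
  have add: "q (\<lambda>t. f t + g t) \<le> q f + q g" if "f \<in> V" "g \<in> V" for f g
    using q that by (auto simp: sublinear_on_def)
  have bdd: "bdd_below (?h f ` {0..})" if f: "f \<in> V" for f
  proof (rule bdd_belowI2)
    fix s :: real assume "s \<in> {0..}"
    then have s: "s \<ge> 0" by simp
    have "q (\<lambda>t. of_real s * y t) = q (\<lambda>t. (f t + of_real s * y t) + - f t)" by simp
    also have "\<dots> \<le> q (\<lambda>t. f t + of_real s * y t) + q (\<lambda>t. - f t)"
      using f y V_closed by (intro add) auto
    finally show "- q (\<lambda>t. - f t) \<le> ?h f s"
      using sublinear_on_mult[OF q y s] by simp
  qed
  have le: "push_down V q y f \<le> ?h f s" if "f \<in> V" "s \<ge> 0" for f s
    unfolding push_down_def using that bdd by (auto intro: cINF_lower)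
  have ge: "c \<le> push_down V q y f" if "f \<in> V" "\<And>s. s \<ge> 0 \<Longrightarrow> c \<le> ?h f s" for f c
    unfolding push_down_def using that by (auto intro!: cINF_greatest)
  show "push_down V q y f \<le> q f" if "f \<in> V" for f
    using le[OF that, of 0] by simp
  show "push_down V q y f \<le> q (\<lambda>t. f t + y t) - q y" if "f \<in> V" for f
    using le[OF that, of 1] by simp
  show ?c
    using le[of "\<lambda>t. - y t" 1] y V_closed sublinear_on_mult[OF q y, of 0] by simp
  show ?a
    unfolding sublinear_on_def
  proof (intro conjI ballI allI impI)
    fix f g assume f: "f \<in> V" and g: "g \<in> V"
    have two: "push_down V q y (\<lambda>t. f t + g t) \<le> ?h f s1 + ?h g s2" if "s1 \<ge> 0" "s2 \<ge> 0" for s1 s2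
    proof -
      have "push_down V q y (\<lambda>t. f t + g t) \<le> ?h (\<lambda>t. f t + g t) (s1 + s2)"
        using f g that V_closed by (intro le) auto
      also have "q (\<lambda>t. f t + g t + of_real (s1 + s2) * y t)
          = q (\<lambda>t. (f t + of_real s1 * y t) + (g t + of_real s2 * y t))"
        by (simp add: algebra_simps)
      also have "\<dots> \<le> q (\<lambda>t. f t + of_real s1 * y t) + q (\<lambda>t. g t + of_real s2 * y t)"
        using f g y V_closed by (intro add) auto
      finally show ?thesis by (simp add: algebra_simps)
    qed
    have one: "push_down V q y (\<lambda>t. f t + g t) - ?h f s1 \<le> push_down V q y g" if "s1 \<ge> 0" for s1
      by (rule ge[OF g]) (use two[OF that] in \<open>simp add: diff_le_eq add.commute\<close>)
    have "push_down V q y (\<lambda>t. f t + g t) - push_down V q y g \<le> push_down V q y f"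
    proof (rule ge[OF f])
      fix s :: real assume "s \<ge> 0"
      from one[OF this] show "push_down V q y (\<lambda>t. f t + g t) - push_down V q y g \<le> ?h f s" by linarith
    qed
    then show "push_down V q y (\<lambda>t. f t + g t) \<le> push_down V q y f + push_down V q y g" by simp
  next
    fix f :: "'a \<Rightarrow> complex" and r :: real assume f: "f \<in> V" and r: "r > 0"
    have "push_down V q y (\<lambda>t. of_real r * f t) / r \<le> push_down V q y f"
    proof (rule ge[OF f])
      fix s :: real assume s: "s \<ge> 0"
      have "push_down V q y (\<lambda>t. of_real r * f t) \<le> ?h (\<lambda>t. of_real r * f t) (r * s)"
        using f r s V_closed by (intro le) auto
      also have "q (\<lambda>t. of_real r * f t + of_real (r * s) * y t)
          = q (\<lambda>t. of_real r * (f t + of_real s * y t))" by (simp add: algebra_simps)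
      also have "\<dots> = r * q (\<lambda>t. f t + of_real s * y t)"
        using f y r V_closed by (intro sublinear_on_mult[OF q]) auto
      finally show "push_down V q y (\<lambda>t. of_real r * f t) / r \<le> ?h f s"
        using r by (simp add: field_simps)
    qed
    then show "push_down V q y (\<lambda>t. of_real r * f t) \<le> r * push_down V q y f"
      using r by (simp add: field_simps)
  qed
qed

text \<open>A minimal sublinear functional is additive, since it cannot be pushed down in any direction;
  pushing down in the direction \<open>x\<close> at the outset forces equality at \<open>x\<close>.\<close>

lemma hahn_banach_real:
  assumes p: "sublinear_on V p" and x: "x \<in> V"
  obtains q where "\<And>f g. f \<in> V \<Longrightarrow> g \<in> V \<Longrightarrow> q (\<lambda>t. f t + g t) = q f + q g"
    and "\<And>r f. f \<in> V \<Longrightarrow> q (\<lambda>t. of_real r * f t) = r * q f"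
    and "\<And>f. f \<in> V \<Longrightarrow> q f \<le> p f" and "q x = p x"
proof -
  define p1 where "p1 = push_down V p x"
  have p1: "sublinear_on V p1" "\<And>f. f \<in> V \<Longrightarrow> p1 f \<le> p f" "p1 (\<lambda>t. - x t) \<le> - p x"
    unfolding p1_def using push_down[OF p x] by auto
  define A where "A = {q. sublinear_on V q \<and> (\<forall>f\<in>V. q f \<le> p1 f) \<and> (\<forall>f. f \<notin> V \<longrightarrow> q f = 0)}"
  have p1A: "p1 \<in> A" unfolding A_def using p1 by (auto simp: p1_def push_down_def)
  have "\<exists>m\<in>A. \<forall>a\<in>A. m \<ge> a \<longrightarrow> a = m"
  \<comment> \<open>Zorn's lemma for the reversed order: the bound of a chain is its pointwise
    infimum, finite because every member lies above \<open>- p1 (- f)\<close> at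
    \<open>f\<close>.\<close>
  proof (rule predicate_Zorn)
    show "partial_order_on A (relation_of (\<ge>) A)"
      by (rule partial_order_on_relation_ofI) auto
    fix C assume C: "C \<in> Chains (relation_of (\<ge>) A)"
    then have CA: "C \<subseteq> A" and chain: "\<And>a b. a \<in> C \<Longrightarrow> b \<in> C \<Longrightarrow> a \<le> b \<or> b \<le> a"
      by (auto simp: Chains_def relation_of_def)
    show "\<exists>u\<in>A. \<forall>a\<in>C. u \<le> a"
    proof (cases "C = {}")
      case True then show ?thesis using p1A by auto
    next
      case False
      define u where "u f = (if f \<in> V then INF q\<in>C. q f else 0)" for f
      have bdd: "bdd_below ((\<lambda>q. q f) ` C)" if "f \<in> V" for f
      proof (rule bdd_belowI2)
        fix q assume "q \<in> C"
        then have q: "q \<in> A" using CA by auto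
        have "q (\<lambda>t. - f t) \<le> p1 (\<lambda>t. - f t)" using q that V_closed by (auto simp: A_def)
        then show "- p1 (\<lambda>t. - f t) \<le> q f"
          using sublinear_on_ge[of q f] q that by (auto simp: A_def)
      qed
      have le: "u f \<le> q f" if "f \<in> V" "q \<in> C" for f q
        unfolding u_def using that bdd by (auto intro: cINF_lower)
      have ge: "c \<le> u f" if "f \<in> V" "\<And>q. q \<in> C \<Longrightarrow> c \<le> q f" for f c
        unfolding u_def using that False by (auto intro!: cINF_greatest)
      have "sublinear_on V u"
        unfolding sublinear_on_def
      proof (intro conjI ballI allI impI)
        fix f g assume f: "f \<in> V" and g: "g \<in> V"
        have fg: "(\<lambda>t. f t + g t) \<in> V" using f g V_closed by auto
        have "u (\<lambda>t. f t + g t) \<le> q1 f + q2 g" if "q1 \<in> C" "q2 \<in> C" for q1 q2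
        proof -
          \<comment> \<open>Subadditivity passes to the infimum only because a chain contains a
            member below both \<open>q1\<close> and \<open>q2\<close>.\<close>
          have "\<exists>q\<in>C. q \<le> q1 \<and> q \<le> q2" using chain[OF that] that by auto
          then obtain q where q: "q \<in> C" "q \<le> q1" "q \<le> q2" by blast
          have "u (\<lambda>t. f t + g t) \<le> q (\<lambda>t. f t + g t)" using le[OF fg q(1)] .
          also have "\<dots> \<le> q f + q g" using q CA f g by (auto simp: A_def sublinear_on_def)
          also have "\<dots> \<le> q1 f + q2 g" using q by (intro add_mono) (auto simp: le_fun_def)
          finally show ?thesis .
        qed
        then have two: "u (\<lambda>t. f t + g t) - q1 f \<le> q2 g" if "q1 \<in> C" "q2 \<in> C" for q1 q2
          using that by (simp add: diff_le_eq add.commute)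
        have one: "u (\<lambda>t. f t + g t) - q1 f \<le> u g" if "q1 \<in> C" for q1
          by (rule ge[OF g]) (rule two[OF that])
        have "u (\<lambda>t. f t + g t) - u g \<le> u f"
        proof (rule ge[OF f])
          fix q assume "q \<in> C"
          from one[OF this] show "u (\<lambda>t. f t + g t) - u g \<le> q f" by linarith
        qed
        then show "u (\<lambda>t. f t + g t) \<le> u f + u g" by simp
      next
        fix f :: "'a \<Rightarrow> complex" and r :: real assume f: "f \<in> V" and r: "r > 0"
        have "u (\<lambda>t. of_real r * f t) / r \<le> u f"
        proof (rule ge[OF f])
          fix q assume q: "q \<in> C"
          have "u (\<lambda>t. of_real r * f t) \<le> q (\<lambda>t. of_real r * f t)"
            using f V_closed q by (intro le) auto
          also have "\<dots> \<le> r * q f" using q CA f r by (auto simp: A_def sublinear_on_def)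
          finally show "u (\<lambda>t. of_real r * f t) / r \<le> q f" using r by (simp add: field_simps)
        qed
        then show "u (\<lambda>t. of_real r * f t) \<le> r * u f" using r by (simp add: field_simps)
      qed
      moreover have "u f \<le> p1 f" if "f \<in> V" for f
      proof -
        obtain q where "q \<in> C" using False by auto
        then show ?thesis using le[OF that, of q] CA that by (fastforce simp: A_def)
      qed
      ultimately have "u \<in> A" by (auto simp: A_def u_def)
      moreover have "u \<le> a" if "a \<in> C" for a
        using le that CA by (fastforce simp: le_fun_def A_def u_def)
      ultimately show ?thesis by blast
    qed
  qed
  then obtain q where qA: "q \<in> A" and min: "\<And>a. a \<in> A \<Longrightarrow> a \<le> q \<Longrightarrow> a = q" by auto
  have q: "sublinear_on V q" "\<And>f. f \<in> V \<Longrightarrow> q f \<le> p1 f" "\<And>f. f \<notin> V \<Longrightarrow> q f = 0"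
    using qA by (auto simp: A_def)
  have add: "q (\<lambda>t. f t + g t) = q f + q g" if f: "f \<in> V" and g: "g \<in> V" for f g
  proof -
    note pd = push_down[OF q(1) g]
    have "push_down V q g \<le> q"
      using pd(2) q(3) by (auto simp: le_fun_def push_down_def)
    moreover have "push_down V q g \<in> A"
      using pd(1,2) q(2) by (auto simp: A_def push_down_def intro: order_trans)
    ultimately have "push_down V q g = q" using min by blast
    then have "q f \<le> q (\<lambda>t. f t + g t) - q g" using pd(4)[OF f] by simp
    then show ?thesis using q(1) f g by (force simp: sublinear_on_def)
  qed
  have neg: "q (\<lambda>t. - f t) = - q f" if "f \<in> V" for f
    using add[of f "\<lambda>t. - f t"] that V_closed sublinear_on_mult[OF q(1) that, of 0] by simp
  show ?thesis
  proof (rule that[OF add])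
    show "q (\<lambda>t. of_real r * f t) = r * q f" if "f \<in> V" for r f
    proof (cases "r \<ge> 0")
      case False
      have "q (\<lambda>t. of_real r * f t) = q (\<lambda>t. - (of_real (- r) * f t))" by simp
      also have "\<dots> = - ((- r) * q f)"
        using False that V_closed sublinear_on_mult[OF q(1) that, of "- r"] by (subst neg) auto
      finally show ?thesis by simp
    qed (use sublinear_on_mult[OF q(1) that] in blast)
    show "q f \<le> p f" if "f \<in> V" for f using q(2) p1(2) that order_trans by blast
    show "q x = p x"
    proof (rule antisym)
      show "q x \<le> p x" using q(2) p1(2) x order_trans by blast
      have "- q x \<le> - p x" using neg[OF x] q(2)[of "\<lambda>t. - x t"] p1(3) x V_closed by simp
      then show "p x \<le> q x" by simp
    qed
  qed
qed

end

text \<open>The unit ball of the dual space. Unlike in \<open>dual\<close>, values off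
  \<open>carr X\<close> are left free, since these functionals only serve to test elements.\<close>

definition contraction :: "'a fspace \<Rightarrow> (('a \<Rightarrow> complex) \<Rightarrow> complex) \<Rightarrow> bool" where
  "contraction X \<phi> \<longleftrightarrow>
     (\<forall>f\<in>carr X. \<forall>g\<in>carr X. \<phi> (\<lambda>t. f t + g t) = \<phi> f + \<phi> g) \<and>
     (\<forall>c. \<forall>f\<in>carr X. \<phi> (\<lambda>t. c * f t) = c * \<phi> f) \<and>
     (\<forall>f\<in>carr X. cmod (\<phi> f) \<le> nrm X f)"

section \<open>Norming functionals\<close>

context seminormed
begin

lemma contraction_add:
    "\<lbrakk>contraction X \<phi>; f \<in> carr X; g \<in> carr X\<rbrakk> \<Longrightarrow> \<phi> (\<lambda>t. f t + g t) = \<phi> f + \<phi> g"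
  and contraction_cmult: "\<lbrakk>contraction X \<phi>; f \<in> carr X\<rbrakk> \<Longrightarrow> \<phi> (\<lambda>t. c * f t) = c * \<phi> f"
  and contraction_le: "\<lbrakk>contraction X \<phi>; f \<in> carr X\<rbrakk> \<Longrightarrow> cmod (\<phi> f) \<le> nrm X f"
  by (auto simp: contraction_def)

lemma contraction_diff:
  "\<lbrakk>contraction X \<phi>; f \<in> carr X; g \<in> carr X\<rbrakk> \<Longrightarrow> \<phi> (\<lambda>t. f t - g t) = \<phi> f - \<phi> g"
  using contraction_add[of \<phi> f "\<lambda>t. (-1) * g t"] contraction_cmult[of \<phi> g "-1"]
    cmult_carr[of g "-1"] by simp

lemma contraction_divide:
  "\<lbrakk>contraction X \<phi>; f \<in> carr X\<rbrakk> \<Longrightarrow> \<phi> (\<lambda>t. f t / c) = \<phi> f / c"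
  using contraction_cmult[of \<phi> f "inverse c"] by (simp add: field_simps)

lemma contraction_zero: "contraction X \<phi> \<Longrightarrow> \<phi> (\<lambda>_. 0) = 0"
  using contraction_cmult[of \<phi> "\<lambda>_. 0" 0] by simp

lemma contraction_sum_list:
  assumes "contraction X \<phi>" "\<And>y. y \<in> set xs \<Longrightarrow> g y \<in> carr X"
  shows "\<phi> (\<lambda>t. \<Sum>y\<leftarrow>xs. g y t) = (\<Sum>y\<leftarrow>xs. \<phi> (g y))"
  using assms(2)
proof (induction xs)
  case (Cons a xs)
  have "(\<lambda>t. \<Sum>y\<leftarrow>xs. g y t) \<in> carr X"
    using sum_list_carr[of "map g xs"] Cons.prems by (auto simp: o_def)
  with Cons show ?case
    using contraction_add[OF assms(1), of "g a" "\<lambda>t. \<Sum>y\<leftarrow>xs. g y t"] by simp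
qed (use contraction_zero[OF assms(1)] in auto)

theorem hahn_banach:
  assumes x: "x \<in> carr X"
  obtains \<phi> where "contraction X \<phi>" "\<phi> x = of_real (nrm X x)"
proof -
  have sub: "sublinear_on (carr X) (nrm X)"
    unfolding sublinear_on_def using nrm_add nrm_cmult by auto
  obtain q where add: "\<And>f g. f \<in> carr X \<Longrightarrow> g \<in> carr X \<Longrightarrow> q (\<lambda>t. f t + g t) = q f + q g"
    and mult: "\<And>r f. f \<in> carr X \<Longrightarrow> q (\<lambda>t. of_real r * f t) = r * q f"
    and le: "\<And>f. f \<in> carr X \<Longrightarrow> q f \<le> nrm X f" and qx: "q x = nrm X x"
    using hahn_banach_real[OF subspace sub x] by blast
  \<comment> \<open>A complex linear functional is determined by its real part \<open>q\<close>
    through this formula.\<close>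
  define \<phi> where "\<phi> f = Complex (q f) (- q (\<lambda>t. \<i> * f t))" for f
  have padd: "\<phi> (\<lambda>t. f t + g t) = \<phi> f + \<phi> g" if "f \<in> carr X" "g \<in> carr X" for f g
    using add[OF that] add[of "\<lambda>t. \<i> * f t" "\<lambda>t. \<i> * g t"] that
    by (simp add: \<phi>_def complex_eq_iff algebra_simps)
  have pmult: "\<phi> (\<lambda>t. c * f t) = c * \<phi> f" if f: "f \<in> carr X" for c f
  proof -
    have 1: "q (\<lambda>t. c * f t) = Re c * q f + Im c * q (\<lambda>t. \<i> * f t)"
    proof -
      have "(\<lambda>t. c * f t) = (\<lambda>t. of_real (Re c) * f t + of_real (Im c) * (\<i> * f t))"
        by (rule ext) (subst complex_eq[of c], simp add: algebra_simps)
      then show ?thesis using f add[of "\<lambda>t. of_real (Re c) * f t" "\<lambda>t. of_real (Im c) * (\<i> * f t)"]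
          mult[OF f, of "Re c"] mult[of "\<lambda>t. \<i> * f t" "Im c"] by simp
    qed
    have 2: "q (\<lambda>t. \<i> * (c * f t)) = - Im c * q f + Re c * q (\<lambda>t. \<i> * f t)"
    proof -
      have "(\<lambda>t. \<i> * (c * f t)) = (\<lambda>t. of_real (- Im c) * f t + of_real (Re c) * (\<i> * f t))"
        by (rule ext) (subst complex_eq[of c], simp add: algebra_simps)
      then show ?thesis using f add[of "\<lambda>t. of_real (- Im c) * f t" "\<lambda>t. of_real (Re c) * (\<i> * f t)"]
          mult[OF f, of "- Im c"] mult[of "\<lambda>t. \<i> * f t" "Re c"] by simp
    qed
    show ?thesis unfolding \<phi>_def 1 2 by (simp add: complex_eq_iff algebra_simps)
  qed
  have ple: "cmod (\<phi> f) \<le> nrm X f" if f: "f \<in> carr X" for f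
  proof (cases "\<phi> f = 0")
    case False
    \<comment> \<open>A rotation by \<open>w\<close> makes the value of \<open>\<phi>\<close> real
      and nonnegative, so that the bound for the real part \<open>q\<close> bounds the
      modulus.\<close>
    define w where "w = cnj (\<phi> f) / of_real (cmod (\<phi> f))"
    have w: "cmod w = 1" using False by (simp add: w_def norm_divide)
    have "w * \<phi> f = of_real (cmod (\<phi> f))"
      using False by (simp add: w_def complex_norm_square[symmetric] power2_eq_square field_simps)
    then have "cmod (\<phi> f) = Re (\<phi> (\<lambda>t. w * f t))" using pmult[OF f, of w] by simp
    also have "\<dots> = q (\<lambda>t. w * f t)" by (simp add: \<phi>_def)
    also have "\<dots> \<le> nrm X (\<lambda>t. w * f t)" using f by (intro le) auto
    also have "\<dots> = nrm X f" using f w by (simp add: nrm_cmult)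
    finally show ?thesis .
  qed (use f in auto)
  have c: "contraction X \<phi>" unfolding contraction_def using padd pmult ple by auto
  have "\<phi> x = of_real (nrm X x)"
  proof -
    have re: "Re (\<phi> x) = nrm X x" using qx by (simp add: \<phi>_def)
    have "(Re (\<phi> x))\<^sup>2 + (Im (\<phi> x))\<^sup>2 \<le> (nrm X x)\<^sup>2"
      using ple[OF x] by (metis cmod_power2 norm_ge_zero power_mono)
    then have "Im (\<phi> x) = 0" using re by (simp add: sum_power2_le_zero_iff)
    then show ?thesis using re by (simp add: complex_eq_iff)
  qed
  with c show ?thesis using that by blast
qed

text \<open>The bridge from scalar complex analysis to function spaces: an estimate uniform over all
  contractions is a norm estimate.\<close>

lemma nrm_leI:
  assumes "x \<in> carr X" "\<And>\<phi>. contraction X \<phi> \<Longrightarrow> cmod (\<phi> x) \<le> c"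
  shows "nrm X x \<le> c"
proof -
  obtain \<phi> where "contraction X \<phi>" "\<phi> x = of_real (nrm X x)" using hahn_banach[OF assms(1)] .
  then show ?thesis using assms(2)[of \<phi>] nrm_nonneg[OF assms(1)] by simp
qed

end

section \<open>Vector-valued holomorphic functions\<close>

text \<open>Taylor's formula of order one, with Cauchy's estimate for the second derivative on discs
  of radius \<open>r/3\<close> around points of the half-size ball; \<open>18 = 2! * 9\<close>. The
  constant depends on \<open>h\<close> only through \<open>A\<close>, so it is shared by all
  compositions of a bounded vector-valued function with contractions.\<close>

lemma difference_quotient_bound:
  fixes h :: "complex \<Rightarrow> complex"
  assumes hol: "h holomorphic_on ball z r" and le: "\<And>w. w \<in> ball z r \<Longrightarrow> cmod (h w) \<le> A"
    and r: "r > 0" and w: "w \<in> ball z (r/2)" "w \<noteq> z"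
  shows "cmod ((h w - h z) / (w - z) - deriv h z) \<le> 18 * (A + 1) / r\<^sup>2 * cmod (w - z)"
proof -
  define B where "B = 18 * (A + 1) / r\<^sup>2"
  have A: "A \<ge> 0" using le[of z] r norm_ge_zero order_trans by (metis centre_in_ball)
  have B2: "cmod ((deriv ^^ 2) h x) \<le> B" if "x \<in> ball z (r/2)" for x
  proof -
    have sub: "cball x (r/3) \<subseteq> ball z r"
    proof
      fix y assume "y \<in> cball x (r/3)"
      then have "dist z y \<le> dist z x + r/3" using dist_triangle[of z y x] by simp
      also have "\<dots> < r" using that r by simp
      finally show "y \<in> ball z r" by simp
    qed
    have "cmod ((deriv ^^ 2) h x) \<le> fact 2 * (A + 1) / (r/3)^2"
    proof (rule Cauchy_higher_deriv_bound[where y=0])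
      show "h holomorphic_on ball x (r/3)"
        using sub by (intro holomorphic_on_subset[OF hol]) auto
      show "continuous_on (cball x (r/3)) h"
        using sub by (intro holomorphic_on_imp_continuous_on holomorphic_on_subset[OF hol])
      \<comment> \<open>Cauchy's estimate asks for values in an open ball, so \<open>A\<close> is
        enlarged to \<open>A + 1\<close>.\<close>
      show "h w \<in> ball 0 (A + 1)" if "w \<in> ball x (r/3)" for w
      proof -
        have "w \<in> cball x (r/3)" using that by simp
        then have "w \<in> ball z r" using sub by blast
        from le[OF this] show ?thesis by simp
      qed
    qed (use r in auto)
    also have "\<dots> = B" by (simp add: B_def power2_eq_square)
    finally show ?thesis .
  qed
  have "cmod ((deriv ^^ 0) h w - (\<Sum>i\<le>1. (deriv ^^ i) h z * (w - z)^i / fact i))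
      \<le> B * cmod (w - z)^Suc 1 / fact 1"
  proof (rule field_Taylor[of "ball z (r/2)" 1 "\<lambda>i. (deriv ^^ i) h"])
    fix i x assume x: "x \<in> ball z (r/2)"
    then have xr: "x \<in> ball z r" using r by simp
    have "(deriv ^^ i) h holomorphic_on ball z r"
      using hol by (intro holomorphic_higher_deriv) auto
    then have "((deriv ^^ i) h has_field_derivative deriv ((deriv ^^ i) h) x) (at x)"
      using xr by (intro holomorphic_derivI[of _ "ball z r"]) auto
    then show "((deriv ^^ i) h has_field_derivative (deriv ^^ Suc i) h x) (at x within ball z (r/2))"
      by (auto intro: has_field_derivative_at_within)
  qed (use w r B2 in \<open>auto simp: numeral_2_eq_2\<close>)
  then have *: "cmod (h w - h z - deriv h z * (w - z)) \<le> B * cmod (w - z)^2"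
    by (simp add: diff_diff_eq power2_eq_square)
  have wz: "cmod (w - z) > 0" using w by simp
  have "(h w - h z) / (w - z) - deriv h z = (h w - h z - deriv h z * (w - z)) / (w - z)"
    using w by (simp add: field_simps)
  then have "cmod ((h w - h z) / (w - z) - deriv h z) = cmod (h w - h z - deriv h z * (w - z)) / cmod (w - z)"
    by (simp add: norm_divide)
  also have "\<dots> \<le> B * cmod (w - z)"
    using * wz by (simp add: divide_le_eq power2_eq_square mult.assoc)
  finally show ?thesis by (simp add: B_def)
qed

context seminormed
begin

lemma contraction_has_field_derivative:
  assumes \<phi>: "contraction X \<phi>" and d: "complex_deriv_in X F d z"
    and F: "F z \<in> carr X" "eventually (\<lambda>w. F w \<in> carr X) (at z)"
  shows "((\<lambda>w. \<phi> (F w)) has_field_derivative \<phi> d) (at z)"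
proof -
  have dX: "d \<in> carr X" and lim: "((\<lambda>w. nrm X (\<lambda>t. (F w t - F z t) / (w - z) - d t)) \<longlongrightarrow> 0) (at z)"
    using d by (auto simp: complex_deriv_in_def)
  have "((\<lambda>w. (\<phi> (F w) - \<phi> (F z)) / (w - z) - \<phi> d) \<longlongrightarrow> 0) (at z)"
  proof (rule Lim_null_comparison[OF _ lim])
    show "\<forall>\<^sub>F w in at z. cmod ((\<phi> (F w) - \<phi> (F z)) / (w - z) - \<phi> d)
        \<le> nrm X (\<lambda>t. (F w t - F z t) / (w - z) - d t)"
      using F(2)
    proof eventually_elim
      case (elim w)
      have "\<phi> (\<lambda>t. (F w t - F z t) / (w - z) - d t) = (\<phi> (F w) - \<phi> (F z)) / (w - z) - \<phi> d"
        using elim F(1) dX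
        by (simp add: contraction_diff[OF \<phi>] contraction_divide[OF \<phi>])
      then show ?case
        using contraction_le[OF \<phi>, of "\<lambda>t. (F w t - F z t) / (w - z) - d t"] elim F(1) dX by simp
    qed
  qed
  then show ?thesis
    unfolding has_field_derivative_iff by (rule LIM_zero_cancel)
qed

lemma contraction_continuous_on:
  assumes \<phi>: "contraction X \<phi>" and c: "continuous_in X A F" and F: "\<And>z. z \<in> A \<Longrightarrow> F z \<in> carr X"
  shows "continuous_on A (\<lambda>w. \<phi> (F w))"
  unfolding continuous_on_def
proof
  fix z assume z: "z \<in> A"
  have lim: "((\<lambda>w. nrm X (\<lambda>t. F w t - F z t)) \<longlongrightarrow> 0) (at z within A)"
    using c z by (auto simp: continuous_in_def)
  show "((\<lambda>w. \<phi> (F w)) \<longlongrightarrow> \<phi> (F z)) (at z within A)"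
  proof (rule LIM_zero_cancel, rule Lim_null_comparison[OF _ lim])
    show "\<forall>\<^sub>F w in at z within A. cmod (\<phi> (F w) - \<phi> (F z)) \<le> nrm X (\<lambda>t. F w t - F z t)"
      unfolding eventually_at_filter
    proof (rule always_eventually, intro allI impI)
      fix w assume "w \<in> A"
      then show "cmod (\<phi> (F w) - \<phi> (F z)) \<le> nrm X (\<lambda>t. F w t - F z t)"
        using contraction_le[OF \<phi>, of "\<lambda>t. F w t - F z t"] contraction_diff[OF \<phi>, of "F w" "F z"] F z
        by simp
    qed
  qed
qed

text \<open>Second order Taylor bounds, uniform over contractions, make the difference quotients Cauchy.\<close>

theorem weakly_holomorphic_imp_deriv:
  assumes complete: complete_space and r: "r > 0"
    and F: "\<And>z. z \<in> ball z0 r \<Longrightarrow> F z \<in> carr X"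
    and le: "\<And>z. z \<in> ball z0 r \<Longrightarrow> nrm X (F z) \<le> A"
    and hol: "\<And>\<phi>. contraction X \<phi> \<Longrightarrow> (\<lambda>z. \<phi> (F z)) holomorphic_on ball z0 r"
  shows "\<exists>d. complex_deriv_in X F d z0"
proof -
  define K where "K = 18 * (A + 1) / r\<^sup>2"
  define q where "q w t = (F w t - F z0 t) / (w - z0)" for w t
  have F0: "F z0 \<in> carr X" using F r by simp
  have A: "A \<ge> 0" using le[of z0] nrm_nonneg[OF F0] r by simp
  then have K: "K \<ge> 0" by (simp add: K_def)
  have qX: "q w \<in> carr X" if "w \<in> ball z0 r" for w
    unfolding q_def using F[OF that] F0 by simp
  have q_le: "nrm X (\<lambda>t. q w t - q w' t) \<le> K * (cmod (w - z0) + cmod (w' - z0))"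
    if w: "w \<in> ball z0 (r/2)" "w \<noteq> z0" and w': "w' \<in> ball z0 (r/2)" "w' \<noteq> z0" for w w'
  proof (rule nrm_leI)
    have wr: "w \<in> ball z0 r" "w' \<in> ball z0 r" using w w' r by auto
    show "(\<lambda>t. q w t - q w' t) \<in> carr X" using qX wr by simp
    fix \<phi> assume \<phi>: "contraction X \<phi>"
    let ?h = "\<lambda>z. \<phi> (F z)"
    have bd: "cmod (?h z) \<le> A" if "z \<in> ball z0 r" for z
      using contraction_le[OF \<phi> F[OF that]] le[OF that] by linarith
    have eq: "\<phi> (q v) = (?h v - ?h z0) / (v - z0)" if "v \<in> ball z0 r" for v
      unfolding q_def using F[OF that] F0 by (simp add: contraction_divide[OF \<phi>] contraction_diff[OF \<phi>])
    have "cmod (\<phi> (\<lambda>t. q w t - q w' t)) = cmod (\<phi> (q w) - \<phi> (q w'))"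
      using qX wr by (simp add: contraction_diff[OF \<phi>])
    also have "\<dots> \<le> cmod (\<phi> (q w) - deriv ?h z0) + cmod (\<phi> (q w') - deriv ?h z0)"
      by (metis norm_triangle_ineq4 diff_diff_eq2 diff_add_cancel add_diff_eq)
    also have "\<dots> \<le> K * cmod (w - z0) + K * cmod (w' - z0)"
      unfolding K_def eq[OF wr(1)] eq[OF wr(2)]
      using w w' r bd by (intro add_mono difference_quotient_bound[OF hol[OF \<phi>]]) auto
    finally show "cmod (\<phi> (\<lambda>t. q w t - q w' t)) \<le> K * (cmod (w - z0) + cmod (w' - z0))"
      by (simp add: algebra_simps)
  qed
  \<comment> \<open>Completeness is sequential, so the derivative is first found along one explicit
    sequence tending to \<open>z0\<close>. The estimate \<open>bound\<close> then gives convergence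
    along all \<open>v\<close>.\<close>
  define w where "w n = z0 + of_real (r / 4 * inverse (real (Suc n)))" for n
  have wn: "cmod (w n - z0) = r / 4 * inverse (real (Suc n))" for n
    using r unfolding w_def by (simp del: of_real_mult of_real_divide add: norm_of_real)
  have w0: "w n \<noteq> z0" for n using wn[of n] r by auto
  have wb: "w n \<in> ball z0 (r/2)" for n
  proof -
    have "r / 4 * inverse (real (Suc n)) \<le> r / 4 * 1"
      using r by (intro mult_left_mono) (auto simp: field_simps)
    then have "cmod (w n - z0) < r / 2" using wn[of n] r by linarith
    then show ?thesis by (simp add: dist_norm norm_minus_commute)
  qed
  have wr: "w n \<in> ball z0 r" for n
    by (rule subsetD[OF subset_ball wb]) (use r in simp)
  have lim_w: "(\<lambda>n. cmod (w n - z0)) \<longlonglongrightarrow> 0"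
    unfolding wn using tendsto_mult[OF tendsto_const LIMSEQ_inverse_real_of_nat, of "r/4"] by simp
  have "\<exists>d\<in>carr X. (\<lambda>n. nrm X (\<lambda>t. q (w n) t - d t)) \<longlonglongrightarrow> 0"
  proof (rule complete_spaceD[OF complete])
    fix e :: real assume e: "e > 0"
    have "(\<lambda>n. K * cmod (w n - z0)) \<longlonglongrightarrow> K * 0"
      by (intro tendsto_intros lim_w)
    then have "\<forall>\<^sub>F n in sequentially. K * cmod (w n - z0) < e / 2"
      using e by (intro order_tendstoD(2)) auto
    then obtain N where N: "\<And>n. n \<ge> N \<Longrightarrow> K * cmod (w n - z0) < e / 2"
      by (auto simp: eventually_sequentially)
    have "nrm X (\<lambda>t. q (w m) t - q (w n) t) < e" if "m \<ge> N" "n \<ge> N" for m n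
      using q_le[OF wb w0 wb w0, of m n] N[OF that(1)] N[OF that(2)] by (simp add: distrib_left)
    then show "\<exists>N. \<forall>m\<ge>N. \<forall>n\<ge>N. nrm X (\<lambda>t. q (w m) t - q (w n) t) < e" by blast
  qed (use qX wr in auto)
  then obtain d where d: "d \<in> carr X" and lim: "(\<lambda>n. nrm X (\<lambda>t. q (w n) t - d t)) \<longlonglongrightarrow> 0"
    by blast
  have bound: "nrm X (\<lambda>t. q v t - d t) \<le> K * cmod (v - z0)" if v: "v \<in> ball z0 (r/2)" "v \<noteq> z0" for v
  proof -
    have vr: "v \<in> ball z0 r" using v r by auto
    have "nrm X (\<lambda>t. d t - q v t) \<le> K * cmod (v - z0)"
    proof (rule LIMSEQ_le)
      show "(\<lambda>n. nrm X (\<lambda>t. q (w n) t - q v t)) \<longlonglongrightarrow> nrm X (\<lambda>t. d t - q v t)"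
        using qX wr vr d lim by (intro tendsto_nrm_diff) auto
      show "(\<lambda>n. K * (cmod (w n - z0) + cmod (v - z0))) \<longlonglongrightarrow> K * cmod (v - z0)"
        using tendsto_mult[OF tendsto_const tendsto_add[OF lim_w tendsto_const], of K "cmod (v - z0)"] by simp
      show "\<exists>N. \<forall>n\<ge>N. nrm X (\<lambda>t. q (w n) t - q v t) \<le> K * (cmod (w n - z0) + cmod (v - z0))"
        using q_le[OF wb w0 v] by blast
    qed
    then show ?thesis using nrm_diff_commute[OF d qX[OF vr]] by simp
  qed
  have "((\<lambda>v. nrm X (\<lambda>t. q v t - d t)) \<longlongrightarrow> 0) (at z0)"
  proof (rule Lim_null_comparison)
    have "\<forall>\<^sub>F v in at z0. v \<in> ball z0 (r/2) \<and> v \<noteq> z0"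
      using r eventually_at_ball[of "r/2" z0 UNIV] by (auto simp: eventually_at_filter elim: eventually_mono)
    then show "\<forall>\<^sub>F v in at z0. norm (nrm X (\<lambda>t. q v t - d t)) \<le> K * cmod (v - z0)"
    proof eventually_elim
      case (elim v)
      then have "q v \<in> carr X" using qX[of v] r by auto
      then show ?case using bound[of v] elim d by simp
    qed
    show "((\<lambda>v. K * cmod (v - z0)) \<longlongrightarrow> 0) (at z0)"
      by (rule tendsto_eq_intros refl)+ simp
  qed
  then show ?thesis unfolding complex_deriv_in_def q_def using d by blast
qed

text \<open>Existence comes from \<open>e\<close>; functionals only identify it, since they separate
  points up to seminorm 0. Vector-valued derivatives can thus be computed by scalar
  calculus.\<close>

lemma complex_deriv_inI:
  assumes e: "complex_deriv_in X F e z" and F: "F z \<in> carr X" "eventually (\<lambda>w. F w \<in> carr X) (at z)"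
    and d: "d \<in> carr X"
    and weak: "\<And>\<phi>. contraction X \<phi> \<Longrightarrow> ((\<lambda>w. \<phi> (F w)) has_field_derivative \<phi> d) (at z)"
  shows "complex_deriv_in X F d z"
proof -
  have eX: "e \<in> carr X" and lim: "((\<lambda>w. nrm X (\<lambda>t. (F w t - F z t) / (w - z) - e t)) \<longlongrightarrow> 0) (at z)"
    using e by (auto simp: complex_deriv_in_def)
  have "nrm X (\<lambda>t. e t - d t) \<le> 0"
  proof (rule nrm_leI)
    fix \<phi> assume \<phi>: "contraction X \<phi>"
    have "\<phi> e = \<phi> d"
      using contraction_has_field_derivative[OF \<phi> e F] weak[OF \<phi>] DERIV_unique by blast
    then show "cmod (\<phi> (\<lambda>t. e t - d t)) \<le> 0"
      using eX d by (simp add: contraction_diff[OF \<phi>])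
  qed (use eX d in auto)
  moreover have "nrm X (\<lambda>t. e t - d t) \<ge> 0" using eX d by (intro nrm_nonneg) simp
  ultimately have ed: "nrm X (\<lambda>t. e t - d t) = 0" by (rule antisym)
  have "((\<lambda>w. nrm X (\<lambda>t. (F w t - F z t) / (w - z) - d t)) \<longlongrightarrow> 0) (at z)"
  proof (rule Lim_null_comparison[OF _ lim])
    show "\<forall>\<^sub>F w in at z. norm (nrm X (\<lambda>t. (F w t - F z t) / (w - z) - d t))
        \<le> nrm X (\<lambda>t. (F w t - F z t) / (w - z) - e t)"
      using F(2)
    proof eventually_elim
      case (elim w)
      show ?case
        using nrm_diff_triangle[of "\<lambda>t. (F w t - F z t) / (w - z)" e d] elim F(1) d eX ed by simp
    qed
  qed
  then show ?thesis using d by (simp add: complex_deriv_in_def)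
qed

end


section \<open>The maximum principle on the strip\<close>

lemma interior_strip: "interior strip = {z. 0 < Re z \<and> Re z < 1}"
proof -
  have eq: "strip = {z. Re z \<ge> 0} \<inter> {z. Re z \<le> 1}" by (auto simp: strip_def)
  have "interior {z. Re z \<ge> 0} = {z. Re z > 0}" "interior {z. Re z \<le> 1} = {z. Re z < 1}"
    using interior_halfspace_ge[of "1::complex" 0] interior_halfspace_le[of "1::complex" 1]
    by (simp_all add: inner_complex_def)
  then show "interior strip = {z. 0 < Re z \<and> Re z < 1}" unfolding eq interior_Int by auto
qed

text \<open>A Phragmen-Lindelof argument. The factor \<open>exp (\<delta> (w^2 - 1))\<close> has
  modulus at most 1 on the strip and decays vertically, so the maximum modulus principle applies on
  a tall rectangle; afterwards \<open>\<delta>\<close> tends to 0.\<close>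

lemma strip_maximum_principle:
  fixes h :: "complex \<Rightarrow> complex"
  assumes cont: "continuous_on strip h" and hol: "h holomorphic_on interior strip"
    and bd: "\<And>z. z \<in> strip \<Longrightarrow> cmod (h z) \<le> B"
    and A: "\<And>y. cmod (h (Complex 0 y)) \<le> A" "\<And>y. cmod (h (Complex 1 y)) \<le> A"
    and z: "z \<in> strip"
  shows "cmod (h z) \<le> A"
proof -
  have A0: "A \<ge> 0" using A(1)[of 0] norm_ge_zero order_trans by blast
  have B0: "B \<ge> 0" using bd[OF z] norm_ge_zero order_trans by blast
  define c where "c = (Re z)\<^sup>2 - (Im z)\<^sup>2 - 1"
  have main: "cmod (h z) * exp (\<delta> * c) \<le> A + \<delta>" if \<delta>: "\<delta> > 0" for \<delta>
  proof -
    define k where "k w = h w * exp (of_real \<delta> * (w\<^sup>2 - 1))" for w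
    have k: "cmod (k w) = cmod (h w) * exp (\<delta> * ((Re w)\<^sup>2 - (Im w)\<^sup>2 - 1))" for w
      by (simp add: k_def norm_mult power2_eq_square)
    have "((\<lambda>R. B * exp (- \<delta> * R\<^sup>2)) \<longlongrightarrow> B * 0) at_top"
      using \<delta> by (intro tendsto_intros filterlim_compose[OF exp_at_bot] filterlim_tendsto_neg_mult_at_bot[OF tendsto_const] filterlim_pow_at_top filterlim_ident) auto
    then have "\<forall>\<^sub>F R in at_top. B * exp (- \<delta> * R\<^sup>2) < A + \<delta>"
      using A0 \<delta> by (intro order_tendstoD(2)) auto
    \<comment> \<open>The summand \<open>\<delta>\<close> leaves room when \<open>A = 0\<close>: the
      decaying bound on the horizontal sides need not fall below \<open>A\<close>, but it falls
      below \<open>A + \<delta>\<close>.\<close>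
    then obtain R0 where R0: "\<And>R. R \<ge> R0 \<Longrightarrow> B * exp (- \<delta> * R\<^sup>2) < A + \<delta>"
      by (auto simp: eventually_at_top_linorder)
    define R where "R = max R0 (\<bar>Im z\<bar> + 1)"
    have R: "B * exp (- \<delta> * R\<^sup>2) < A + \<delta>" "\<bar>Im z\<bar> < R" using R0 by (auto simp: R_def)
    define Q where "Q = cbox (Complex 0 (- R)) (Complex 1 R)"
    have Q: "Q \<subseteq> strip" by (auto simp: Q_def in_cbox_complex_iff strip_def)
    have intQ: "interior Q = box (Complex 0 (- R)) (Complex 1 R)" by (simp add: Q_def)
    have "cmod (k z) \<le> A + \<delta>"
    proof (rule maximum_modulus_frontier[of k Q])
      show "k holomorphic_on interior Q"
        unfolding k_def using interior_mono[OF Q]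
        by (intro holomorphic_intros holomorphic_on_subset[OF hol])
      have "continuous_on Q k"
        unfolding k_def by (intro continuous_intros continuous_on_subset[OF cont] Q)
      then show "continuous_on (closure Q) k" by (simp add: Q_def)
      show "bounded Q" by (simp add: Q_def)
      show "z \<in> Q" using R(2) z by (auto simp: Q_def in_cbox_complex_iff strip_def)
      fix w assume "w \<in> frontier Q"
      then have w: "w \<in> Q" "w \<notin> box (Complex 0 (- R)) (Complex 1 R)"
        unfolding frontier_def intQ by (auto simp: Q_def)
      have wQ: "0 \<le> Re w" "Re w \<le> 1" "- R \<le> Im w" "Im w \<le> R"
        using w(1) by (auto simp: Q_def in_cbox_complex_iff)
      have Re2: "(Re w)\<^sup>2 \<le> 1" using wQ by (simp add: power_le_one)
      consider "Re w = 0" | "Re w = 1" | "\<bar>Im w\<bar> = R"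
        using w(2) wQ by (force simp: in_box_complex_iff)
      then show "cmod (k w) \<le> A + \<delta>"
      proof cases
        case 3
        then have "(Im w)\<^sup>2 = R\<^sup>2" by (metis power2_abs)
        then have "exp (\<delta> * ((Re w)\<^sup>2 - (Im w)\<^sup>2 - 1)) \<le> exp (- \<delta> * R\<^sup>2)"
          using Re2 \<delta> by (simp add: algebra_simps)
        moreover have "cmod (h w) \<le> B" using bd w(1) Q by blast
        ultimately have "cmod (k w) \<le> B * exp (- \<delta> * R\<^sup>2)"
          unfolding k by (intro mult_mono) (use B0 in auto)
        then show ?thesis using R(1) by simp
      next
        case 1
        then have "cmod (h w) \<le> A" using A(1)[of "Im w"] by (metis complex_surj)
        moreover have "exp (\<delta> * ((Re w)\<^sup>2 - (Im w)\<^sup>2 - 1)) \<le> 1"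
          using Re2 \<delta> by (auto simp: mult_le_0_iff intro: order_trans[of _ "(Re w)\<^sup>2"])
        ultimately have "cmod (k w) \<le> A * 1" unfolding k by (intro mult_mono) (use A0 in auto)
        then show ?thesis using \<delta> by simp
      next
        case 2
        then have "cmod (h w) \<le> A" using A(2)[of "Im w"] by (metis complex_surj)
        moreover have "exp (\<delta> * ((Re w)\<^sup>2 - (Im w)\<^sup>2 - 1)) \<le> 1"
          using Re2 \<delta> by (auto simp: mult_le_0_iff intro: order_trans[of _ "(Re w)\<^sup>2"])
        ultimately have "cmod (k w) \<le> A * 1" unfolding k by (intro mult_mono) (use A0 in auto)
        then show ?thesis using \<delta> by simp
      qed
    qed
    then show ?thesis by (simp add: k c_def)
  qed
  show ?thesis
  proof (rule tendsto_le)
    show "((\<lambda>\<delta>. A + \<delta>) \<longlongrightarrow> A) (at_right 0)"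
      by (rule tendsto_eq_intros refl)+ simp
    show "((\<lambda>\<delta>. cmod (h z) * exp (\<delta> * c)) \<longlongrightarrow> cmod (h z)) (at_right 0)"
      by (rule tendsto_eq_intros refl)+ simp
    show "\<forall>\<^sub>F \<delta> in at_right 0. cmod (h z) * exp (\<delta> * c) \<le> A + \<delta>"
      using main by (auto simp: eventually_at_filter)
  qed simp
qed

section \<open>Koethe spaces and their sums\<close>

locale koethe =
  fixes M :: "'a measure" and X :: "'a fspace"
  assumes koethe_space: "koethe_space M X"

sublocale koethe \<subseteq> seminormed X
  using koethe_space unfolding koethe_space_def by unfold_locales blast+

text \<open>Only one half of definiteness has to be supplied: a function vanishing almost everywhere
  is dominated by 0, so the ideal property gives it norm 0.\<close>

lemma koethe_spaceI:
  assumes "seminormed X" "sigma_finite_measure M" "carr X \<subseteq> borel_measurable M"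
    and definite: "\<And>f. f \<in> carr X \<Longrightarrow> nrm X f = 0 \<Longrightarrow> AE t in M. f t = 0"
    and ideal: "\<And>f g. \<lbrakk>f \<in> borel_measurable M; g \<in> carr X; AE t in M. cmod (f t) \<le> cmod (g t)\<rbrakk> \<Longrightarrow>
        f \<in> carr X \<and> nrm X f \<le> nrm X g"
    and complete: "seminormed.complete_space X"
  shows "koethe_space M X"
proof -
  interpret seminormed X by fact
  have "nrm X f = 0" if "f \<in> carr X" "AE t in M. f t = 0" for f
    using ideal[of f "\<lambda>_. 0"] that assms(3) nrm_nonneg[OF that(1)] by auto
  then show ?thesis
    unfolding koethe_space_def ae_eq_def
    using assms(2,3) subspace nrm_cmult nrm_add definite ideal complete[unfolded complete_space_def]
    by (intro conjI) (blast intro: nrm_nonneg)+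
qed

context koethe
begin

lemma sigma_finite: "sigma_finite_measure M"
  using koethe_space unfolding koethe_space_def by blast

lemma measurable_carr: "f \<in> carr X \<Longrightarrow> f \<in> borel_measurable M"
  using koethe_space unfolding koethe_space_def by blast

lemma nrm_eq_0_iff: "f \<in> carr X \<Longrightarrow> nrm X f = 0 \<longleftrightarrow> (AE t in M. f t = 0)"
  using koethe_space unfolding koethe_space_def ae_eq_def by blast

lemma ideal:
  assumes "f \<in> borel_measurable M" "g \<in> carr X" "AE t in M. cmod (f t) \<le> cmod (g t)"
  shows "f \<in> carr X" "nrm X f \<le> nrm X g"
  using koethe_space assms unfolding koethe_space_def by blast+

lemma complete: complete_space
  using koethe_space unfolding koethe_space_def complete_space_def by blast

lemma ae_cong:
  assumes "f \<in> borel_measurable M" "g \<in> carr X" "AE t in M. f t = g t"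
  shows "f \<in> carr X" "nrm X f = nrm X g"
proof -
  have le: "AE t in M. cmod (f t) \<le> cmod (g t)" "AE t in M. cmod (g t) \<le> cmod (f t)"
    using assms(3) by auto
  show f: "f \<in> carr X" using ideal[OF assms(1,2) le(1)] by blast
  show "nrm X f = nrm X g"
    using ideal[OF assms(1,2) le(1)] ideal[OF measurable_carr[OF assms(2)] f le(2)] by simp
qed

lemma mult_bounded:
  assumes "h \<in> borel_measurable M" "AE t in M. cmod (h t) \<le> 1" "f \<in> carr X"
  shows "(\<lambda>t. h t * f t) \<in> carr X" "nrm X (\<lambda>t. h t * f t) \<le> nrm X f"
proof -
  have m: "(\<lambda>t. h t * f t) \<in> borel_measurable M"
    using assms measurable_carr by (intro borel_measurable_times) auto
  have le: "AE t in M. cmod (h t * f t) \<le> cmod (f t)"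
    using assms(2) by eventually_elim (simp add: norm_mult mult_left_le_one_le)
  show "(\<lambda>t. h t * f t) \<in> carr X" "nrm X (\<lambda>t. h t * f t) \<le> nrm X f"
    using ideal[OF m assms(3) le] by auto
qed

lemma ae_eqI:
  assumes "f \<in> carr X" "g \<in> carr X" "nrm X (\<lambda>t. f t - g t) \<le> 0"
  shows "AE t in M. f t = g t"
proof -
  have fg: "(\<lambda>t. f t - g t) \<in> carr X" using assms by simp
  then have "nrm X (\<lambda>t. f t - g t) = 0" using assms(3) nrm_nonneg[OF fg] by linarith
  then show ?thesis using nrm_eq_0_iff[OF fg] by simp
qed

text \<open>By completeness the moduli have a norm sum \<open>g\<close>, and \<open>Re g\<close>
  dominates every partial sum almost everywhere. Hence the series converges absolutely at almost
  every point. This takes the place of the continuous embedding into L0.\<close>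

lemma tendsto_zero_AE:
  assumes f: "\<And>n. f n \<in> carr X" and le: "\<And>n. nrm X (f n) \<le> (1/2)^n"
  shows "AE t in M. (\<lambda>n. f n t) \<longlonglongrightarrow> 0"
proof -
  define F where "F n t = complex_of_real (cmod (f n t))" for n t
  have m: "F n \<in> borel_measurable M" for n
    unfolding F_def using measurable_carr[OF f] by measurable
  have F: "F n \<in> carr X" "nrm X (F n) \<le> (1/2)^n" for n
    using ideal[OF m f, of n n] le[of n] by (auto simp: F_def)
  have sm: "summable (\<lambda>n. (1/2::real)^n)" by (simp add: summable_geometric)
  obtain g where g: "g \<in> carr X"
    and gle: "\<And>N. nrm X (\<lambda>t. g t - (\<Sum>n<N. F n t)) \<le> (\<Sum>n. (1/2)^(n + N))"
    using complete_space_series[OF complete F sm] by blast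
  have "AE t in M. (\<Sum>n<N. cmod (f n t)) \<le> Re (g t)" for N
  proof -
    \<comment> \<open>The excess of the \<open>N\<close>-th partial sum over \<open>Re g\<close>. It
      is dominated by each later remainder \<open>g - (\<Sum>n<m. F n)\<close>, so its norm lies
      below arbitrarily small tails.\<close>
    define p where "p t = complex_of_real (max 0 ((\<Sum>n<N. cmod (f n t)) - Re (g t)))" for t
    have pm: "p \<in> borel_measurable M"
      unfolding p_def using measurable_carr[OF f] measurable_carr[OF g] by measurable
    have p: "p \<in> carr X \<and> nrm X p \<le> (\<Sum>n. (1/2)^(n + m))" if "m \<ge> N" for m
    proof -
      have le: "cmod (p t) \<le> cmod (g t - (\<Sum>n<m. F n t))" for t
      proof -
        have "(\<Sum>n<N. cmod (f n t)) \<le> (\<Sum>n<m. cmod (f n t))"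
          using that by (intro sum_mono2) auto
        moreover have "(\<Sum>n<m. cmod (f n t)) - Re (g t) \<le> \<bar>Re (g t - (\<Sum>n<m. F n t))\<bar>"
          by (simp add: F_def)
        moreover have "\<bar>Re (g t - (\<Sum>n<m. F n t))\<bar> \<le> cmod (g t - (\<Sum>n<m. F n t))"
          by (rule abs_Re_le_cmod)
        ultimately show ?thesis by (simp add: p_def)
      qed
      have d: "(\<lambda>t. g t - (\<Sum>n<m. F n t)) \<in> carr X" using g F by simp
      have "p \<in> carr X" "nrm X p \<le> nrm X (\<lambda>t. g t - (\<Sum>n<m. F n t))"
        using ideal[OF pm d] le by auto
      then show ?thesis using gle[of m] by simp
    qed
    have "nrm X p \<le> 0"
      by (rule LIMSEQ_le_const[OF suminf_tail_tendsto_zero[OF sm]]) (use p in blast)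
    then have "AE t in M. p t = 0"
      using ae_eqI[of p "\<lambda>_. 0"] p[of N] by simp
    then show ?thesis by eventually_elim (auto simp: p_def max_def split: if_splits)
  qed
  then have "AE t in M. \<forall>N. (\<Sum>n<N. cmod (f n t)) \<le> Re (g t)" by (simp add: AE_all_countable)
  then show ?thesis
  proof eventually_elim
    case (elim t)
    have "summable (\<lambda>n. cmod (f n t))"
      by (rule bounded_imp_summable[of _ "Re (g t)"]) (use elim in \<open>auto simp: lessThan_Suc_atMost[symmetric] simp del: lessThan_Suc sum.lessThan_Suc\<close>)
    then show ?case by (rule tendsto_norm_zero_cancel[OF summable_LIMSEQ_zero])
  qed
qed

end

section \<open>The sum of two Koethe spaces\<close>

locale couple = X0: koethe M X0 + X1: koethe M X1 for M :: "'a measure" and X0 X1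
begin

abbreviation "Z \<equiv> sum_space X0 X1"

lemma sum_carrI: "a \<in> carr X0 \<Longrightarrow> b \<in> carr X1 \<Longrightarrow> (\<lambda>t. a t + b t) \<in> carr Z"
  unfolding sum_space_def by auto

lemma sum_carrE:
  assumes "f \<in> carr Z" obtains a b where "a \<in> carr X0" "b \<in> carr X1" "f = (\<lambda>t. a t + b t)"
  using assms unfolding sum_space_def by auto

lemma sum_nrm_le:
  assumes "a \<in> carr X0" "b \<in> carr X1"
  shows "nrm Z (\<lambda>t. a t + b t) \<le> nrm X0 a + nrm X1 b"
  unfolding sum_space_def fspace.simps
proof (rule cInf_lower)
  show "bdd_below {nrm X0 a' + nrm X1 b' | a' b'. a' \<in> carr X0 \<and> b' \<in> carr X1 \<and>
      (\<lambda>t. a t + b t) = (\<lambda>t. a' t + b' t)}"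
    by (rule bdd_belowI[of _ 0]) auto
qed (use assms in auto)

lemma sum_nrm_ge:
  assumes "f \<in> carr Z"
    and "\<And>a b. a \<in> carr X0 \<Longrightarrow> b \<in> carr X1 \<Longrightarrow> f = (\<lambda>t. a t + b t) \<Longrightarrow> c \<le> nrm X0 a + nrm X1 b"
  shows "c \<le> nrm Z f"
proof -
  obtain a b where ab: "a \<in> carr X0" "b \<in> carr X1" "f = (\<lambda>t. a t + b t)"
    using sum_carrE[OF assms(1)] .
  show ?thesis
    unfolding sum_space_def fspace.simps
  proof (rule cInf_greatest)
    show "{nrm X0 a + nrm X1 b | a b. a \<in> carr X0 \<and> b \<in> carr X1 \<and> f = (\<lambda>t. a t + b t)} \<noteq> {}"
      using ab by auto
    fix x assume "x \<in> {nrm X0 a + nrm X1 b | a b. a \<in> carr X0 \<and> b \<in> carr X1 \<and> f = (\<lambda>t. a t + b t)}"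
    then show "c \<le> x" using assms(2) by auto
  qed
qed

lemma sum_nrm_less:
  assumes "f \<in> carr Z" "nrm Z f < c"
  obtains a b where "a \<in> carr X0" "b \<in> carr X1" "f = (\<lambda>t. a t + b t)" "nrm X0 a + nrm X1 b < c"
  using sum_nrm_ge[OF assms(1), of c] assms(2) that by fastforce

lemma left_carr: "a \<in> carr X0 \<Longrightarrow> a \<in> carr Z" and left_le: "a \<in> carr X0 \<Longrightarrow> nrm Z a \<le> nrm X0 a"
  and right_carr: "b \<in> carr X1 \<Longrightarrow> b \<in> carr Z" and right_le: "b \<in> carr X1 \<Longrightarrow> nrm Z b \<le> nrm X1 b"
  using sum_carrI[of a "\<lambda>_. 0"] sum_carrI[of "\<lambda>_. 0" b] sum_nrm_le[of a "\<lambda>_. 0"] sum_nrm_le[of "\<lambda>_. 0" b]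
  by auto

lemma sum_seminormed: "seminormed Z"
proof
  have add: "(\<lambda>t. f t + g t) \<in> carr Z" if f: "f \<in> carr Z" and g: "g \<in> carr Z" for f g
  proof -
    obtain a b where 1: "a \<in> carr X0" "b \<in> carr X1" "f = (\<lambda>t. a t + b t)"
      using sum_carrE[OF f] .
    obtain a' b' where 2: "a' \<in> carr X0" "b' \<in> carr X1" "g = (\<lambda>t. a' t + b' t)"
      using sum_carrE[OF g] .
    note * = 1 2
    have "(\<lambda>t. f t + g t) = (\<lambda>t. (a t + a' t) + (b t + b' t))" using * by auto
    then show ?thesis using sum_carrI[of "\<lambda>t. a t + a' t" "\<lambda>t. b t + b' t"] * by simp
  qed
  have mult: "(\<lambda>t. c * f t) \<in> carr Z" if f: "f \<in> carr Z" for f c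
  proof -
    obtain a b where *: "a \<in> carr X0" "b \<in> carr X1" "f = (\<lambda>t. a t + b t)"
      using sum_carrE[OF f] .
    have "(\<lambda>t. c * f t) = (\<lambda>t. c * a t + c * b t)" using * by (auto simp: algebra_simps)
    then show ?thesis using sum_carrI[of "\<lambda>t. c * a t" "\<lambda>t. c * b t"] * by simp
  qed
  show "linear_subspace (carr Z)"
    unfolding linear_subspace_def using left_carr[of "\<lambda>_. 0"] add mult by auto
  show nonneg: "0 \<le> nrm Z f" if "f \<in> carr Z" for f
    using that by (intro sum_nrm_ge) auto
  have mult_le: "nrm Z (\<lambda>t. c * f t) \<le> cmod c * nrm Z f" if f: "f \<in> carr Z" and c: "c \<noteq> 0" for f c
  proof -
    have "nrm Z (\<lambda>t. c * f t) / cmod c \<le> nrm Z f"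
    proof (rule sum_nrm_ge[OF f])
      fix a b assume *: "a \<in> carr X0" "b \<in> carr X1" "f = (\<lambda>t. a t + b t)"
      have "nrm Z (\<lambda>t. c * a t + c * b t) \<le> cmod c * nrm X0 a + cmod c * nrm X1 b"
        using sum_nrm_le[of "\<lambda>t. c * a t" "\<lambda>t. c * b t"] * by (simp add: X0.nrm_cmult X1.nrm_cmult)
      then show "nrm Z (\<lambda>t. c * f t) / cmod c \<le> nrm X0 a + nrm X1 b"
        using c * by (simp add: field_simps)
    qed
    then show ?thesis using c by (simp add: field_simps)
  qed
  show "nrm Z (\<lambda>t. c * f t) = cmod c * nrm Z f" if f: "f \<in> carr Z" for f c
  proof (cases "c = 0")
    case True
    have "nrm Z (\<lambda>_. 0) = 0"
      using left_le[of "\<lambda>_. 0"] nonneg[of "\<lambda>_. 0"] left_carr[of "\<lambda>_. 0"] by simp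
    then show ?thesis using True by simp
  next
    case False
    have "nrm Z f \<le> cmod (1/c) * nrm Z (\<lambda>t. c * f t)"
      using mult_le[OF mult[OF f, of c], of "1/c"] False by simp
    then have "cmod c * nrm Z f \<le> nrm Z (\<lambda>t. c * f t)"
      using False by (simp add: norm_divide field_simps)
    then show ?thesis using mult_le[OF f False] by simp
  qed
  show "nrm Z (\<lambda>t. f t + g t) \<le> nrm Z f + nrm Z g" if f: "f \<in> carr Z" and g: "g \<in> carr Z" for f g
  proof -
    have "nrm Z (\<lambda>t. f t + g t) - nrm Z g \<le> nrm Z f"
    proof (rule sum_nrm_ge[OF f])
      fix a b assume *: "a \<in> carr X0" "b \<in> carr X1" "f = (\<lambda>t. a t + b t)"
      have "nrm Z (\<lambda>t. f t + g t) - (nrm X0 a + nrm X1 b) \<le> nrm Z g"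
      proof (rule sum_nrm_ge[OF g])
        fix a' b' assume **: "a' \<in> carr X0" "b' \<in> carr X1" "g = (\<lambda>t. a' t + b' t)"
        have "(\<lambda>t. f t + g t) = (\<lambda>t. (a t + a' t) + (b t + b' t))" using * ** by auto
        then have "nrm Z (\<lambda>t. f t + g t) \<le> nrm X0 (\<lambda>t. a t + a' t) + nrm X1 (\<lambda>t. b t + b' t)"
          using * ** sum_nrm_le[of "\<lambda>t. a t + a' t" "\<lambda>t. b t + b' t"] by simp
        also have "\<dots> \<le> (nrm X0 a + nrm X0 a') + (nrm X1 b + nrm X1 b')"
          using * ** by (intro add_mono X0.nrm_add X1.nrm_add)
        finally show "nrm Z (\<lambda>t. f t + g t) - (nrm X0 a + nrm X1 b) \<le> nrm X0 a' + nrm X1 b'" by simp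
      qed
      then show "nrm Z (\<lambda>t. f t + g t) - nrm Z g \<le> nrm X0 a + nrm X1 b" by simp
    qed
    then show ?thesis by simp
  qed
qed

text \<open>Definiteness uses the common ambient space: if \<open>f = a n + b n\<close> with both
  parts geometrically small in norm, then both tend to 0 almost everywhere. The ideal property
  multiplies a decomposition of \<open>g\<close> by \<open>f / g\<close>, and completeness
  decomposes each term of a geometric series.\<close>

theorem sum_koethe: "koethe_space M Z"
proof (rule koethe_spaceI)
  interpret Z: seminormed Z by (rule sum_seminormed)
  show "seminormed Z" by (rule sum_seminormed)
  show "sigma_finite_measure M" by (rule X0.sigma_finite)
  show "carr Z \<subseteq> borel_measurable M"
  proof
    fix f assume "f \<in> carr Z"
    then obtain a b where *: "a \<in> carr X0" "b \<in> carr X1" "f = (\<lambda>t. a t + b t)" by (rule sum_carrE)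
    then show "f \<in> borel_measurable M"
      using X0.measurable_carr X1.measurable_carr by (simp add: borel_measurable_add)
  qed
  show "AE t in M. f t = 0" if f: "f \<in> carr Z" "nrm Z f = 0" for f
  proof -
    have "\<forall>n. \<exists>a b. a \<in> carr X0 \<and> b \<in> carr X1 \<and> f = (\<lambda>t. a t + b t) \<and> nrm X0 a + nrm X1 b < (1/2)^n"
    proof
      fix n :: nat
      have "nrm Z f < (1/2)^n" using f(2) by simp
      from sum_nrm_less[OF f(1) this]
      show "\<exists>a b. a \<in> carr X0 \<and> b \<in> carr X1 \<and> f = (\<lambda>t. a t + b t) \<and> nrm X0 a + nrm X1 b < (1/2)^n"
        by blast
    qed
    then obtain a b where ab: "\<And>n. a n \<in> carr X0" "\<And>n. b n \<in> carr X1" "\<And>n. f = (\<lambda>t. a n t + b n t)"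
      "\<And>n. nrm X0 (a n) + nrm X1 (b n) < (1/2)^n" unfolding choice_iff by blast
    have "nrm X0 (a n) \<le> (1/2)^n" "nrm X1 (b n) \<le> (1/2)^n" for n
      using ab(4)[of n] X0.nrm_nonneg[OF ab(1)[of n]] X1.nrm_nonneg[OF ab(2)[of n]] by linarith+
    then have "AE t in M. (\<lambda>n. a n t) \<longlonglongrightarrow> 0" "AE t in M. (\<lambda>n. b n t) \<longlonglongrightarrow> 0"
      using ab by (auto intro: X0.tendsto_zero_AE X1.tendsto_zero_AE)
    then show ?thesis
    proof eventually_elim
      case (elim t)
      have "(\<lambda>n. a n t + b n t) = (\<lambda>n. f t)" using fun_cong[OF ab(3)] by simp
      then have "(\<lambda>n. f t) \<longlonglongrightarrow> 0" using tendsto_add[OF elim] by simp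
      then show ?case by (simp add: LIMSEQ_const_iff)
    qed
  qed
  show "f \<in> carr Z \<and> nrm Z f \<le> nrm Z g"
    if f: "f \<in> borel_measurable M" and g: "g \<in> carr Z" and le: "AE t in M. cmod (f t) \<le> cmod (g t)" for f g
  proof -
    have *: "f \<in> carr Z \<and> nrm Z f \<le> nrm X0 a + nrm X1 b"
      if ab: "a \<in> carr X0" "b \<in> carr X1" "g = (\<lambda>t. a t + b t)" for a b
    proof -
      \<comment> \<open>Where \<open>g\<close> vanishes so does \<open>f\<close> (almost
        everywhere), so the convention \<open>f / 0 = 0\<close> is harmless.\<close>
      define h where "h t = f t / g t" for t
      have [measurable]: "a \<in> borel_measurable M" "b \<in> borel_measurable M" "f \<in> borel_measurable M"
        using ab X0.measurable_carr X1.measurable_carr f by auto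
      have hm: "h \<in> borel_measurable M" unfolding h_def ab(3) by measurable
      have h1: "AE t in M. cmod (h t) \<le> 1"
        using le by eventually_elim (auto simp: h_def norm_divide divide_le_eq_1)
      note ha = X0.mult_bounded[OF hm h1 ab(1)] and hb = X1.mult_bounded[OF hm h1 ab(2)]
      \<comment> \<open>The second part is \<open>f - h * a\<close> and not \<open>h * b\<close>:
        the sum space demands a decomposition valid at every point, and \<open>h * g = f\<close>
        holds only almost everywhere.\<close>
      have m: "(\<lambda>t. f t - h t * a t) \<in> borel_measurable M" using hm by measurable
      have "AE t in M. f t - h t * a t = h t * b t"
        using le
      proof eventually_elim
        case (elim t)
        have "h t * (a t + b t) = f t" using elim by (auto simp: h_def ab(3))
        then show ?case by (simp add: algebra_simps)
      qed
      note fb = X1.ae_cong[OF m hb(1) this]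
      have eq: "f = (\<lambda>t. h t * a t + (f t - h t * a t))" by simp
      have "f \<in> carr Z" using sum_carrI[OF ha(1) fb(1)] by simp
      moreover have "nrm Z f \<le> nrm X0 a + nrm X1 b"
        using sum_nrm_le[OF ha(1) fb(1)] ha(2) hb(2) fb(2) by simp
      ultimately show ?thesis by simp
    qed
    obtain a b where "a \<in> carr X0" "b \<in> carr X1" "g = (\<lambda>t. a t + b t)" using sum_carrE[OF g] .
    then have "f \<in> carr Z" using * by blast
    moreover have "nrm Z f \<le> nrm Z g" using * by (intro sum_nrm_ge[OF g]) blast
    ultimately show ?thesis by blast
  qed
  show Z.complete_space
  proof (rule Z.complete_spaceI)
    fix f :: "nat \<Rightarrow> 'a \<Rightarrow> complex"
    assume f: "\<And>n. f n \<in> carr Z" "\<And>n. nrm Z (f n) \<le> (1/2)^n"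
    \<comment> \<open>The factor 2 provides the strict inequality needed to choose a representative
      below an infimum.\<close>
    have "\<exists>a b. a \<in> carr X0 \<and> b \<in> carr X1 \<and> f n = (\<lambda>t. a t + b t) \<and> nrm X0 a + nrm X1 b < 2 * (1/2)^n" for n
    proof -
      have "nrm Z (f n) < 2 * (1/2)^n" using f(2)[of n] by (rule le_less_trans) simp
      from sum_nrm_less[OF f(1) this] show ?thesis by blast
    qed
    then have "\<forall>n. \<exists>a b. a \<in> carr X0 \<and> b \<in> carr X1 \<and> f n = (\<lambda>t. a t + b t) \<and> nrm X0 a + nrm X1 b < 2 * (1/2)^n"
      by blast
    then obtain a b where ab: "\<And>n. a n \<in> carr X0" "\<And>n. b n \<in> carr X1" "\<And>n. f n = (\<lambda>t. a n t + b n t)"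
      "\<And>n. nrm X0 (a n) + nrm X1 (b n) < 2 * (1/2)^n" unfolding choice_iff by blast
    have le: "nrm X0 (a n) \<le> 2 * (1/2)^n" "nrm X1 (b n) \<le> 2 * (1/2)^n" for n
      using ab(4)[of n] X0.nrm_nonneg[OF ab(1)[of n]] X1.nrm_nonneg[OF ab(2)[of n]] by linarith+
    have sm: "summable (\<lambda>n. 2 * (1/2::real)^n)" by (intro summable_mult) (simp add: summable_geometric)
    obtain ga where ga: "ga \<in> carr X0"
      "\<And>N. nrm X0 (\<lambda>t. ga t - (\<Sum>n<N. a n t)) \<le> (\<Sum>n. 2 * (1/2)^(n + N))"
      using X0.complete_space_series[OF X0.complete ab(1) le(1) sm] by blast
    obtain gb where gb: "gb \<in> carr X1"
      "\<And>N. nrm X1 (\<lambda>t. gb t - (\<Sum>n<N. b n t)) \<le> (\<Sum>n. 2 * (1/2)^(n + N))"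
      using X1.complete_space_series[OF X1.complete ab(2) le(2) sm] by blast
    let ?T = "\<lambda>N. \<Sum>n. 2 * (1/2::real)^(n + N)"
    have g: "(\<lambda>t. ga t + gb t) \<in> carr Z" using ga gb by (intro sum_carrI)
    have bound: "nrm Z (\<lambda>t. ga t + gb t - (\<Sum>n<N. f n t)) \<le> ?T N + ?T N" for N
    proof -
      have eq: "(\<lambda>t. ga t + gb t - (\<Sum>n<N. f n t))
          = (\<lambda>t. (ga t - (\<Sum>n<N. a n t)) + (gb t - (\<Sum>n<N. b n t)))"
        by (subst ab(3)) (simp add: sum.distrib algebra_simps)
      have "nrm Z (\<lambda>t. (ga t - (\<Sum>n<N. a n t)) + (gb t - (\<Sum>n<N. b n t)))
          \<le> nrm X0 (\<lambda>t. ga t - (\<Sum>n<N. a n t)) + nrm X1 (\<lambda>t. gb t - (\<Sum>n<N. b n t))"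
        using ga gb ab by (intro sum_nrm_le) auto
      then show ?thesis unfolding eq using ga(2)[of N] gb(2)[of N] by linarith
    qed
    have "(\<lambda>N. nrm Z (\<lambda>t. ga t + gb t - (\<Sum>n<N. f n t))) \<longlonglongrightarrow> 0"
    proof (rule Lim_null_comparison)
      show "(\<lambda>N. ?T N + ?T N) \<longlonglongrightarrow> 0"
        using tendsto_add[OF suminf_tail_tendsto_zero[OF sm] suminf_tail_tendsto_zero[OF sm]] by simp
      show "\<forall>\<^sub>F N in sequentially. norm (nrm Z (\<lambda>t. ga t + gb t - (\<Sum>n<N. f n t))) \<le> ?T N + ?T N"
        using bound g f by simp
    qed
    with g show "\<exists>g\<in>carr Z. (\<lambda>N. nrm Z (\<lambda>t. g t - (\<Sum>n<N. f n t))) \<longlonglongrightarrow> 0"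
      by (intro bexI[of _ "\<lambda>t. ga t + gb t"])
  qed
qed

end

sublocale couple \<subseteq> Z: koethe M "sum_space X0 X1"
  by unfold_locales (rule sum_koethe)

section \<open>The Calderon space\<close>

lemma continuous_in_le:
  assumes "continuous_in X A g"
    and "\<And>w z. w \<in> A \<Longrightarrow> z \<in> A \<Longrightarrow> 0 \<le> nrm Y (\<lambda>t. g' w t - g' z t)"
    and "\<And>w z. w \<in> A \<Longrightarrow> z \<in> A \<Longrightarrow> nrm Y (\<lambda>t. g' w t - g' z t) \<le> nrm X (\<lambda>t. g w t - g z t)"
  shows "continuous_in Y A g'"
  unfolding continuous_in_def
proof
  fix z assume z: "z \<in> A"
  have lim: "((\<lambda>w. nrm X (\<lambda>t. g w t - g z t)) \<longlongrightarrow> 0) (at z within A)"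
    using assms(1) z by (auto simp: continuous_in_def)
  show "((\<lambda>w. nrm Y (\<lambda>t. g' w t - g' z t)) \<longlongrightarrow> 0) (at z within A)"
    by (rule Lim_null_comparison[OF _ lim], unfold eventually_at_filter, rule always_eventually)
      (use assms(2,3) z in auto)
qed

lemma continuous_in_subset: "continuous_in X A g \<Longrightarrow> B \<subseteq> A \<Longrightarrow> continuous_in X B g"
  unfolding continuous_in_def by (meson subsetD tendsto_within_subset)

context seminormed
begin

lemma continuous_in_add:
  assumes "continuous_in X A g" "continuous_in X A h"
    and c: "\<And>z. z \<in> A \<Longrightarrow> g z \<in> carr X" "\<And>z. z \<in> A \<Longrightarrow> h z \<in> carr X"
  shows "continuous_in X A (\<lambda>z t. g z t + h z t)"
  unfolding continuous_in_def
proof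
  fix z assume z: "z \<in> A"
  have lim: "((\<lambda>w. nrm X (\<lambda>t. g w t - g z t) + nrm X (\<lambda>t. h w t - h z t)) \<longlongrightarrow> 0) (at z within A)"
    using assms(1,2) z by (intro tendsto_add_zero) (auto simp: continuous_in_def)
  have le: "norm (nrm X (\<lambda>t. g w t + h w t - (g z t + h z t)))
      \<le> nrm X (\<lambda>t. g w t - g z t) + nrm X (\<lambda>t. h w t - h z t)" if "w \<in> A" for w
    using nrm_add[of "\<lambda>t. g w t - g z t" "\<lambda>t. h w t - h z t"] c[OF that] c[OF z]
    by (simp add: algebra_simps)
  show "((\<lambda>w. nrm X (\<lambda>t. g w t + h w t - (g z t + h z t))) \<longlongrightarrow> 0) (at z within A)"
    by (rule Lim_null_comparison[OF _ lim], unfold eventually_at_filter, rule always_eventually)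
      (use le in auto)
qed

lemma continuous_in_scalar:
  assumes g: "continuous_in X A g" "\<And>z. z \<in> A \<Longrightarrow> g z \<in> carr X" and c: "continuous_on A c"
  shows "continuous_in X A (\<lambda>z t. c z * g z t)"
  unfolding continuous_in_def
proof
  fix z assume z: "z \<in> A"
  have "(c \<longlongrightarrow> c z) (at z within A)" using c z by (simp add: continuous_on_def)
  moreover have "((\<lambda>w. nrm X (\<lambda>t. g w t - g z t)) \<longlongrightarrow> 0) (at z within A)"
    using g z by (auto simp: continuous_in_def)
  ultimately have "((\<lambda>w. cmod (c w) * nrm X (\<lambda>t. g w t - g z t) + cmod (c w - c z) * nrm X (g z))
      \<longlongrightarrow> cmod (c z) * 0 + cmod (c z - c z) * nrm X (g z)) (at z within A)"
    by (intro tendsto_intros)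
  then have lim: "((\<lambda>w. cmod (c w) * nrm X (\<lambda>t. g w t - g z t) + cmod (c w - c z) * nrm X (g z))
      \<longlongrightarrow> 0) (at z within A)" by simp
  have le: "norm (nrm X (\<lambda>t. c w * g w t - c z * g z t))
      \<le> cmod (c w) * nrm X (\<lambda>t. g w t - g z t) + cmod (c w - c z) * nrm X (g z)" if "w \<in> A" for w
  proof -
    have "(\<lambda>t. c w * g w t - c z * g z t) = (\<lambda>t. c w * (g w t - g z t) + (c w - c z) * g z t)"
      by (simp add: algebra_simps)
    then show ?thesis
      using nrm_add[of "\<lambda>t. c w * (g w t - g z t)" "\<lambda>t. (c w - c z) * g z t"] g(2)[OF that] g(2)[OF z]
      by (simp add: nrm_cmult)
  qed
  show "((\<lambda>w. nrm X (\<lambda>t. c w * g w t - c z * g z t)) \<longlongrightarrow> 0) (at z within A)"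
    by (rule Lim_null_comparison[OF _ lim], unfold eventually_at_filter, rule always_eventually)
      (use le in auto)
qed

lemma continuous_in_uniform_limit:
  assumes G: "\<And>z. z \<in> A \<Longrightarrow> G z \<in> carr X" and S: "\<And>n z. z \<in> A \<Longrightarrow> S n z \<in> carr X"
    and cont: "\<And>n. continuous_in X A (S n)"
    and le: "\<And>n z. z \<in> A \<Longrightarrow> nrm X (\<lambda>t. G z t - S n z t) \<le> c n" and c: "c \<longlonglongrightarrow> (0::real)"
  shows "continuous_in X A G"
  unfolding continuous_in_def
proof
  fix z assume z: "z \<in> A"
  show "((\<lambda>w. nrm X (\<lambda>t. G w t - G z t)) \<longlongrightarrow> 0) (at z within A)"
  proof (rule tendstoI)
    fix e :: real assume e: "e > 0"
    then obtain n where n: "c n < e/3"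
      using order_tendstoD(2)[OF c, of "e/3"] by (auto simp: eventually_sequentially)
    have "((\<lambda>w. nrm X (\<lambda>t. S n w t - S n z t)) \<longlongrightarrow> 0) (at z within A)"
      using cont z by (auto simp: continuous_in_def)
    then have "\<forall>\<^sub>F w in at z within A. nrm X (\<lambda>t. S n w t - S n z t) < e/3"
      using e by (intro order_tendstoD(2)) auto
    moreover have "\<forall>\<^sub>F w in at z within A. w \<in> A"
      by (simp add: eventually_at_filter)
    ultimately show "\<forall>\<^sub>F w in at z within A. dist (nrm X (\<lambda>t. G w t - G z t)) 0 < e"
    proof eventually_elim
      case (elim w)
      have "nrm X (\<lambda>t. G w t - G z t) \<le> nrm X (\<lambda>t. G w t - S n w t) + nrm X (\<lambda>t. S n w t - G z t)"
        using G S elim z by (intro nrm_diff_triangle) auto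
      also have "nrm X (\<lambda>t. S n w t - G z t) \<le> nrm X (\<lambda>t. S n w t - S n z t) + nrm X (\<lambda>t. S n z t - G z t)"
        using G S elim z by (intro nrm_diff_triangle) auto
      also have "nrm X (\<lambda>t. S n z t - G z t) = nrm X (\<lambda>t. G z t - S n z t)"
        using G S elim z by (intro nrm_diff_commute) auto
      finally have "nrm X (\<lambda>t. G w t - G z t) < e"
        using le[OF elim(2), of n] le[OF z, of n] elim(1) n by linarith
      then show ?case using G elim z by simp
    qed
  qed
qed

end

lemma line_in_strip [simp]: "Complex 0 y \<in> strip" "Complex 1 y \<in> strip"
  by (auto simp: strip_def)

context couple
begin

abbreviation "H \<equiv> calderon X0 X1"
abbreviation "hnrm \<equiv> calderon_norm X0 X1"

lemma calderonD:
  assumes "g \<in> H"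
  shows "z \<in> strip \<Longrightarrow> g z \<in> carr Z" "\<exists>C. \<forall>z\<in>strip. nrm Z (g z) \<le> C" "continuous_in Z strip g"
    "g (Complex 0 y) \<in> carr X0" "\<exists>C. \<forall>y. nrm X0 (g (Complex 0 y)) \<le> C"
    "continuous_in X0 UNIV (\<lambda>y. g (Complex 0 y))"
    "g (Complex 1 y) \<in> carr X1" "\<exists>C. \<forall>y. nrm X1 (g (Complex 1 y)) \<le> C"
    "continuous_in X1 UNIV (\<lambda>y. g (Complex 1 y))"
  using assms unfolding calderon_def bounded_in_def by auto

lemma eventually_carr:
  assumes "\<And>z. z \<in> strip \<Longrightarrow> g z \<in> carr Z" "z \<in> interior strip"
  shows "\<forall>\<^sub>F w in at z. g w \<in> carr Z"
proof -
  have "\<forall>\<^sub>F w in at z. w \<in> interior strip"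
    using assms(2) by (simp add: eventually_at_in_open')
  then show ?thesis by (rule eventually_mono) (use assms(1) interior_subset in blast)
qed

lemma calderon_holomorphic:
  assumes g: "g \<in> H" and \<phi>: "contraction Z \<phi>"
  shows "(\<lambda>z. \<phi> (g z)) holomorphic_on interior strip"
proof -
  have "\<exists>d. ((\<lambda>z. \<phi> (g z)) has_field_derivative d) (at z)" if z: "z \<in> interior strip" for z
  proof -
    have "\<exists>d. complex_deriv_in Z g d z" using g z unfolding calderon_def by blast
    then show ?thesis
      using Z.contraction_has_field_derivative[OF \<phi>, of g _ z] eventually_carr[of g z]
        calderonD(1)[OF g] z interior_subset by blast
  qed
  then show ?thesis by (subst holomorphic_on_open) auto
qed

text \<open>Derivatives are replaced by holomorphy after each contraction: a bound on the strip and
  completeness of the sum space restore the strong derivative. This is how functions are shown to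
  lie in \<open>H\<close> below.\<close>

lemma calderonI:
  assumes "\<And>z. z \<in> strip \<Longrightarrow> g z \<in> carr Z" "\<And>z. z \<in> strip \<Longrightarrow> nrm Z (g z) \<le> C" "continuous_in Z strip g"
    "\<And>\<phi>. contraction Z \<phi> \<Longrightarrow> (\<lambda>z. \<phi> (g z)) holomorphic_on interior strip"
    "\<And>y. g (Complex 0 y) \<in> carr X0" "\<And>y. nrm X0 (g (Complex 0 y)) \<le> C0"
    "continuous_in X0 UNIV (\<lambda>y. g (Complex 0 y))"
    "\<And>y. g (Complex 1 y) \<in> carr X1" "\<And>y. nrm X1 (g (Complex 1 y)) \<le> C1"
    "continuous_in X1 UNIV (\<lambda>y. g (Complex 1 y))"
  shows "g \<in> H"
proof -
  have "\<exists>d. complex_deriv_in Z g d z" if z: "z \<in> interior strip" for z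
  proof -
    obtain r where r: "r > 0" "ball z r \<subseteq> interior strip"
      using z open_contains_ball[of "interior strip"] by auto
    then have s: "ball z r \<subseteq> strip" using interior_subset by blast
    show ?thesis
      using s by (intro Z.weakly_holomorphic_imp_deriv[OF Z.complete r(1), where A=C] assms(1,2)
          holomorphic_on_subset[OF assms(4) r(2)]) auto
  qed
  then show ?thesis unfolding calderon_def bounded_in_def using assms by blast
qed

lemma hnrm_bdd:
  assumes g: "g \<in> H"
  shows "bdd_above (range (\<lambda>y. max (nrm X0 (g (Complex 0 y))) (nrm X1 (g (Complex 1 y)))))"
proof -
  obtain C0 C1 where "\<And>y. nrm X0 (g (Complex 0 y)) \<le> C0" "\<And>y. nrm X1 (g (Complex 1 y)) \<le> C1"
    using calderonD(5,8)[OF g] by blast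
  then show ?thesis by (intro bdd_aboveI[of _ "max C0 C1"]) (auto simp: max.coboundedI1 max.coboundedI2)
qed

lemma le_hnrm:
  assumes g: "g \<in> H"
  shows "nrm X0 (g (Complex 0 y)) \<le> hnrm g" "nrm X1 (g (Complex 1 y)) \<le> hnrm g" "0 \<le> hnrm g"
proof -
  have "max (nrm X0 (g (Complex 0 y))) (nrm X1 (g (Complex 1 y))) \<le> hnrm g"
    unfolding calderon_norm_def by (rule cSUP_upper[OF UNIV_I hnrm_bdd[OF g]])
  then show "nrm X0 (g (Complex 0 y)) \<le> hnrm g" "nrm X1 (g (Complex 1 y)) \<le> hnrm g" by auto
  then show "0 \<le> hnrm g" using X0.nrm_nonneg[OF calderonD(4)[OF g, of y]] by linarith
qed

lemma hnrm_leI: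
  assumes "\<And>y. nrm X0 (g (Complex 0 y)) \<le> c" "\<And>y. nrm X1 (g (Complex 1 y)) \<le> c"
  shows "hnrm g \<le> c"
  unfolding calderon_norm_def using assms by (intro cSUP_least) auto

text \<open>Tested against contractions of \<open>Z\<close>. The inclusions of \<open>X0\<close> and
  \<open>X1\<close> into \<open>Z\<close> do not increase norms, so the boundary bounds carry
  over.\<close>

theorem calderon_maximum_principle:
  assumes g: "g \<in> H" and z: "z \<in> strip"
  shows "nrm Z (g z) \<le> hnrm g"
proof (rule Z.nrm_leI)
  show "g z \<in> carr Z" using calderonD(1)[OF g z] .
  fix \<phi> assume \<phi>: "contraction Z \<phi>"
  obtain C where C: "\<And>z. z \<in> strip \<Longrightarrow> nrm Z (g z) \<le> C" using calderonD(2)[OF g] by blast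
  show "cmod (\<phi> (g z)) \<le> hnrm g"
  proof (rule strip_maximum_principle[OF _ _ _ _ _ z, of "\<lambda>z. \<phi> (g z)" C])
    show "continuous_on strip (\<lambda>z. \<phi> (g z))"
      by (rule Z.contraction_continuous_on[OF \<phi> calderonD(3)[OF g] calderonD(1)[OF g]])
    show "(\<lambda>z. \<phi> (g z)) holomorphic_on interior strip" by (rule calderon_holomorphic[OF g \<phi>])
    show "cmod (\<phi> (g z)) \<le> C" if "z \<in> strip" for z
      using Z.contraction_le[OF \<phi> calderonD(1)[OF g that]] C[OF that] by linarith
    show "cmod (\<phi> (g (Complex 0 y))) \<le> hnrm g" for y
      using Z.contraction_le[OF \<phi> calderonD(1)[OF g], of "Complex 0 y"]
        left_le[OF calderonD(4)[OF g, of y]] le_hnrm(1)[OF g, of y] by simp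
    show "cmod (\<phi> (g (Complex 1 y))) \<le> hnrm g" for y
      using Z.contraction_le[OF \<phi> calderonD(1)[OF g], of "Complex 1 y"]
        right_le[OF calderonD(7)[OF g, of y]] le_hnrm(2)[OF g, of y] by simp
  qed
qed

lemma calderon_zero: "(\<lambda>z t. 0) \<in> H"
  by (rule calderonI[where C=0 and ?C0.0=0 and ?C1.0=0]) (auto simp: continuous_in_def Z.contraction_zero)

lemma calderon_add:
  assumes f: "f \<in> H" and g: "g \<in> H"
  shows "(\<lambda>z t. f z t + g z t) \<in> H" "hnrm (\<lambda>z t. f z t + g z t) \<le> hnrm f + hnrm g"
proof -
  note F = calderonD[OF f] and G = calderonD[OF g]
  have 0: "nrm X0 (\<lambda>t. f (Complex 0 y) t + g (Complex 0 y) t) \<le> hnrm f + hnrm g" for y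
    using X0.nrm_add[OF F(4) G(4), of y y] le_hnrm(1)[OF f, of y] le_hnrm(1)[OF g, of y] by linarith
  have 1: "nrm X1 (\<lambda>t. f (Complex 1 y) t + g (Complex 1 y) t) \<le> hnrm f + hnrm g" for y
    using X1.nrm_add[OF F(7) G(7), of y y] le_hnrm(2)[OF f, of y] le_hnrm(2)[OF g, of y] by linarith
  show "hnrm (\<lambda>z t. f z t + g z t) \<le> hnrm f + hnrm g" by (rule hnrm_leI) (use 0 1 in auto)
  show "(\<lambda>z t. f z t + g z t) \<in> H"
  proof (rule calderonI[OF _ _ _ _ _ 0 _ _ 1])
    show "nrm Z (\<lambda>t. f z t + g z t) \<le> hnrm f + hnrm g" if "z \<in> strip" for z
      using Z.nrm_add[OF F(1)[OF that] G(1)[OF that]] calderon_maximum_principle[OF f that]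
        calderon_maximum_principle[OF g that] by linarith
    show "(\<lambda>z. \<phi> (\<lambda>t. f z t + g z t)) holomorphic_on interior strip" if \<phi>: "contraction Z \<phi>" for \<phi>
    proof -
      have "(\<lambda>z. \<phi> (f z) + \<phi> (g z)) holomorphic_on interior strip"
        by (intro holomorphic_intros calderon_holomorphic f g \<phi>)
      moreover have "\<phi> (\<lambda>t. f z t + g z t) = \<phi> (f z) + \<phi> (g z)" if "z \<in> interior strip" for z
        using that interior_subset F(1) G(1) by (intro Z.contraction_add[OF \<phi>]) auto
      ultimately show ?thesis by (simp cong: holomorphic_cong)
    qed
  qed (use F G in \<open>auto intro!: Z.continuous_in_add X0.continuous_in_add X1.continuous_in_add\<close>)
qed

lemma calderon_scalar:
  assumes g: "g \<in> H" and c: "continuous_on strip c" "c holomorphic_on interior strip"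
    and le: "\<And>z. z \<in> strip \<Longrightarrow> cmod (c z) \<le> K"
  shows "(\<lambda>z t. c z * g z t) \<in> H" "hnrm (\<lambda>z t. c z * g z t) \<le> K * hnrm g"
proof -
  note G = calderonD[OF g]
  have K: "K \<ge> 0" by (rule order_trans[OF norm_ge_zero le[OF line_in_strip(1)]])
  have 0: "nrm X0 (\<lambda>t. c (Complex 0 y) * g (Complex 0 y) t) \<le> K * hnrm g" for y
    unfolding X0.nrm_cmult[OF G(4)] using le le_hnrm(1)[OF g] K G(4) by (intro mult_mono) auto
  have 1: "nrm X1 (\<lambda>t. c (Complex 1 y) * g (Complex 1 y) t) \<le> K * hnrm g" for y
    unfolding X1.nrm_cmult[OF G(7)] using le le_hnrm(2)[OF g] K G(7) by (intro mult_mono) auto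
  have c01: "continuous_on UNIV (\<lambda>y. c (Complex 0 y))" "continuous_on UNIV (\<lambda>y. c (Complex 1 y))"
  proof -
    have *: "continuous_on UNIV (Complex a)" for a
      unfolding Complex_eq by (intro continuous_intros)
    show "continuous_on UNIV (\<lambda>y. c (Complex 0 y))" "continuous_on UNIV (\<lambda>y. c (Complex 1 y))"
      by (rule continuous_on_compose2[OF c(1) *]; auto)+
  qed
  show "hnrm (\<lambda>z t. c z * g z t) \<le> K * hnrm g" by (rule hnrm_leI) (use 0 1 in auto)
  show "(\<lambda>z t. c z * g z t) \<in> H"
  proof (rule calderonI[OF _ _ _ _ _ 0 _ _ 1])
    show "nrm Z (\<lambda>t. c z * g z t) \<le> K * hnrm g" if "z \<in> strip" for z
      unfolding Z.nrm_cmult[OF G(1)[OF that]]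
      using le[OF that] calderon_maximum_principle[OF g that] K G(1)[OF that] by (intro mult_mono) auto
    show "(\<lambda>z. \<phi> (\<lambda>t. c z * g z t)) holomorphic_on interior strip" if \<phi>: "contraction Z \<phi>" for \<phi>
    proof -
      have "(\<lambda>z. c z * \<phi> (g z)) holomorphic_on interior strip"
        by (intro holomorphic_intros calderon_holomorphic g \<phi> c)
      moreover have "\<phi> (\<lambda>t. c z * g z t) = c z * \<phi> (g z)" if "z \<in> interior strip" for z
        using that interior_subset G(1) by (intro Z.contraction_cmult[OF \<phi>]) auto
      ultimately show ?thesis by (simp cong: holomorphic_cong)
    qed
  qed (use G c01 c in \<open>auto intro!: Z.continuous_in_scalar X0.continuous_in_scalar X1.continuous_in_scalar\<close>)
qed

lemma calderon_const:
  assumes "g \<in> H" shows "(\<lambda>z t. c * g z t) \<in> H" "hnrm (\<lambda>z t. c * g z t) \<le> cmod c * hnrm g"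
  using calderon_scalar[OF assms, of "\<lambda>_. c" "cmod c"] by auto

lemma calderon_diff:
  assumes f: "f \<in> H" and g: "g \<in> H"
  shows "(\<lambda>z t. f z t - g z t) \<in> H" "hnrm (\<lambda>z t. f z t - g z t) \<le> hnrm f + hnrm g"
  using calderon_add[OF f calderon_const(1)[OF g, of "-1"]] calderon_const(2)[OF g, of "-1"] by auto

lemma calderon_sum: "(\<And>k. k \<in> A \<Longrightarrow> f k \<in> H) \<Longrightarrow> (\<lambda>z t. \<Sum>k\<in>A. f k z t) \<in> H"
  by (induction A rule: infinite_finite_induct) (auto intro: calderon_add calderon_zero)

lemma calderon_sum_list: "(\<And>x. x \<in> set xs \<Longrightarrow> f x \<in> H) \<Longrightarrow> (\<lambda>z t. \<Sum>x\<leftarrow>xs. f x z t) \<in> H"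
  by (induction xs) (auto intro: calderon_add calderon_zero)

text \<open>Agreement with \<open>h * g\<close> is asked only almost everywhere, for each
  \<open>z\<close> separately. This freedom allows a value to be changed on a null set at a single
  point, as the definition of the interpolation space by exact equality at \<open>\<theta>\<close>
  requires.\<close>

lemma calderon_dominated:
  assumes g: "g \<in> H" and h: "h \<in> borel_measurable M" "AE t in M. cmod (h t) \<le> 1"
    and g': "\<And>z. z \<in> strip \<Longrightarrow> g' z \<in> borel_measurable M"
      "\<And>z. z \<in> strip \<Longrightarrow> AE t in M. g' z t = h t * g z t"
  shows "g' \<in> H" "hnrm g' \<le> hnrm g"
proof -
  note G = calderonD[OF g]
  have Z: "g' z \<in> carr Z" "nrm Z (g' z) \<le> nrm Z (g z)" if "z \<in> strip" for z
    using Z.ae_cong[OF g'(1) Z.mult_bounded(1)[OF h G(1)] g'(2)] Z.mult_bounded(2)[OF h G(1)] that by auto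
  have X0: "g' (Complex 0 y) \<in> carr X0" "nrm X0 (g' (Complex 0 y)) \<le> hnrm g" for y
    using X0.ae_cong[OF g'(1) X0.mult_bounded(1)[OF h G(4)] g'(2)] X0.mult_bounded(2)[OF h G(4), of y]
      le_hnrm(1)[OF g, of y] by auto
  have X1: "g' (Complex 1 y) \<in> carr X1" "nrm X1 (g' (Complex 1 y)) \<le> hnrm g" for y
    using X1.ae_cong[OF g'(1) X1.mult_bounded(1)[OF h G(7)] g'(2)] X1.mult_bounded(2)[OF h G(7), of y]
      le_hnrm(2)[OF g, of y] by auto
  show "hnrm g' \<le> hnrm g" by (rule hnrm_leI) (use X0 X1 in auto)
  have le: "AE t in M. cmod (g' w t - g' z t) \<le> cmod (g w t - g z t)" if "w \<in> strip" "z \<in> strip" for w z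
    using g'(2)[OF that(1)] g'(2)[OF that(2)] h(2)
    by eventually_elim (simp add: right_diff_distrib[symmetric] norm_mult mult_left_le_one_le)
  have m: "(\<lambda>t. g' w t - g' z t) \<in> borel_measurable M" if "w \<in> strip" "z \<in> strip" for w z
    using that g'(1) by (intro borel_measurable_diff) auto
  show "g' \<in> H"
  proof (rule calderonI[OF Z(1) _ _ _ X0 _ X1])
    show "nrm Z (g' z) \<le> hnrm g" if "z \<in> strip" for z
      using Z(2)[OF that] calderon_maximum_principle[OF g that] by linarith
    show "continuous_in Z strip g'"
      by (rule continuous_in_le[OF G(3)]) (use Z Z.ideal(2)[OF m _ le] G in auto)
    show "continuous_in X0 UNIV (\<lambda>y. g' (Complex 0 y))"
      by (rule continuous_in_le[OF G(6)]) (use X0 X0.ideal(2)[OF m _ le] G in auto)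
    show "continuous_in X1 UNIV (\<lambda>y. g' (Complex 1 y))"
      by (rule continuous_in_le[OF G(9)]) (use X1 X1.ideal(2)[OF m _ le] G in auto)
    fix \<phi> assume \<phi>: "contraction Z \<phi>"
    \<comment> \<open>Multiplication by \<open>h\<close> is absorbed into the functional, so
      holomorphy of \<open>\<phi> (h * g z)\<close> is that of \<open>g\<close> tested against
      another contraction.\<close>
    have \<psi>: "contraction Z (\<lambda>f. \<phi> (\<lambda>t. h t * f t))"
      unfolding contraction_def
    proof (intro conjI ballI allI)
      fix f k assume fk: "f \<in> carr Z" "k \<in> carr Z"
      show "\<phi> (\<lambda>t. h t * (f t + k t)) = \<phi> (\<lambda>t. h t * f t) + \<phi> (\<lambda>t. h t * k t)"
        using Z.contraction_add[OF \<phi> Z.mult_bounded(1)[OF h fk(1)] Z.mult_bounded(1)[OF h fk(2)]]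
        by (simp add: distrib_left)
    next
      fix c f assume f: "f \<in> carr Z"
      show "\<phi> (\<lambda>t. h t * (c * f t)) = c * \<phi> (\<lambda>t. h t * f t)"
        using Z.contraction_cmult[OF \<phi> Z.mult_bounded(1)[OF h f], of c] by (simp add: mult.left_commute)
    next
      fix f assume f: "f \<in> carr Z"
      show "cmod (\<phi> (\<lambda>t. h t * f t)) \<le> nrm Z f"
        using Z.contraction_le[OF \<phi> Z.mult_bounded(1)[OF h f]] Z.mult_bounded(2)[OF h f] by linarith
    qed
    have "\<phi> (g' z) = \<phi> (\<lambda>t. h t * g z t)" if "z \<in> interior strip" for z
    proof -
      have z: "z \<in> strip" using that interior_subset by blast
      have hg: "(\<lambda>t. h t * g z t) \<in> carr Z" by (rule Z.mult_bounded(1)[OF h G(1)[OF z]])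
      have d: "(\<lambda>t. g' z t - h t * g z t) \<in> carr Z" using Z(1)[OF z] hg by simp
      have "AE t in M. g' z t - h t * g z t = 0" using g'(2)[OF z] by eventually_elim simp
      then have "nrm Z (\<lambda>t. g' z t - h t * g z t) = 0" using Z.nrm_eq_0_iff[OF d] by blast
      then have "\<phi> (\<lambda>t. g' z t - h t * g z t) = 0" using Z.contraction_le[OF \<phi> d] by simp
      then show ?thesis using Z.contraction_diff[OF \<phi> Z(1)[OF z] hg] by simp
    qed
    then show "(\<lambda>z. \<phi> (g' z)) holomorphic_on interior strip"
      using calderon_holomorphic[OF g \<psi>] by (simp cong: holomorphic_cong)
  qed
qed

text \<open>Completeness of \<open>H\<close>. The bounds on the terms hold at every point of the
  strip by the maximum principle, so the convergence is uniform and keeps continuity and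
  holomorphy.\<close>

lemma calderon_series:
  assumes g: "\<And>n. g n \<in> H" and le: "\<And>n. hnrm (g n) \<le> c n" and c: "summable c"
  shows "\<exists>G\<in>H. \<forall>N. hnrm (\<lambda>z t. G z t - (\<Sum>n<N. g n z t)) \<le> (\<Sum>n. c (n + N))"
proof -
  note D = calderonD[OF g]
  define T where "T N = (\<Sum>n. c (n + N))" for N
  have T: "T \<longlonglongrightarrow> 0" unfolding T_def by (rule suminf_tail_tendsto_zero[OF c])
  \<comment> \<open>A limit in \<open>Z\<close> is determined only up to a null set, and on a
    boundary line it must converge in \<open>X0\<close> or \<open>X1\<close> as well. There the
    limit is taken in the smaller space, and convergence in \<open>Z\<close> follows.\<close>
  define P where "P z L \<longleftrightarrow> L \<in> carr Z \<and> (\<forall>N. nrm Z (\<lambda>t. L t - (\<Sum>n<N. g n z t)) \<le> T N) \<and>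
      (Re z = 0 \<longrightarrow> L \<in> carr X0 \<and> (\<forall>N. nrm X0 (\<lambda>t. L t - (\<Sum>n<N. g n z t)) \<le> T N)) \<and>
      (Re z = 1 \<longrightarrow> L \<in> carr X1 \<and> (\<forall>N. nrm X1 (\<lambda>t. L t - (\<Sum>n<N. g n z t)) \<le> T N))" for z L
  have "\<exists>L. P z L" if z: "z \<in> strip" for z
  proof -
    consider "Re z = 0" | "Re z = 1" | "Re z \<noteq> 0" "Re z \<noteq> 1" by blast
    then show ?thesis
    proof cases
      case 1
      then have ze: "z = Complex 0 (Im z)" by (simp add: complex_eq_iff)
      have gz: "g n z \<in> carr X0" "nrm X0 (g n z) \<le> c n" for n
        using D(4)[of n "Im z"] le_hnrm(1)[OF g, of n "Im z"] le[of n] ze by auto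
      obtain L where L: "L \<in> carr X0" "\<And>N. nrm X0 (\<lambda>t. L t - (\<Sum>n<N. g n z t)) \<le> T N"
        using X0.complete_space_series[OF X0.complete gz c] unfolding T_def by blast
      have "nrm Z (\<lambda>t. L t - (\<Sum>n<N. g n z t)) \<le> T N" for N
        using left_le[of "\<lambda>t. L t - (\<Sum>n<N. g n z t)"] L(2)[of N] L(1) gz by simp
      then show ?thesis unfolding P_def using L left_carr 1 by auto
    next
      case 2
      then have ze: "z = Complex 1 (Im z)" by (simp add: complex_eq_iff)
      have gz: "g n z \<in> carr X1" "nrm X1 (g n z) \<le> c n" for n
        using D(7)[of n "Im z"] le_hnrm(2)[OF g, of n "Im z"] le[of n] ze by auto
      obtain L where L: "L \<in> carr X1" "\<And>N. nrm X1 (\<lambda>t. L t - (\<Sum>n<N. g n z t)) \<le> T N"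
        using X1.complete_space_series[OF X1.complete gz c] unfolding T_def by blast
      have "nrm Z (\<lambda>t. L t - (\<Sum>n<N. g n z t)) \<le> T N" for N
        using right_le[of "\<lambda>t. L t - (\<Sum>n<N. g n z t)"] L(2)[of N] L(1) gz by simp
      then show ?thesis unfolding P_def using L right_carr 2 by auto
    next
      case 3
      have gz: "g n z \<in> carr Z" "nrm Z (g n z) \<le> c n" for n
        using D(1)[OF z] calderon_maximum_principle[OF g z, of n] le[of n] by auto
      show ?thesis
        using Z.complete_space_series[OF Z.complete gz c] 3 unfolding P_def T_def by blast
    qed
  qed
  then obtain G where G: "\<And>z. z \<in> strip \<Longrightarrow> P z (G z)" by metis
  have GZ: "G z \<in> carr Z" "nrm Z (\<lambda>t. G z t - (\<Sum>n<N. g n z t)) \<le> T N" if "z \<in> strip" for z N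
    using G[OF that] by (auto simp: P_def)
  have G0: "G (Complex 0 y) \<in> carr X0" "nrm X0 (\<lambda>t. G (Complex 0 y) t - (\<Sum>n<N. g n (Complex 0 y) t)) \<le> T N" for y N
    using G[of "Complex 0 y"] by (auto simp: P_def)
  have G1: "G (Complex 1 y) \<in> carr X1" "nrm X1 (\<lambda>t. G (Complex 1 y) t - (\<Sum>n<N. g n (Complex 1 y) t)) \<le> T N" for y N
    using G[of "Complex 1 y"] by (auto simp: P_def)
  have S: "(\<lambda>z t. \<Sum>n<N. g n z t) \<in> H" for N by (rule calderon_sum) (rule g)
  note SD = calderonD[OF S]
  have "G \<in> H"
  proof (rule calderonI[OF GZ(1) _ _ _ G0(1) _ _ G1(1)])
    show "nrm Z (G z) \<le> T 0" if "z \<in> strip" for z using GZ(2)[OF that, of 0] by simp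
    show "nrm X0 (G (Complex 0 y)) \<le> T 0" for y using G0(2)[of y 0] by simp
    show "nrm X1 (G (Complex 1 y)) \<le> T 0" for y using G1(2)[of y 0] by simp
    show "continuous_in Z strip G"
      by (rule Z.continuous_in_uniform_limit[OF GZ(1) SD(1) SD(3) GZ(2) T])
    show "continuous_in X0 UNIV (\<lambda>y. G (Complex 0 y))"
      by (rule X0.continuous_in_uniform_limit[OF G0(1) SD(4) SD(6) G0(2) T])
    show "continuous_in X1 UNIV (\<lambda>y. G (Complex 1 y))"
      by (rule X1.continuous_in_uniform_limit[OF G1(1) SD(7) SD(9) G1(2) T])
    fix \<phi> assume \<phi>: "contraction Z \<phi>"
    show "(\<lambda>z. \<phi> (G z)) holomorphic_on interior strip"
    proof (rule holomorphic_uniform_sequence[where f="\<lambda>N z. \<phi> (\<lambda>t. \<Sum>n<N. g n z t)"])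
      show "(\<lambda>z. \<phi> (\<lambda>t. \<Sum>n<N. g n z t)) holomorphic_on interior strip" for N
        by (rule calderon_holomorphic[OF S \<phi>])
      fix z assume "z \<in> interior strip"
      then obtain d where d: "d > 0" "cball z d \<subseteq> interior strip"
        using open_contains_cball[of "interior strip"] by auto
      have "uniform_limit (cball z d) (\<lambda>N z. \<phi> (\<lambda>t. \<Sum>n<N. g n z t)) (\<lambda>z. \<phi> (G z)) sequentially"
      proof (rule uniform_limitI)
        fix e :: real assume "e > 0"
        then have "\<forall>\<^sub>F N in sequentially. T N < e" by (rule order_tendstoD(2)[OF T])
        then show "\<forall>\<^sub>F N in sequentially. \<forall>x\<in>cball z d. dist (\<phi> (\<lambda>t. \<Sum>n<N. g n x t)) (\<phi> (G x)) < e"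
        proof eventually_elim
          case (elim N)
          show ?case
          proof
            fix x assume "x \<in> cball z d"
            then have x: "x \<in> strip" using d interior_subset by blast
            have "dist (\<phi> (\<lambda>t. \<Sum>n<N. g n x t)) (\<phi> (G x)) = cmod (\<phi> (\<lambda>t. G x t - (\<Sum>n<N. g n x t)))"
              using Z.contraction_diff[OF \<phi> GZ(1)[OF x] SD(1)[OF x]] by (simp add: dist_norm norm_minus_commute)
            also have "\<dots> \<le> nrm Z (\<lambda>t. G x t - (\<Sum>n<N. g n x t))"
              using GZ(1)[OF x] SD(1)[OF x] by (intro Z.contraction_le[OF \<phi>]) auto
            also have "\<dots> < e" using GZ(2)[OF x, of N] elim by linarith
            finally show "dist (\<phi> (\<lambda>t. \<Sum>n<N. g n x t)) (\<phi> (G x)) < e" .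
          qed
        qed
      qed
      with d show "\<exists>d>0. cball z d \<subseteq> interior strip \<and>
          uniform_limit (cball z d) (\<lambda>N z. \<phi> (\<lambda>t. \<Sum>n<N. g n z t)) (\<lambda>z. \<phi> (G z)) sequentially" by blast
    qed simp
  qed
  moreover have "hnrm (\<lambda>z t. G z t - (\<Sum>n<N. g n z t)) \<le> T N" for N
    by (rule hnrm_leI) (use G0 G1 in auto)
  ultimately show ?thesis unfolding T_def by blast
qed

end

section \<open>The interpolation space\<close>

locale interpolation = couple M X0 X1 for M :: "'a measure" and X0 X1 +
  fixes \<theta> :: real
  assumes \<theta>: "0 < \<theta>" "\<theta> < 1"
begin

abbreviation "X \<equiv> interp_space X0 X1 \<theta>"
abbreviation "th \<equiv> complex_of_real \<theta>"

lemma th_interior: "th \<in> interior strip" and th_strip [simp]: "th \<in> strip"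
  using \<theta> by (simp add: interior_strip, simp add: strip_def)

lemma interp_carrI: "g \<in> H \<Longrightarrow> g th \<in> carr X"
  unfolding interp_space_def by auto

lemma interp_carrE:
  assumes "x \<in> carr X" obtains g where "g \<in> H" "g th = x"
  using assms unfolding interp_space_def by auto

lemma interp_nrm_le:
  assumes g: "g \<in> H" shows "nrm X (g th) \<le> hnrm g"
  unfolding interp_space_def fspace.simps
proof (rule cInf_lower)
  show "bdd_below {hnrm k |k. k \<in> H \<and> k th = g th}"
    by (rule bdd_belowI[of _ 0]) (auto intro: le_hnrm)
qed (use g in auto)

lemma interp_nrm_ge:
  assumes x: "x \<in> carr X" and le: "\<And>g. g \<in> H \<Longrightarrow> g th = x \<Longrightarrow> c \<le> hnrm g"
  shows "c \<le> nrm X x"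
  unfolding interp_space_def fspace.simps
proof (rule cInf_greatest)
  obtain g where "g \<in> H" "g th = x" using interp_carrE[OF x] .
  then show "{hnrm g |g. g \<in> H \<and> g th = x} \<noteq> {}" by auto
  fix a assume "a \<in> {hnrm g |g. g \<in> H \<and> g th = x}"
  then show "c \<le> a" using le by auto
qed

lemma interp_nrm_less:
  assumes "x \<in> carr X" "nrm X x < c"
  obtains g where "g \<in> H" "g th = x" "hnrm g < c"
  using interp_nrm_ge[OF assms(1), of c] assms(2) that by fastforce

lemma interp_sum_carr: "x \<in> carr X \<Longrightarrow> x \<in> carr Z"
  by (metis interp_carrE calderonD(1) th_strip)

lemma interp_sum_le: "x \<in> carr X \<Longrightarrow> nrm Z x \<le> nrm X x"
  by (rule interp_nrm_ge) (use calderon_maximum_principle[OF _ th_strip] in auto)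

lemma interp_seminormed: "seminormed X"
proof
  have add: "(\<lambda>t. f t + g t) \<in> carr X" if f: "f \<in> carr X" and g: "g \<in> carr X" for f g
  proof -
    obtain F where F: "F \<in> H" "F th = f" using interp_carrE[OF f] .
    obtain G where G: "G \<in> H" "G th = g" using interp_carrE[OF g] .
    show ?thesis using interp_carrI[OF calderon_add(1)[OF F(1) G(1)]] F G by simp
  qed
  have mult: "(\<lambda>t. c * f t) \<in> carr X" if f: "f \<in> carr X" for f c
  proof -
    obtain F where F: "F \<in> H" "F th = f" using interp_carrE[OF f] .
    show ?thesis using interp_carrI[OF calderon_const(1)[OF F(1), of c]] F by simp
  qed
  have zero: "(\<lambda>_. 0) \<in> carr X" using interp_carrI[OF calderon_zero] .
  show "linear_subspace (carr X)"
    unfolding linear_subspace_def using add mult zero by auto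
  show nonneg: "0 \<le> nrm X f" if "f \<in> carr X" for f
    using that by (rule interp_nrm_ge) (rule le_hnrm)
  have mult_le: "nrm X (\<lambda>t. c * f t) \<le> cmod c * nrm X f" if f: "f \<in> carr X" and c: "c \<noteq> 0" for f c
  proof -
    have "nrm X (\<lambda>t. c * f t) / cmod c \<le> nrm X f"
    proof (rule interp_nrm_ge[OF f])
      fix g assume g: "g \<in> H" "g th = f"
      have "nrm X (\<lambda>t. c * f t) \<le> cmod c * hnrm g"
        using interp_nrm_le[OF calderon_const(1)[OF g(1), of c]] calderon_const(2)[OF g(1), of c] g(2) by simp
      then show "nrm X (\<lambda>t. c * f t) / cmod c \<le> hnrm g"
        using c by (simp add: field_simps)
    qed
    then show ?thesis using c by (simp add: field_simps)
  qed
  show "nrm X (\<lambda>t. c * f t) = cmod c * nrm X f" if f: "f \<in> carr X" for f c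
  proof (cases "c = 0")
    case True
    have "hnrm (\<lambda>z t. 0) \<le> 0" by (rule hnrm_leI) auto
    then have "nrm X (\<lambda>_. 0) = 0"
      using interp_nrm_le[OF calderon_zero] nonneg[OF zero] by simp
    then show ?thesis using True by simp
  next
    case False
    have "nrm X f \<le> cmod (1/c) * nrm X (\<lambda>t. c * f t)"
      using mult_le[OF mult[OF f, of c], of "1/c"] False by simp
    then have "cmod c * nrm X f \<le> nrm X (\<lambda>t. c * f t)"
      using False by (simp add: norm_divide field_simps)
    then show ?thesis using mult_le[OF f False] by simp
  qed
  show "nrm X (\<lambda>t. f t + g t) \<le> nrm X f + nrm X g" if f: "f \<in> carr X" and g: "g \<in> carr X" for f g
  proof -
    have "nrm X (\<lambda>t. f t + g t) - nrm X g \<le> nrm X f"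
    proof (rule interp_nrm_ge[OF f])
      fix F assume F: "F \<in> H" "F th = f"
      have "nrm X (\<lambda>t. f t + g t) - hnrm F \<le> nrm X g"
      proof (rule interp_nrm_ge[OF g])
        fix G assume G: "G \<in> H" "G th = g"
        show "nrm X (\<lambda>t. f t + g t) - hnrm F \<le> hnrm G"
          using interp_nrm_le[OF calderon_add(1)[OF F(1) G(1)]] calderon_add(2)[OF F(1) G(1)] F(2) G(2)
          by simp
      qed
      then show "nrm X (\<lambda>t. f t + g t) - nrm X g \<le> hnrm F" by simp
    qed
    then show ?thesis by simp
  qed
qed

text \<open>The properties are lifted to \<open>H\<close>: the ideal property by multiplying a
  representing function by a bounded measurable function, completeness by summing nearly optimal
  representing functions.\<close>

theorem interp_koethe: "koethe_space M X"
proof (rule koethe_spaceI)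
  interpret X: seminormed X by (rule interp_seminormed)
  show "seminormed X" by (rule interp_seminormed)
  show "sigma_finite_measure M" by (rule X0.sigma_finite)
  show "carr X \<subseteq> borel_measurable M"
    using interp_sum_carr Z.measurable_carr by blast
  show "AE t in M. f t = 0" if f: "f \<in> carr X" "nrm X f = 0" for f
    using Z.ae_eqI[of f "\<lambda>_. 0"] interp_sum_carr[OF f(1)] interp_sum_le[OF f(1)] f(2) by simp
  show "f \<in> carr X \<and> nrm X f \<le> nrm X x"
    if f: "f \<in> borel_measurable M" and x: "x \<in> carr X" and le: "AE t in M. cmod (f t) \<le> cmod (x t)" for f x
  proof -
    have *: "f \<in> carr X \<and> nrm X f \<le> hnrm g" if g: "g \<in> H" "g th = x" for g
    proof -
      define h where "h t = f t / x t" for t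
      have xm: "x \<in> borel_measurable M" using Z.measurable_carr interp_sum_carr x by blast
      have hm: "h \<in> borel_measurable M" unfolding h_def using f xm by (intro borel_measurable_divide)
      have h1: "AE t in M. cmod (h t) \<le> 1"
        using le by eventually_elim (auto simp: h_def norm_divide divide_le_eq_1)
      \<comment> \<open>At \<open>th\<close> the value is set to \<open>f\<close> itself, because
        \<open>h * x\<close> equals \<open>f\<close> only almost everywhere.\<close>
      define g' where "g' z = (if z = th then f else (\<lambda>t. h t * g z t))" for z
      have m: "g' z \<in> borel_measurable M" if "z \<in> strip" for z
        using hm f Z.measurable_carr[OF calderonD(1)[OF g(1) that]]
        by (auto simp: g'_def intro: borel_measurable_times)
      have e: "AE t in M. g' z t = h t * g z t" for z
        using le by eventually_elim (auto simp: g'_def h_def g(2))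
      note g' = calderon_dominated[OF g(1) hm h1 m e]
      have "g' th = f" by (simp add: g'_def)
      then show ?thesis using interp_carrI[OF g'(1)] interp_nrm_le[OF g'(1)] g'(2) by simp
    qed
    obtain g where "g \<in> H" "g th = x" using interp_carrE[OF x] .
    then have "f \<in> carr X" using * by blast
    moreover have "nrm X f \<le> nrm X x" using * by (intro interp_nrm_ge[OF x]) blast
    ultimately show ?thesis by blast
  qed
  show X.complete_space
  proof (rule X.complete_spaceI)
    fix f :: "nat \<Rightarrow> 'a \<Rightarrow> complex"
    assume f: "\<And>n. f n \<in> carr X" "\<And>n. nrm X (f n) \<le> (1/2)^n"
    have "\<exists>g. g \<in> H \<and> g th = f n \<and> hnrm g \<le> 2 * (1/2)^n" for n
    proof -
      have "nrm X (f n) < 2 * (1/2)^n" using f(2)[of n] by (rule le_less_trans) simp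
      then obtain g where "g \<in> H" "g th = f n" "hnrm g < 2 * (1/2)^n"
        using interp_nrm_less[OF f(1)] by blast
      then show ?thesis by (intro exI[of _ g]) simp
    qed
    then obtain g where g: "\<And>n. g n \<in> H" "\<And>n. g n th = f n" "\<And>n. hnrm (g n) \<le> 2 * (1/2)^n" by metis
    have sm: "summable (\<lambda>n. 2 * (1/2::real)^n)" by (intro summable_mult) (simp add: summable_geometric)
    let ?T = "\<lambda>N. \<Sum>n. 2 * (1/2::real)^(n + N)"
    obtain G where G: "G \<in> H" "\<And>N. hnrm (\<lambda>z t. G z t - (\<Sum>n<N. g n z t)) \<le> ?T N"
      using calderon_series[OF g(1,3) sm] by blast
    have x: "G th \<in> carr X" by (rule interp_carrI[OF G(1)])
    have le: "nrm X (\<lambda>t. G th t - (\<Sum>n<N. f n t)) \<le> ?T N" for N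
    proof -
      have "(\<lambda>z t. G z t - (\<Sum>n<N. g n z t)) \<in> H"
        by (intro calderon_diff(1) calderon_sum G g)
      from interp_nrm_le[OF this] G(2)[of N] show ?thesis using g(2) by simp
    qed
    have "(\<lambda>N. nrm X (\<lambda>t. G th t - (\<Sum>n<N. f n t))) \<longlonglongrightarrow> 0"
      by (rule Lim_null_comparison[OF _ suminf_tail_tendsto_zero[OF sm]]) (use le x f in simp)
    then show "\<exists>g\<in>carr X. (\<lambda>N. nrm X (\<lambda>t. g t - (\<Sum>n<N. f n t))) \<longlonglongrightarrow> 0"
      using x by (intro bexI[of _ "G th"])
  qed
qed

end

sublocale interpolation \<subseteq> X: koethe M "interp_space X0 X1 \<theta>"
  by unfold_locales (rule interp_koethe)

context interpolation
begin

text \<open>If \<open>G\<close> vanishes at \<open>\<theta>\<close>, then \<open>G z / (z - \<theta>)\<close> extends to a member of the Calderon space whose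
  value at \<open>\<theta>\<close> is the derivative of \<open>G\<close>.\<close>

theorem derivative_in_interp:
  assumes G: "G \<in> H" and G0: "AE t in M. G th t = 0" and d: "complex_deriv_in Z G d th"
  shows "d \<in> carr X" "nrm X d \<le> hnrm G / min \<theta> (1 - \<theta>)"
proof -
  \<comment> \<open>The distance from \<open>\<theta>\<close> to the boundary, so that
    \<open>1 / (z - \<theta>)\<close> is at most \<open>1 / m\<close> on both lines.\<close>
  define m where "m = min \<theta> (1 - \<theta>)"
  have m: "m > 0" using \<theta> by (simp add: m_def)
  note D = calderonD[OF G]
  have dZ: "d \<in> carr Z" and lim: "((\<lambda>w. nrm Z (\<lambda>t. (G w t - G th t) / (w - th) - d t)) \<longlongrightarrow> 0) (at th)"
    using d by (auto simp: complex_deriv_in_def)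
  define c where "c z = 1 / (z - th)" for z
  define K where "K z = (if z = th then d else (\<lambda>t. c z * G z t))" for z
  have KZ: "K z \<in> carr Z" if "z \<in> strip" for z
    using D(1)[OF that] dZ by (simp add: K_def)
  have at_th: "((\<lambda>w. nrm Z (\<lambda>t. K w t - K th t)) \<longlongrightarrow> 0) (at th)"
  proof (rule Lim_null_comparison[OF _ lim])
    have "\<forall>\<^sub>F w in at th. w \<noteq> th \<and> G w \<in> carr Z"
      using eventually_carr[OF D(1) th_interior] by (auto simp: eventually_at_filter elim: eventually_mono)
    then show "\<forall>\<^sub>F w in at th. norm (nrm Z (\<lambda>t. K w t - K th t))
        \<le> nrm Z (\<lambda>t. (G w t - G th t) / (w - th) - d t)"
    proof eventually_elim
      case (elim w)
      have 1: "(\<lambda>t. K w t - K th t) \<in> carr Z" using elim dZ by (simp add: K_def)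
      have 2: "(\<lambda>t. (G w t - G th t) / (w - th) - d t) \<in> carr Z" using elim dZ D(1)[OF th_strip] by simp
      \<comment> \<open>\<open>G th\<close> vanishes only almost everywhere, so
        \<open>c w * G w\<close> and the difference quotient also agree only almost
        everywhere.\<close>
      have "AE t in M. cmod (K w t - K th t) \<le> cmod ((G w t - G th t) / (w - th) - d t)"
        using G0 by eventually_elim (use elim in \<open>simp add: K_def c_def\<close>)
      from Z.ideal(2)[OF Z.measurable_carr[OF 1] 2 this] show ?case using 1 by simp
    qed
  qed
  \<comment> \<open>Boundedness of \<open>K\<close> in \<open>Z\<close> has two sources: continuity
    on a disc of radius \<open>\<delta>\<close> around \<open>th\<close>, and the bound
    \<open>1 / \<delta>\<close> for \<open>c\<close> outside it.\<close>
  obtain \<delta> where \<delta>: "\<delta> > 0" "\<And>w. 0 < dist w th \<Longrightarrow> dist w th < \<delta> \<Longrightarrow> nrm Z (\<lambda>t. K w t - K th t) < 1"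
  proof -
    have "\<forall>\<^sub>F w in at th. nrm Z (\<lambda>t. K w t - K th t) < 1"
      by (rule order_tendstoD(2)[OF at_th]) simp
    with that show ?thesis unfolding eventually_at by (metis zero_less_dist_iff UNIV_I)
  qed
  have c_cont: "continuous_on (strip - {th}) c"
    unfolding c_def by (intro continuous_intros) auto
  have away: "continuous_in Z (strip - {th}) (\<lambda>z t. c z * G z t)"
    using D(1) by (intro Z.continuous_in_scalar c_cont continuous_in_subset[OF D(3)]) auto
  have K_cont: "continuous_in Z strip K"
    unfolding continuous_in_def
  proof
    fix z assume z: "z \<in> strip"
    show "((\<lambda>w. nrm Z (\<lambda>t. K w t - K z t)) \<longlongrightarrow> 0) (at z within strip)"
    proof (cases "z = th")
      case True
      then show ?thesis using tendsto_within_subset[OF at_th, of strip] by simp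
    next
      case False
      have "((\<lambda>w. nrm Z (\<lambda>t. c w * G w t - c z * G z t)) \<longlongrightarrow> 0) (at z within strip - {th})"
        using away False z by (auto simp: continuous_in_def)
      moreover have ev: "\<forall>\<^sub>F w in at z. w \<noteq> th"
        using eventually_at_in_open'[of "- {th}" z] False by (simp add: open_Compl)
      then have "\<forall>\<^sub>F w in at z. (w \<in> strip - {th}) = (w \<in> strip)"
        by eventually_elim auto
      ultimately have *: "((\<lambda>w. nrm Z (\<lambda>t. c w * G w t - c z * G z t)) \<longlongrightarrow> 0) (at z within strip)"
        using Lim_transform_within_set_eq by blast
      have "\<forall>\<^sub>F w in at z within strip. nrm Z (\<lambda>t. c w * G w t - c z * G z t) = nrm Z (\<lambda>t. K w t - K z t)"
        using filter_leD[OF at_le[OF subset_UNIV] ev] by (rule eventually_mono) (use False in \<open>simp add: K_def\<close>)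
      from Lim_transform_eventually[OF * this] show ?thesis .
    qed
  qed
  have cm0: "cmod (c (Complex 0 y)) \<le> 1 / m" and cm1: "cmod (c (Complex 1 y)) \<le> 1 / m" for y
  proof -
    have "\<theta> \<le> cmod (Complex 0 y - th)" "1 - \<theta> \<le> cmod (Complex 1 y - th)"
      using abs_Re_le_cmod[of "Complex 0 y - th"] abs_Re_le_cmod[of "Complex 1 y - th"] \<theta> by auto
    then have "m \<le> cmod (Complex 0 y - th)" "m \<le> cmod (Complex 1 y - th)" by (auto simp: m_def)
    then show "cmod (c (Complex 0 y)) \<le> 1 / m" "cmod (c (Complex 1 y)) \<le> 1 / m"
      unfolding c_def norm_divide using m by (simp_all add: frac_le)
  qed
  have K0: "K (Complex 0 y) = (\<lambda>t. c (Complex 0 y) * G (Complex 0 y) t)"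
    and K1: "K (Complex 1 y) = (\<lambda>t. c (Complex 1 y) * G (Complex 1 y) t)" for y
    using \<theta> by (auto simp: K_def complex_eq_iff)
  have n0: "nrm X0 (K (Complex 0 y)) \<le> hnrm G / m" for y
    unfolding K0 X0.nrm_cmult[OF D(4)]
    using mult_mono[OF cm0[of y] le_hnrm(1)[OF G, of y]] D(4) m by simp
  have n1: "nrm X1 (K (Complex 1 y)) \<le> hnrm G / m" for y
    unfolding K1 X1.nrm_cmult[OF D(7)]
    using mult_mono[OF cm1[of y] le_hnrm(2)[OF G, of y]] D(7) m by simp
  have cc: "continuous_on UNIV (\<lambda>y. c (Complex 0 y))" "continuous_on UNIV (\<lambda>y. c (Complex 1 y))"
  proof -
    have *: "continuous_on UNIV (Complex a)" for a
      unfolding Complex_eq by (intro continuous_intros)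
    show "continuous_on UNIV (\<lambda>y. c (Complex 0 y))" "continuous_on UNIV (\<lambda>y. c (Complex 1 y))"
      by (rule continuous_on_compose2[OF c_cont *]; use \<theta> in \<open>auto simp: complex_eq_iff\<close>)+
  qed
  have KH: "K \<in> H"
  proof (rule calderonI[OF KZ _ K_cont _ _ n0 _ _ n1])
    fix z assume z: "z \<in> strip"
    show "nrm Z (K z) \<le> max (nrm Z d + 1) (1 / \<delta> * hnrm G)"
    proof (cases "dist z th < \<delta>")
      case True
      have "nrm Z (\<lambda>t. K z t - K th t) \<le> 1"
        using \<delta>(2)[of z] True by (cases "z = th") auto
      then show ?thesis
        using Z.nrm_le_add_diff[OF KZ[OF z] KZ[OF th_strip]] by (simp add: K_def)
    next
      case False
      then have zth: "z \<noteq> th" using \<delta> by auto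
      have "cmod (c z) \<le> 1 / \<delta>"
        using False \<delta>(1) by (simp add: c_def norm_divide dist_norm frac_le)
      then have "cmod (c z) * nrm Z (G z) \<le> 1 / \<delta> * hnrm G"
        using calderon_maximum_principle[OF G z] D(1)[OF z] \<delta>(1) by (intro mult_mono) auto
      then show ?thesis using zth by (simp add: K_def Z.nrm_cmult[OF D(1)[OF z]])
    qed
  next
    fix \<phi> assume \<phi>: "contraction Z \<phi>"
    show "(\<lambda>z. \<phi> (K z)) holomorphic_on interior strip"
    \<comment> \<open>Riemann's removable singularity theorem; the continuity of \<open>K\<close> at
      \<open>th\<close>, obtained from the derivative of \<open>G\<close>, makes it
      applicable.\<close>
    proof (rule no_isolated_singularity'[of "{th}"])
      have "continuous_on strip (\<lambda>z. \<phi> (K z))"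
        by (rule Z.contraction_continuous_on[OF \<phi> K_cont KZ])
      then have "continuous_on (interior strip) (\<lambda>z. \<phi> (K z))"
        using interior_subset by (rule continuous_on_subset)
      then show "((\<lambda>z. \<phi> (K z)) \<longlongrightarrow> \<phi> (K z)) (at z within interior strip)" if "z \<in> {th}" for z
        using that th_interior by (auto simp: continuous_on_def)
      have "(\<lambda>z. c z * \<phi> (G z)) holomorphic_on (interior strip - {th})"
        unfolding c_def
        by (intro holomorphic_intros holomorphic_on_subset[OF calderon_holomorphic[OF G \<phi>]]) auto
      moreover have "c z * \<phi> (G z) = \<phi> (K z)" if "z \<in> interior strip - {th}" for z
      proof -
        have "z \<in> strip" using that interior_subset by blast
        then show ?thesis using that Z.contraction_cmult[OF \<phi> D(1)] by (simp add: K_def)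
      qed
      ultimately show "(\<lambda>z. \<phi> (K z)) holomorphic_on (interior strip - {th})"
        by (rule holomorphic_transform)
    qed auto
  next
    show "continuous_in X0 UNIV (\<lambda>y. K (Complex 0 y))"
      unfolding K0 by (rule X0.continuous_in_scalar[OF D(6) D(4) cc(1)])
    show "continuous_in X1 UNIV (\<lambda>y. K (Complex 1 y))"
      unfolding K1 by (rule X1.continuous_in_scalar[OF D(9) D(7) cc(2)])
  qed (use K0 K1 D in auto)
  have "K th = d" by (simp add: K_def)
  then show "d \<in> carr X" using interp_carrI[OF KH] by simp
  have "hnrm K \<le> hnrm G / m" by (rule hnrm_leI[OF n0 n1])
  then show "nrm X d \<le> hnrm G / min \<theta> (1 - \<theta>)"
    using interp_nrm_le[OF KH] \<open>K th = d\<close> by (simp add: m_def)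
qed

end


section \<open>Unconditional bases\<close>

text \<open>Passing to a tail does not increase the norm, so pointwise smallness of tails at
  finitely many points spreads over small balls around them, and compactness makes it
  uniform.\<close>

lemma uniform_tail_on_compact:
  fixes g :: "real \<Rightarrow> nat \<Rightarrow> complex"
  assumes X: "unconditional_basis_space M X" and C: "compact C" and e: "e > 0"
    and g: "\<And>s. s \<in> C \<Longrightarrow> g s \<in> carr X" and cont: "continuous_in X C g"
  shows "\<exists>N0. \<forall>N\<ge>N0. \<forall>s\<in>C. nrm X (\<lambda>i. if i < N then 0 else g s i) < e"
proof -
  have M: "M = count_space UNIV" and "koethe_space M X"
    and tail: "\<And>x. x \<in> carr X \<Longrightarrow> (\<lambda>N. nrm X (\<lambda>i. x i - (if i < N then x i else 0))) \<longlonglongrightarrow> 0"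
    using X by (auto simp: unconditional_basis_space_def)
  interpret koethe M X by unfold_locales fact
  have R: "(\<lambda>i. if i < N then 0 else x i) \<in> carr X" "nrm X (\<lambda>i. if i < N then 0 else x i) \<le> nrm X x"
    if x: "x \<in> carr X" for x N
    using ideal[OF _ x, of "\<lambda>i. if i < N then 0 else x i"] by (auto simp: M)
  have "\<exists>N. \<forall>n\<ge>N. nrm X (\<lambda>i. if i < n then 0 else g s i) < e/2" if s: "s \<in> C" for s
  proof -
    have "(\<lambda>i. g s i - (if i < n then g s i else 0)) = (\<lambda>i. if i < n then 0 else g s i)" for n by auto
    then have "(\<lambda>n. nrm X (\<lambda>i. if i < n then 0 else g s i)) \<longlonglongrightarrow> 0" using tail[OF g[OF s]] by simp
    then have "\<forall>\<^sub>F n in sequentially. nrm X (\<lambda>i. if i < n then 0 else g s i) < e/2"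
      using e by (intro order_tendstoD(2)) auto
    then show ?thesis by (simp add: eventually_sequentially)
  qed
  then obtain N where N: "\<And>s n. s \<in> C \<Longrightarrow> n \<ge> N s \<Longrightarrow> nrm X (\<lambda>i. if i < n then 0 else g s i) < e/2"
    by metis
  have "\<exists>d>0. \<forall>r\<in>C. dist r s < d \<longrightarrow> nrm X (\<lambda>i. g r i - g s i) < e/2" if s: "s \<in> C" for s
  proof -
    have "((\<lambda>r. nrm X (\<lambda>i. g r i - g s i)) \<longlongrightarrow> 0) (at s within C)"
      using cont s by (auto simp: continuous_in_def)
    then have "\<forall>\<^sub>F r in at s within C. nrm X (\<lambda>i. g r i - g s i) < e/2"
      using e by (intro order_tendstoD(2)) auto
    then obtain d where d: "d > 0" "\<And>r. r \<in> C \<Longrightarrow> r \<noteq> s \<Longrightarrow> dist r s < d \<Longrightarrow> nrm X (\<lambda>i. g r i - g s i) < e/2"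
      unfolding eventually_at by blast
    have "nrm X (\<lambda>i. g r i - g s i) < e/2" if "r \<in> C" "dist r s < d" for r
      using d(2)[of r] that e by (cases "r = s") auto
    then show ?thesis using d(1) by blast
  qed
  then obtain d where d: "\<And>s. s \<in> C \<Longrightarrow> d s > 0"
    "\<And>s r. s \<in> C \<Longrightarrow> r \<in> C \<Longrightarrow> dist r s < d s \<Longrightarrow> nrm X (\<lambda>i. g r i - g s i) < e/2" by metis
  have "C \<subseteq> (\<Union>s\<in>C. ball s (d s))" using d(1) by force
  then obtain F where F: "F \<subseteq> C" "finite F" "C \<subseteq> (\<Union>s\<in>F. ball s (d s))"
    using compactE_image[OF C, of C "\<lambda>s. ball s (d s)"] by auto
  define N0 where "N0 = (\<Sum>s\<in>F. N s)"
  have "nrm X (\<lambda>i. if i < n then 0 else g r i) < e" if n: "n \<ge> N0" and r: "r \<in> C" for n r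
  proof -
    obtain s where s: "s \<in> F" "dist r s < d s" using F(3) r by (auto simp: dist_commute)
    then have sC: "s \<in> C" using F by auto
    have "N s \<le> N0" unfolding N0_def using F s by (intro member_le_sum) auto
    then have 1: "nrm X (\<lambda>i. if i < n then 0 else g s i) < e/2" using N[OF sC, of n] n by simp
    have dc: "(\<lambda>i. g r i - g s i) \<in> carr X" using g[OF r] g[OF sC] by simp
    have "nrm X (\<lambda>i. if i < n then 0 else g r i - g s i) < e/2"
      using R(2)[OF dc, of n] d(2)[OF sC r s(2)] by linarith
    moreover have "(\<lambda>i. if i < n then 0 else g r i)
        = (\<lambda>i. (if i < n then 0 else g s i) + (if i < n then 0 else g r i - g s i))" by auto
    ultimately show ?thesis
      using 1 nrm_add[OF R(1)[OF g[OF sC], of n] R(1)[OF dc, of n]] by simp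
  qed
  then show ?thesis by blast
qed

text \<open>The factor \<open>exp ((z - \<theta>)\<^sup>2)\<close> equals 1 at \<open>\<theta>\<close> and decays along the boundary lines, so only compact
  parts of these lines matter.\<close>

theorem interp_unconditional_basis:
  fixes X0 X1 :: "nat fspace"
  assumes X0: "unconditional_basis_space (count_space UNIV) X0"
    and X1: "unconditional_basis_space (count_space UNIV) X1"
    and \<theta>: "0 < \<theta>" "\<theta> < 1"
  shows "unconditional_basis_space (count_space UNIV) (interp_space X0 X1 \<theta>)"
proof -
  interpret interpolation "count_space UNIV" X0 X1 \<theta>
    using X0 X1 \<theta> by unfold_locales (auto simp: unconditional_basis_space_def)
  have "(\<lambda>i. if i = k then 1 else 0) \<in> carr X" for k
  proof -
    let ?d = "\<lambda>i::nat. if i = k then 1 else (0::complex)"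
    have d: "?d \<in> carr X0" "?d \<in> carr X1" "?d \<in> carr Z"
      using X0 X1 left_carr by (auto simp: unconditional_basis_space_def)
    have "(\<lambda>z. ?d) \<in> H"
      by (rule calderonI[of "\<lambda>z. ?d" "nrm Z ?d" "nrm X0 ?d" "nrm X1 ?d"])
        (use d in \<open>auto simp: continuous_in_def\<close>)
    from interp_carrI[OF this] show ?thesis by simp
  qed
  moreover have "(\<lambda>N. nrm X (\<lambda>i. x i - (if i < N then x i else 0))) \<longlonglongrightarrow> 0" if x: "x \<in> carr X" for x
  proof -
    obtain g where g: "g \<in> H" "g th = x" using interp_carrE[OF x] .
    define c where "c z = exp ((z - th)\<^sup>2)" for z
    have cm: "cmod (c z) \<le> exp 1 * exp (- (Im z)\<^sup>2)" if "z \<in> strip" for z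
    proof -
      have "\<bar>Re z - \<theta>\<bar> \<le> 1" using that \<theta> by (auto simp: strip_def)
      then have "(Re z - \<theta>)\<^sup>2 \<le> 1" by (simp add: abs_square_le_1)
      then show ?thesis by (simp add: c_def power2_eq_square exp_add[symmetric])
    qed
    have c1: "cmod (c z) \<le> exp 1" if "z \<in> strip" for z
      using cm[OF that] by (rule order_trans) simp
    define G where "G z i = c z * g z i" for z i
    have G: "G \<in> H" unfolding G_def
      by (rule calderon_scalar(1)[OF g(1) _ _ c1]) (auto simp: c_def intro!: continuous_intros holomorphic_intros)
    note D = calderonD[OF G]
    have Gth: "G th = x" by (simp add: G_def c_def g(2) fun_eq_iff)
    show ?thesis
    proof (rule LIMSEQ_I)
      fix e :: real assume e: "e > 0"
      have "((\<lambda>R. exp 1 * exp (- R\<^sup>2) * hnrm g) \<longlongrightarrow> exp 1 * 0 * hnrm g) at_top"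
        by (intro tendsto_intros filterlim_compose[OF exp_at_bot]
            filterlim_compose[OF filterlim_uminus_at_bot_at_top] filterlim_pow_at_top filterlim_ident) auto
      then have "\<forall>\<^sub>F R in at_top. exp 1 * exp (- R\<^sup>2) * hnrm g < e/2"
        using e by (intro order_tendstoD(2)) auto
      then obtain R where R: "R \<ge> 0" "exp 1 * exp (- R\<^sup>2) * hnrm g < e/2"
        unfolding eventually_at_top_linorder by (metis max.cobounded1 max.cobounded2)
      have far: "cmod (c z) * hnrm g < e/2" if "z \<in> strip" "\<bar>Im z\<bar> > R" for z
      proof -
        have "R\<^sup>2 \<le> (Im z)\<^sup>2" using that(2) R(1) by (simp add: abs_le_square_iff[symmetric])
        then have "exp 1 * exp (- (Im z)\<^sup>2) * hnrm g \<le> exp 1 * exp (- R\<^sup>2) * hnrm g"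
          using le_hnrm(3)[OF g(1)] by (intro mult_right_mono) auto
        moreover have "cmod (c z) * hnrm g \<le> exp 1 * exp (- (Im z)\<^sup>2) * hnrm g"
          using cm[OF that(1)] le_hnrm(3)[OF g(1)] by (rule mult_right_mono)
        ultimately show ?thesis using R(2) by linarith
      qed
      have e2: "e/2 > 0" using e by simp
      obtain N0 where N0: "\<And>N s. N \<ge> N0 \<Longrightarrow> s \<in> {-R..R} \<Longrightarrow> nrm X0 (\<lambda>i. if i < N then 0 else G (Complex 0 s) i) < e/2"
        using uniform_tail_on_compact[OF X0 compact_Icc e2 D(4) continuous_in_subset[OF D(6) subset_UNIV], of "-R" R]
        by blast
      obtain N1 where N1: "\<And>N s. N \<ge> N1 \<Longrightarrow> s \<in> {-R..R} \<Longrightarrow> nrm X1 (\<lambda>i. if i < N then 0 else G (Complex 1 s) i) < e/2"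
        using uniform_tail_on_compact[OF X1 compact_Icc e2 D(7) continuous_in_subset[OF D(9) subset_UNIV], of "-R" R]
        by blast
      have "norm (nrm X (\<lambda>i. x i - (if i < N then x i else 0)) - 0) < e" if N: "N \<ge> max N0 N1" for N
      proof -
        \<comment> \<open>Cutting off the first \<open>N\<close> coordinates stays in
          \<open>H\<close>, and the value at \<open>th\<close> is the tail of \<open>x\<close>. Its
          norm is therefore controlled by boundary tails.\<close>
        define K where "K z i = (if i < N then 0 else G z i)" for z and i :: nat
        have K_eq: "K z = (\<lambda>i. if i < N then 0 else G z i)" for z by (auto simp: K_def)
        have K: "K \<in> H"
          by (rule calderon_dominated(1)[OF G, of "\<lambda>i. if i < N then 0 else 1"]) (auto simp: K_def)
        have "nrm X0 (K (Complex 0 s)) \<le> e/2" for s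
        proof (cases "\<bar>s\<bar> \<le> R")
          case True
          then have "s \<in> {-R..R}" by auto
          then show ?thesis using N0[of N s] N by (simp add: K_eq)
        next
          case False
          have "nrm X0 (K (Complex 0 s)) \<le> nrm X0 (G (Complex 0 s))"
            by (rule X0.ideal(2)[OF _ D(4)]) (auto simp: K_def)
          also have "\<dots> = cmod (c (Complex 0 s)) * nrm X0 (g (Complex 0 s))"
            unfolding G_def by (rule X0.nrm_cmult[OF calderonD(4)[OF g(1)]])
          also have "\<dots> \<le> cmod (c (Complex 0 s)) * hnrm g"
            using le_hnrm(1)[OF g(1)] by (intro mult_left_mono) auto
          also have "\<dots> \<le> e/2" using far[of "Complex 0 s"] False by simp
          finally show ?thesis .
        qed
        moreover have "nrm X1 (K (Complex 1 s)) \<le> e/2" for s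
        proof (cases "\<bar>s\<bar> \<le> R")
          case True
          then have "s \<in> {-R..R}" by auto
          then show ?thesis using N1[of N s] N by (simp add: K_eq)
        next
          case False
          have "nrm X1 (K (Complex 1 s)) \<le> nrm X1 (G (Complex 1 s))"
            by (rule X1.ideal(2)[OF _ D(7)]) (auto simp: K_def)
          also have "\<dots> = cmod (c (Complex 1 s)) * nrm X1 (g (Complex 1 s))"
            unfolding G_def by (rule X1.nrm_cmult[OF calderonD(7)[OF g(1)]])
          also have "\<dots> \<le> cmod (c (Complex 1 s)) * hnrm g"
            using le_hnrm(2)[OF g(1)] by (intro mult_left_mono) auto
          also have "\<dots> \<le> e/2" using far[of "Complex 1 s"] False by simp
          finally show ?thesis .
        qed
        ultimately have "hnrm K \<le> e/2" by (rule hnrm_leI)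
        moreover have "K th = (\<lambda>i. x i - (if i < N then x i else 0))"
          by (auto simp: K_def Gth)
        ultimately have "nrm X (\<lambda>i. x i - (if i < N then x i else 0)) \<le> e/2"
          "(\<lambda>i. x i - (if i < N then x i else 0)) \<in> carr X"
          using interp_nrm_le[OF K] interp_carrI[OF K] by auto
        then show ?thesis using e by simp
      qed
      then show "\<exists>no. \<forall>N\<ge>no. norm (nrm X (\<lambda>i. x i - (if i < N then x i else 0)) - 0) < e" by blast
    qed
  qed
  ultimately show ?thesis
    unfolding unconditional_basis_space_def using interp_koethe by blast
qed

section \<open>Spans of disjoint sequences\<close>

locale disjoint_span = koethe M X for M :: "'a measure" and X +
  fixes u :: "nat \<Rightarrow> 'a \<Rightarrow> complex"
  assumes disjoint: "disjoint_seq M X u"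
begin

abbreviation "W \<equiv> span_space X u"

definition e :: "nat \<Rightarrow> 'a \<Rightarrow> complex" where "e k t = u k t / complex_of_real (nrm X (u k))"

text \<open>The value of \<open>block\<close> is arbitrary where all \<open>u j\<close> vanish.\<close>

definition block :: "'a \<Rightarrow> nat" where "block t = (LEAST j. u j t \<noteq> 0)"

lemma u_carr [simp]: "u k \<in> carr X"
  using disjoint by (simp add: disjoint_seq_def)

lemma e_carr [simp]: "e k \<in> carr X"
  unfolding e_def by simp

lemma nrm_u_pos: "nrm X (u k) > 0"
proof -
  have "\<not> (AE t in M. u k t = 0)" using disjoint by (auto simp: disjoint_seq_def ae_eq_def)
  then have "nrm X (u k) \<noteq> 0" using nrm_eq_0_iff[of "u k"] by simp
  with nrm_nonneg[OF u_carr[of k]] show ?thesis by linarith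
qed

lemma nrm_e [simp]: "nrm X (e k) = 1"
  unfolding e_def using nrm_u_pos[of k] by (simp add: nrm_divide)

lemma e_eq_0_iff: "e k t = 0 \<longleftrightarrow> u k t = 0"
  using nrm_u_pos[of k] by (simp add: e_def)

lemma AE_disjoint: "AE t in M. \<forall>j k. j \<noteq> k \<longrightarrow> u j t = 0 \<or> u k t = 0"
proof -
  have "AE t in M. j \<noteq> k \<longrightarrow> u j t = 0 \<or> u k t = 0" for j k
    using disjoint by (cases "j = k") (auto simp: disjoint_seq_def)
  then show ?thesis by (simp add: AE_all_countable)
qed

lemma AE_block: "AE t in M. \<forall>k. u k t \<noteq> 0 \<longrightarrow> block t = k"
  using AE_disjoint
proof eventually_elim
  case (elim t)
  show ?case
  proof (intro allI impI)
    fix k assume k: "u k t \<noteq> 0"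
    have "u (block t) t \<noteq> 0" unfolding block_def by (rule LeastI[of _ k]) (rule k)
    then show "block t = k" using elim k by blast
  qed
qed

lemma block_measurable: "block \<in> measurable M (count_space UNIV)"
proof -
  have [measurable]: "u k \<in> borel_measurable M" for k by (rule measurable_carr) simp
  show ?thesis unfolding block_def by measurable
qed

text \<open>Functions constant on the supports of the \<open>u k\<close> act as diagonal operators
  on the coefficients. In this way the ideal property of \<open>X\<close> yields 1-unconditionality
  of the sequence.\<close>

lemma block_multiplier:
  assumes "\<And>k. cmod (c k) \<le> 1"
  shows "(\<lambda>t. c (block t)) \<in> borel_measurable M" "AE t in M. cmod (c (block t)) \<le> 1"
    "x \<in> carr X \<Longrightarrow> (\<lambda>t. c (block t) * x t) \<in> carr X"
    "x \<in> carr X \<Longrightarrow> nrm X (\<lambda>t. c (block t) * x t) \<le> nrm X x"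
proof -
  show m: "(\<lambda>t. c (block t)) \<in> borel_measurable M"
    by (rule measurable_compose[OF block_measurable]) simp
  show b: "AE t in M. cmod (c (block t)) \<le> 1" using assms by simp
  show "x \<in> carr X \<Longrightarrow> (\<lambda>t. c (block t) * x t) \<in> carr X"
    "x \<in> carr X \<Longrightarrow> nrm X (\<lambda>t. c (block t) * x t) \<le> nrm X x"
    using mult_bounded[OF m b] by auto
qed

lemma AE_multiplier_sum:
  "AE t in M. \<forall>a N. c (block t) * (\<Sum>k<N. a k * e k t) = (\<Sum>k<N. c k * a k * e k t)"
  using AE_block
proof eventually_elim
  case (elim t)
  have *: "c (block t) * (a k * e k t) = c k * a k * e k t" for k and a :: "nat \<Rightarrow> complex"
    using elim[rule_format, of k] e_eq_0_iff[of k t] by (cases "u k t = 0") auto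
  show ?case by (intro allI, subst sum_distrib_left, rule sum.cong[OF refl], rule *)
qed

lemma partial_sum_carr [simp]: "(\<lambda>t. \<Sum>k<N. a k * e k t) \<in> carr X"
  by simp

lemma expands_iff:
  "expands X u a x \<longleftrightarrow> x \<in> carr X \<and> (\<lambda>N. nrm X (\<lambda>t. x t - (\<Sum>k<N. a k * e k t))) \<longlonglongrightarrow> 0"
  by (simp add: expands_def e_def)

lemma expands_carr: "expands X u a x \<Longrightarrow> x \<in> carr X"
  by (simp add: expands_def)

lemma expands_multiplier:
  assumes x: "expands X u a x" and c: "\<And>k. cmod (c k) \<le> 1"
  shows "expands X u (\<lambda>k. c k * a k) (\<lambda>t. c (block t) * x t)"
  unfolding expands_iff
proof
  have xX: "x \<in> carr X" and lim: "(\<lambda>N. nrm X (\<lambda>t. x t - (\<Sum>k<N. a k * e k t))) \<longlonglongrightarrow> 0"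
    using x by (auto simp: expands_iff)
  show cx: "(\<lambda>t. c (block t) * x t) \<in> carr X" by (rule block_multiplier(3)[of c, OF c xX])
  show "(\<lambda>N. nrm X (\<lambda>t. c (block t) * x t - (\<Sum>k<N. c k * a k * e k t))) \<longlonglongrightarrow> 0"
  proof (rule Lim_null_comparison[OF _ lim], rule always_eventually, rule allI)
    fix N
    have d: "(\<lambda>t. x t - (\<Sum>k<N. a k * e k t)) \<in> carr X" using xX by simp
    have d': "(\<lambda>t. c (block t) * x t - (\<Sum>k<N. c k * a k * e k t)) \<in> carr X"
      by (rule diff_carr[OF cx]) (rule partial_sum_carr)
    have "AE t in M. c (block t) * x t - (\<Sum>k<N. c k * a k * e k t)
        = c (block t) * (x t - (\<Sum>k<N. a k * e k t))"
      using AE_multiplier_sum[of c] by eventually_elim (simp add: right_diff_distrib)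
    from ae_cong(2)[OF measurable_carr[OF d'] block_multiplier(3)[of c, OF c d] this]
    show "norm (nrm X (\<lambda>t. c (block t) * x t - (\<Sum>k<N. c k * a k * e k t)))
        \<le> nrm X (\<lambda>t. x t - (\<Sum>k<N. a k * e k t))"
      using block_multiplier(4)[of c, OF c d] nrm_nonneg[OF d'] by simp
  qed
qed

lemma expands_finite:
  assumes "\<And>k. k \<ge> N \<Longrightarrow> a k = 0"
  shows "expands X u a (\<lambda>t. \<Sum>k<N. a k * e k t)"
  unfolding expands_iff
proof
  have "(\<Sum>k<N. a k * e k t) = (\<Sum>k<n. a k * e k t)" if "n \<ge> N" for n t
    using that assms by (intro sum.mono_neutral_left) auto
  then have "\<forall>\<^sub>F n in sequentially. nrm X (\<lambda>t. (\<Sum>k<N. a k * e k t) - (\<Sum>k<n. a k * e k t)) = 0"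
    unfolding eventually_sequentially by (intro exI[of _ N]) simp
  then show "(\<lambda>n. nrm X (\<lambda>t. (\<Sum>k<N. a k * e k t) - (\<Sum>k<n. a k * e k t))) \<longlonglongrightarrow> 0"
    by (rule tendsto_eventually)
qed simp

lemma expands_add:
  assumes x: "expands X u a x" and y: "expands X u b y"
  shows "expands X u (\<lambda>k. a k + b k) (\<lambda>t. x t + y t)"
  unfolding expands_iff
proof
  have X: "x \<in> carr X" "y \<in> carr X" using x y by (auto simp: expands_iff)
  then show "(\<lambda>t. x t + y t) \<in> carr X" by simp
  have lim: "(\<lambda>N. nrm X (\<lambda>t. x t - (\<Sum>k<N. a k * e k t)) + nrm X (\<lambda>t. y t - (\<Sum>k<N. b k * e k t))) \<longlonglongrightarrow> 0"
    using x y by (intro tendsto_add_zero) (auto simp: expands_iff)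
  have eq: "(\<lambda>t. x t + y t - (\<Sum>k<N. (a k + b k) * e k t))
      = (\<lambda>t. (x t - (\<Sum>k<N. a k * e k t)) + (y t - (\<Sum>k<N. b k * e k t)))" for N
    by (simp add: sum.distrib algebra_simps)
  have "norm (nrm X (\<lambda>t. x t + y t - (\<Sum>k<N. (a k + b k) * e k t)))
      \<le> nrm X (\<lambda>t. x t - (\<Sum>k<N. a k * e k t)) + nrm X (\<lambda>t. y t - (\<Sum>k<N. b k * e k t))" for N
    unfolding eq
    using nrm_add[of "\<lambda>t. x t - (\<Sum>k<N. a k * e k t)" "\<lambda>t. y t - (\<Sum>k<N. b k * e k t)"] X
    by simp
  then show "(\<lambda>N. nrm X (\<lambda>t. x t + y t - (\<Sum>k<N. (a k + b k) * e k t))) \<longlonglongrightarrow> 0"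
    by (intro Lim_null_comparison[OF _ lim] always_eventually allI)
qed

lemma expands_cmult:
  assumes x: "expands X u a x"
  shows "expands X u (\<lambda>k. c * a k) (\<lambda>t. c * x t)"
  unfolding expands_iff
proof
  have X: "x \<in> carr X" using x by (auto simp: expands_iff)
  then show "(\<lambda>t. c * x t) \<in> carr X" by simp
  have eq: "nrm X (\<lambda>t. c * x t - (\<Sum>k<N. c * a k * e k t)) = cmod c * nrm X (\<lambda>t. x t - (\<Sum>k<N. a k * e k t))" for N
  proof -
    have "(\<lambda>t. c * x t - (\<Sum>k<N. c * a k * e k t)) = (\<lambda>t. c * (x t - (\<Sum>k<N. a k * e k t)))"
      by (simp add: sum_distrib_left right_diff_distrib mult.assoc)
    then show ?thesis using X by (simp add: nrm_cmult)
  qed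
  show "(\<lambda>N. nrm X (\<lambda>t. c * x t - (\<Sum>k<N. c * a k * e k t))) \<longlonglongrightarrow> 0"
    unfolding eq using x by (intro tendsto_mult_right_zero) (simp add: expands_iff)
qed

lemma expands_diff:
  assumes x: "expands X u a x" and y: "expands X u b y"
  shows "expands X u (\<lambda>k. a k - b k) (\<lambda>t. x t - y t)"
  using expands_add[OF x expands_cmult[OF y, of "-1"]] by simp

lemma expands_unique:
  assumes "expands X u a x" "expands X u a y"
  shows "AE t in M. x t = y t" "nrm X x = nrm X y"
proof -
  have X: "x \<in> carr X" "y \<in> carr X" using assms by (auto simp: expands_iff)
  have "(\<lambda>N. nrm X (\<lambda>t. x t - y t - (\<Sum>k<N. (a k - a k) * e k t))) \<longlonglongrightarrow> 0"
    using expands_diff[OF assms] by (simp add: expands_iff)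
  then have "nrm X (\<lambda>t. x t - y t) = 0" by (simp add: LIMSEQ_const_iff)
  then show ae: "AE t in M. x t = y t" using ae_eqI[OF X] by simp
  show "nrm X x = nrm X y" using ae_cong(2)[OF measurable_carr[OF X(1)] X(2) ae] .
qed

lemma span_carrI: "expands X u a x \<Longrightarrow> a \<in> carr W"
  unfolding span_space_def by auto

lemma span_carrE: assumes "a \<in> carr W" obtains x where "expands X u a x"
  using assms unfolding span_space_def by auto

lemma nrm_span: assumes "expands X u a x" shows "nrm W a = nrm X x"
proof -
  have "expands X u a (SOME x. expands X u a x)" using assms by (rule someI[of "expands X u a"])
  from expands_unique(2)[OF this assms] show ?thesis by (simp add: span_space_def)
qed

lemma coeff_le:
  assumes x: "expands X u a x" shows "cmod (a k) \<le> nrm X x"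
proof -
  \<comment> \<open>Used as a multiplier, the indicator of \<open>{k}\<close> isolates one term of
    the expansion.\<close>
  define c :: "nat \<Rightarrow> complex" where "c j = (if j = k then 1 else 0)" for j
  have c: "cmod (c j) \<le> 1" for j by (simp add: c_def)
  have 1: "expands X u (\<lambda>j. c j * a j) (\<lambda>t. c (block t) * x t)" by (rule expands_multiplier[of a x c, OF x c])
  have 2: "expands X u (\<lambda>j. c j * a j) (\<lambda>t. \<Sum>j<Suc k. c j * a j * e j t)"
    by (rule expands_finite) (simp add: c_def)
  have "(\<Sum>j<Suc k. c j * a j * e j t) = a k * e k t" for t
    by (simp add: c_def)
  then have "cmod (a k) = nrm X (\<lambda>t. \<Sum>j<Suc k. c j * a j * e j t)" by (simp add: nrm_cmult)
  also have "\<dots> = nrm X (\<lambda>t. c (block t) * x t)" using expands_unique(2)[OF 2 1] .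
  also have "\<dots> \<le> nrm X x" by (rule block_multiplier(4)[of c, OF c expands_carr[OF x]])
  finally show ?thesis .
qed

lemma partial_sum_le:
  assumes x: "expands X u a x" shows "nrm X (\<lambda>t. \<Sum>k<N. a k * e k t) \<le> nrm X x"
proof -
  define c :: "nat \<Rightarrow> complex" where "c j = (if j < N then 1 else 0)" for j
  have c: "cmod (c j) \<le> 1" for j by (simp add: c_def)
  have 1: "expands X u (\<lambda>j. c j * a j) (\<lambda>t. c (block t) * x t)" by (rule expands_multiplier[of a x c, OF x c])
  have 2: "expands X u (\<lambda>j. c j * a j) (\<lambda>t. \<Sum>j<N. c j * a j * e j t)"
    by (rule expands_finite) (simp add: c_def)
  have "(\<lambda>t. \<Sum>j<N. c j * a j * e j t) = (\<lambda>t. \<Sum>k<N. a k * e k t)" by (simp add: c_def)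
  then show ?thesis
    using expands_unique(2)[OF 2 1] block_multiplier(4)[of c, OF c expands_carr[OF x]] by simp
qed

section \<open>The span as a space of coefficient sequences\<close>

lemma span_seminormed: "seminormed W"
proof
  have "(\<lambda>_. 0) \<in> carr W" using span_carrI[OF expands_finite[of 0 "\<lambda>_. 0"]] by simp
  moreover have "(\<lambda>k. a k + b k) \<in> carr W" if ab: "a \<in> carr W" "b \<in> carr W" for a b
  proof -
    obtain x where x: "expands X u a x" using span_carrE[OF ab(1)] .
    obtain y where y: "expands X u b y" using span_carrE[OF ab(2)] .
    show ?thesis by (rule span_carrI[OF expands_add[OF x y]])
  qed
  moreover have "(\<lambda>k. c * a k) \<in> carr W" if a: "a \<in> carr W" for a c
  proof -
    obtain x where x: "expands X u a x" using span_carrE[OF a] .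
    show ?thesis by (rule span_carrI[OF expands_cmult[OF x]])
  qed
  ultimately show "linear_subspace (carr W)" by (simp add: linear_subspace_def)
  show "0 \<le> nrm W a" if a: "a \<in> carr W" for a
  proof -
    obtain x where "expands X u a x" using span_carrE[OF a] .
    then show ?thesis using nrm_span expands_carr by simp
  qed
  show "nrm W (\<lambda>k. c * a k) = cmod c * nrm W a" if a: "a \<in> carr W" for a c
  proof -
    obtain x where x: "expands X u a x" using span_carrE[OF a] .
    show ?thesis
      using nrm_span[OF x] nrm_span[OF expands_cmult[OF x]] nrm_cmult[OF expands_carr[OF x]] by simp
  qed
  show "nrm W (\<lambda>k. a k + b k) \<le> nrm W a + nrm W b" if a: "a \<in> carr W" and b: "b \<in> carr W" for a b
  proof -
    obtain x where x: "expands X u a x" using span_carrE[OF a] .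
    obtain y where y: "expands X u b y" using span_carrE[OF b] .
    show ?thesis
      using nrm_span[OF x] nrm_span[OF y] nrm_span[OF expands_add[OF x y]]
        nrm_add[OF expands_carr[OF x] expands_carr[OF y]] by simp
  qed
qed

text \<open>Dominated coefficients arise by the diagonal multiplier \<open>b k / a k\<close>. For
  completeness, the coefficients converge one by one and the vectors converge in \<open>X\<close>;
  it remains to see that the limit vector expands with the limit coefficients.\<close>

theorem span_koethe: "koethe_space (count_space UNIV) W"
proof (rule koethe_spaceI)
  interpret W: seminormed W by (rule span_seminormed)
  show "seminormed W" by (rule span_seminormed)
  show "sigma_finite_measure (count_space (UNIV :: nat set))"
    by (rule sigma_finite_measure_count_space)
  show "carr W \<subseteq> borel_measurable (count_space UNIV)" by auto
  show "AE k in count_space UNIV. a k = 0" if a: "a \<in> carr W" "nrm W a = 0" for a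
  proof -
    obtain x where x: "expands X u a x" using span_carrE[OF a(1)] .
    have "a k = 0" for k using coeff_le[OF x, of k] nrm_span[OF x] a(2) by simp
    then show ?thesis by simp
  qed
  show "b \<in> carr W \<and> nrm W b \<le> nrm W a"
    if a: "a \<in> carr W" and le: "AE k in count_space UNIV. cmod (b k) \<le> cmod (a k)" for a b
  proof -
    obtain x where x: "expands X u a x" using span_carrE[OF a] .
    define c where "c k = b k / a k" for k
    have le': "cmod (b k) \<le> cmod (a k)" for k using le by (simp add: AE_count_space)
    have c: "cmod (c k) \<le> 1" for k using le'[of k] by (auto simp: c_def norm_divide divide_le_eq_1)
    have "c k * a k = b k" for k using le'[of k] by (auto simp: c_def)
    then have b: "expands X u b (\<lambda>t. c (block t) * x t)" using expands_multiplier[of a x c, OF x c] by simp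
    show ?thesis
      using span_carrI[OF b] nrm_span[OF b] nrm_span[OF x] block_multiplier(4)[of c, OF c expands_carr[OF x]] by simp
  qed
  show W.complete_space
    unfolding W.complete_space_def
  proof (intro allI impI, elim conjE)
    fix a :: "nat \<Rightarrow> nat \<Rightarrow> complex"
    assume a: "\<forall>n. a n \<in> carr W"
      and C: "\<forall>\<epsilon>>0. \<exists>N. \<forall>m\<ge>N. \<forall>n\<ge>N. nrm W (\<lambda>k. a m k - a n k) < \<epsilon>"
    have "\<forall>n. \<exists>x. expands X u (a n) x" using a span_carrE by metis
    then obtain x where x: "\<And>n. expands X u (a n) (x n)" by metis
    note xX = expands_carr[OF x]
    have nW: "nrm W (\<lambda>k. a m k - a n k) = nrm X (\<lambda>t. x m t - x n t)" for m n
      by (rule nrm_span[OF expands_diff[OF x x]])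
    have "\<exists>y\<in>carr X. (\<lambda>n. nrm X (\<lambda>t. x n t - y t)) \<longlonglongrightarrow> 0"
      by (rule complete_spaceD[OF complete xX]) (use C nW in simp)
    then obtain y where y: "y \<in> carr X" and lim: "(\<lambda>n. nrm X (\<lambda>t. x n t - y t)) \<longlonglongrightarrow> 0" by blast
    have "Cauchy (\<lambda>n. a n k)" for k
    proof (rule CauchyI)
      fix \<epsilon> :: real assume "0 < \<epsilon>"
      then obtain N where N: "\<And>m n. m \<ge> N \<Longrightarrow> n \<ge> N \<Longrightarrow> nrm W (\<lambda>k. a m k - a n k) < \<epsilon>" using C by blast
      have "norm (a m k - a n k) < \<epsilon>" if "m \<ge> N" "n \<ge> N" for m n
        using coeff_le[OF expands_diff[OF x[of m] x[of n]], of k] N[OF that] nW[of m n] by simp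
      then show "\<exists>N. \<forall>m\<ge>N. \<forall>n\<ge>N. norm (a m k - a n k) < \<epsilon>" by blast
    qed
    then have "\<forall>k. \<exists>b. (\<lambda>n. a n k) \<longlonglongrightarrow> b" by (simp add: Cauchy_convergent_iff convergent_def)
    then obtain b where b: "\<And>k. (\<lambda>n. a n k) \<longlonglongrightarrow> b k" by metis
    \<comment> \<open>Partial sums are contractive in the vector, so this bound is independent of
      \<open>N\<close>; that uniformity permits exchanging the two limits.\<close>
    have near: "nrm X (\<lambda>t. (\<Sum>k<N. b k * e k t) - (\<Sum>k<N. a m k * e k t)) \<le> nrm X (\<lambda>t. y t - x m t)" for N m
    proof (rule LIMSEQ_le)
      show "(\<lambda>n. nrm X (\<lambda>t. x n t - x m t)) \<longlonglongrightarrow> nrm X (\<lambda>t. y t - x m t)"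
        by (rule tendsto_nrm_diff[OF xX y xX lim])
      have "(\<lambda>n. \<Sum>k<N. cmod (a n k - b k)) \<longlonglongrightarrow> (\<Sum>k<N. cmod (b k - b k))"
        by (intro tendsto_intros b)
      then have l: "(\<lambda>n. \<Sum>k<N. cmod (a n k - b k)) \<longlonglongrightarrow> 0" by simp
      show "(\<lambda>n. nrm X (\<lambda>t. (\<Sum>k<N. a n k * e k t) - (\<Sum>k<N. a m k * e k t)))
          \<longlonglongrightarrow> nrm X (\<lambda>t. (\<Sum>k<N. b k * e k t) - (\<Sum>k<N. a m k * e k t))"
      proof (rule tendsto_nrm_diff)
        show "(\<lambda>n. nrm X (\<lambda>t. (\<Sum>k<N. a n k * e k t) - (\<Sum>k<N. b k * e k t))) \<longlonglongrightarrow> 0"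
        proof (rule Lim_null_comparison[OF _ l], rule always_eventually, rule allI)
          fix n
          have "(\<lambda>t. (\<Sum>k<N. a n k * e k t) - (\<Sum>k<N. b k * e k t)) = (\<lambda>t. \<Sum>k<N. (a n k - b k) * e k t)"
            by (simp add: sum_subtractf left_diff_distrib)
          then show "norm (nrm X (\<lambda>t. (\<Sum>k<N. a n k * e k t) - (\<Sum>k<N. b k * e k t))) \<le> (\<Sum>k<N. cmod (a n k - b k))"
            using nrm_sum[of "{..<N}" "\<lambda>k t. (a n k - b k) * e k t"] by (simp add: nrm_cmult)
        qed
      qed simp_all
      have "nrm X (\<lambda>t. (\<Sum>k<N. a n k * e k t) - (\<Sum>k<N. a m k * e k t)) \<le> nrm X (\<lambda>t. x n t - x m t)" for n
        using partial_sum_le[OF expands_diff[OF x[of n] x[of m]], of N] by (simp add: sum_subtractf left_diff_distrib)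
      then show "\<exists>N'. \<forall>n\<ge>N'. nrm X (\<lambda>t. (\<Sum>k<N. a n k * e k t) - (\<Sum>k<N. a m k * e k t)) \<le> nrm X (\<lambda>t. x n t - x m t)"
        by blast
    qed
    have "expands X u b y"
      unfolding expands_iff
    proof (intro conjI y LIMSEQ_I)
      fix \<epsilon> :: real assume \<epsilon>: "0 < \<epsilon>"
      obtain m where m: "nrm X (\<lambda>t. x m t - y t) < \<epsilon>/3"
        using order_tendstoD(2)[OF lim, of "\<epsilon>/3"] \<epsilon> by (auto simp: eventually_sequentially)
      have m': "nrm X (\<lambda>t. y t - x m t) < \<epsilon>/3" using m nrm_diff_commute[OF xX y] by simp
      have "(\<lambda>N. nrm X (\<lambda>t. x m t - (\<Sum>k<N. a m k * e k t))) \<longlonglongrightarrow> 0" using x by (simp add: expands_iff)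
      then obtain N0 where N0: "\<And>N. N \<ge> N0 \<Longrightarrow> nrm X (\<lambda>t. x m t - (\<Sum>k<N. a m k * e k t)) < \<epsilon>/3"
        using order_tendstoD(2)[of _ 0 sequentially "\<epsilon>/3"] \<epsilon> by (force simp: eventually_sequentially)
      have "nrm X (\<lambda>t. y t - (\<Sum>k<N. b k * e k t)) < \<epsilon>" if N: "N \<ge> N0" for N
      proof -
        have "nrm X (\<lambda>t. y t - (\<Sum>k<N. b k * e k t))
            \<le> nrm X (\<lambda>t. y t - x m t) + nrm X (\<lambda>t. x m t - (\<Sum>k<N. b k * e k t))"
          by (rule nrm_diff_triangle[OF y xX partial_sum_carr])
        also have "nrm X (\<lambda>t. x m t - (\<Sum>k<N. b k * e k t))
            \<le> nrm X (\<lambda>t. x m t - (\<Sum>k<N. a m k * e k t)) + nrm X (\<lambda>t. (\<Sum>k<N. a m k * e k t) - (\<Sum>k<N. b k * e k t))"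
          by (rule nrm_diff_triangle[OF xX partial_sum_carr partial_sum_carr])
        finally show ?thesis
          using near[of N m] nrm_diff_commute[OF partial_sum_carr[of b N] partial_sum_carr[of "a m" N]]
            N0[OF N] m' by linarith
      qed
      then show "\<exists>no. \<forall>N\<ge>no. norm (nrm X (\<lambda>t. y t - (\<Sum>k<N. b k * e k t)) - 0) < \<epsilon>"
        using nrm_nonneg[OF diff_carr[OF y partial_sum_carr]] by auto
    qed
    note eb = this
    have "nrm W (\<lambda>k. a n k - b k) = nrm X (\<lambda>t. x n t - y t)" for n
      by (rule nrm_span[OF expands_diff[OF x eb]])
    then show "\<exists>b\<in>carr W. (\<lambda>n. nrm W (\<lambda>k. a n k - b k)) \<longlonglongrightarrow> 0"
      using lim span_carrI[OF eb] by (intro bexI[of _ b]) simp_all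
  qed
qed

lemma span_truncation:
  assumes x: "expands X u a x"
  shows "(\<lambda>N. nrm W (\<lambda>k. a k - (if k < N then a k else 0))) \<longlonglongrightarrow> 0"
proof -
  have "nrm W (\<lambda>k. a k - (if k < N then a k else 0)) = nrm X (\<lambda>t. x t - (\<Sum>k<N. a k * e k t))" for N
  proof (rule nrm_span, rule expands_diff[OF x])
    have "expands X u (\<lambda>k. if k < N then a k else 0) (\<lambda>t. \<Sum>k<N. (if k < N then a k else 0) * e k t)"
      by (rule expands_finite) simp
    then show "expands X u (\<lambda>k. if k < N then a k else 0) (\<lambda>t. \<Sum>k<N. a k * e k t)" by simp
  qed
  then show ?thesis using x by (simp add: expands_iff)
qed

theorem span_unconditional_basis: "unconditional_basis_space (count_space UNIV) W"
proof -
  have "(\<lambda>i. if i = k then 1 else 0) \<in> carr W" for k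
    by (rule span_carrI[OF expands_finite[of "Suc k"]]) auto
  moreover have "(\<lambda>N. nrm W (\<lambda>i. a i - (if i < N then a i else 0))) \<longlonglongrightarrow> 0" if "a \<in> carr W" for a
    by (rule span_carrE[OF that]) (rule span_truncation)
  ultimately show ?thesis unfolding unconditional_basis_space_def using span_koethe by blast
qed

end

section \<open>The induced centralizer\<close>

locale centralizer = interpolation M X0 X1 \<theta> for M :: "'a measure" and X0 X1 \<theta> +
  fixes B :: "('a \<Rightarrow> complex) \<Rightarrow> complex \<Rightarrow> 'a \<Rightarrow> complex" and \<Omega> :: "('a \<Rightarrow> complex) \<Rightarrow> 'a \<Rightarrow> complex"
  assumes selector: "interp_selector M X0 X1 \<theta> B"
    and deriv: "\<And>x. x \<in> carr X \<Longrightarrow> complex_deriv_in Z (B x) (\<Omega> x) th"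
begin

lemma B_H: "x \<in> carr X \<Longrightarrow> B x \<in> H"
  and B_th: "x \<in> carr X \<Longrightarrow> AE t in M. B x th t = x t"
  and B_cong: "\<lbrakk>x \<in> carr X; y \<in> carr X; AE t in M. x t = y t; z \<in> strip\<rbrakk> \<Longrightarrow> AE t in M. B x z t = B y z t"
  and B_cmult: "\<lbrakk>x \<in> carr X; z \<in> strip\<rbrakk> \<Longrightarrow> AE t in M. B (\<lambda>t. c * x t) z t = c * B x z t"
  and B_sign: "\<lbrakk>w \<in> borel_measurable M; \<And>t. t \<in> space M \<Longrightarrow> w t \<in> {-1, 1}; x \<in> carr X; z \<in> strip\<rbrakk> \<Longrightarrow>
      AE t in M. B (\<lambda>t. w t * x t) z t = w t * B x z t"
  and B_supp: "\<lbrakk>x \<in> carr X; z \<in> strip\<rbrakk> \<Longrightarrow> supp_subset M (B x z) x"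
proof -
  note S = selector[unfolded interp_selector_def Let_def ae_eq_def]
  note S1 = S[THEN conjunct1] and S2 = S[THEN conjunct2, THEN conjunct2]
  note S3 = S2[THEN conjunct2] note S4 = S3[THEN conjunct2] note S5 = S4[THEN conjunct2]
  show "x \<in> carr X \<Longrightarrow> B x \<in> H" "x \<in> carr X \<Longrightarrow> AE t in M. B x th t = x t"
    using S1 by auto
  show "\<lbrakk>x \<in> carr X; y \<in> carr X; AE t in M. x t = y t; z \<in> strip\<rbrakk> \<Longrightarrow> AE t in M. B x z t = B y z t"
    by (rule S2[THEN conjunct1, rule_format])
  show "\<lbrakk>x \<in> carr X; z \<in> strip\<rbrakk> \<Longrightarrow> AE t in M. B (\<lambda>t. c * x t) z t = c * B x z t"
    by (rule S3[THEN conjunct1, rule_format])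
  show "\<lbrakk>w \<in> borel_measurable M; \<And>t. t \<in> space M \<Longrightarrow> w t \<in> {-1, 1}; x \<in> carr X; z \<in> strip\<rbrakk> \<Longrightarrow>
      AE t in M. B (\<lambda>t. w t * x t) z t = w t * B x z t"
    by (rule S4[THEN conjunct1, rule_format]) simp_all
  show "\<lbrakk>x \<in> carr X; z \<in> strip\<rbrakk> \<Longrightarrow> supp_subset M (B x z) x"
    by (rule S5[rule_format])
qed

lemma B_bound: obtains C where "C > 0" "\<And>x. x \<in> carr X \<Longrightarrow> hnrm (B x) \<le> C * nrm X x"
proof -
  obtain C where C: "\<And>x. x \<in> carr X \<Longrightarrow> hnrm (B x) \<le> C * nrm X x"
    using selector[unfolded interp_selector_def Let_def, THEN conjunct2, THEN conjunct1] by blast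
  have "hnrm (B x) \<le> max C 1 * nrm X x" if "x \<in> carr X" for x
    using C[OF that] mult_right_mono[of C "max C 1" "nrm X x"] that by simp
  then show ?thesis using that[of "max C 1"] by simp
qed

lemma \<Omega>_carr: "x \<in> carr X \<Longrightarrow> \<Omega> x \<in> carr Z"
  using deriv by (simp add: complex_deriv_in_def)

lemma \<Omega>_weak:
  assumes x: "x \<in> carr X" and \<phi>: "contraction Z \<phi>"
  shows "((\<lambda>z. \<phi> (B x z)) has_field_derivative \<phi> (\<Omega> x)) (at th)"
  using calderonD(1)[OF B_H[OF x]] th_interior
  by (intro Z.contraction_has_field_derivative[OF \<phi> deriv[OF x]] eventually_carr) auto

text \<open>The null set in the identity between \<open>B x z\<close> and \<open>g z\<close> may
  depend on \<open>z\<close>, so the identity cannot be differentiated pointwise. Functionals on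
  \<open>Z\<close> ignore null sets, and their derivatives determine \<open>\<Omega> x\<close>
  almost everywhere.\<close>

lemma \<Omega>_eqI:
  assumes x: "x \<in> carr X" and d: "d \<in> carr Z"
    and weak: "\<And>\<phi>. contraction Z \<phi> \<Longrightarrow> ((\<lambda>z. \<phi> (g z)) has_field_derivative \<phi> d) (at th)"
    and g: "\<And>z. z \<in> strip \<Longrightarrow> g z \<in> carr Z" "\<And>z. z \<in> strip \<Longrightarrow> AE t in M. B x z t = g z t"
  shows "AE t in M. \<Omega> x t = d t"
proof (rule Z.ae_eqI[OF \<Omega>_carr[OF x] d], rule Z.nrm_leI)
  show "(\<lambda>t. \<Omega> x t - d t) \<in> carr Z" using \<Omega>_carr[OF x] d by simp
  fix \<phi> assume \<phi>: "contraction Z \<phi>"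
  have "\<phi> (B x z) = \<phi> (g z)" if "z \<in> strip" for z
  proof -
    have b: "B x z \<in> carr Z" by (rule calderonD(1)[OF B_H[OF x] that])
    have bg: "(\<lambda>t. B x z t - g z t) \<in> carr Z" using b g(1)[OF that] by simp
    have "AE t in M. B x z t - g z t = 0" using g(2)[OF that] by eventually_elim simp
    then have "nrm Z (\<lambda>t. B x z t - g z t) = 0" using Z.nrm_eq_0_iff[OF bg] by blast
    then have "\<phi> (\<lambda>t. B x z t - g z t) = 0" using Z.contraction_le[OF \<phi> bg] by simp
    then show ?thesis using Z.contraction_diff[OF \<phi> b g(1)[OF that]] by simp
  qed
  then have eq: "\<phi> (g z) = \<phi> (B x z)" if "z \<in> interior strip" for z
    using that interior_subset by (metis subsetD)
  have "((\<lambda>z. \<phi> (B x z)) has_field_derivative \<phi> d) (at th)"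
    by (rule has_field_derivative_transform_within_open[OF weak[OF \<phi>] open_interior th_interior eq])
  then have "\<phi> (\<Omega> x) = \<phi> d" using \<Omega>_weak[OF x \<phi>] DERIV_unique by blast
  then show "cmod (\<phi> (\<lambda>t. \<Omega> x t - d t)) \<le> 0"
    using Z.contraction_diff[OF \<phi> \<Omega>_carr[OF x] d] by simp
qed

lemma \<Omega>_cong:
  assumes "x \<in> carr X" "y \<in> carr X" "AE t in M. x t = y t"
  shows "AE t in M. \<Omega> x t = \<Omega> y t"
  by (rule \<Omega>_eqI[OF assms(1) \<Omega>_carr[OF assms(2)], of "B y"])
    (use \<Omega>_weak[OF assms(2)] calderonD(1)[OF B_H[OF assms(2)]] B_cong[OF assms] in auto)

lemma \<Omega>_cmult:
  assumes x: "x \<in> carr X"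
  shows "AE t in M. \<Omega> (\<lambda>t. c * x t) t = c * \<Omega> x t"
proof (rule \<Omega>_eqI[of _ _ "\<lambda>z t. c * B x z t"])
  fix \<phi> assume \<phi>: "contraction Z \<phi>"
  have "((\<lambda>z. c * \<phi> (B x z)) has_field_derivative c * \<phi> (\<Omega> x)) (at th)"
    by (rule DERIV_cmult[OF \<Omega>_weak[OF x \<phi>]])
  then have "((\<lambda>z. c * \<phi> (B x z)) has_field_derivative \<phi> (\<lambda>t. c * \<Omega> x t)) (at th)"
    using Z.contraction_cmult[OF \<phi> \<Omega>_carr[OF x]] by simp
  then show "((\<lambda>z. \<phi> (\<lambda>t. c * B x z t)) has_field_derivative \<phi> (\<lambda>t. c * \<Omega> x t)) (at th)"
  proof (rule has_field_derivative_transform_within_open[OF _ open_interior th_interior])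
    fix z assume "z \<in> interior strip"
    then have "z \<in> strip" using interior_subset by blast
    then show "c * \<phi> (B x z) = \<phi> (\<lambda>t. c * B x z t)"
      using Z.contraction_cmult[OF \<phi> calderonD(1)[OF B_H[OF x]]] by simp
  qed
qed (use x \<Omega>_carr[OF x] calderonD(1)[OF B_H[OF x]] B_cmult[OF x] in auto)

lemma \<Omega>_sign:
  assumes w: "w \<in> borel_measurable M" "\<And>t. w t \<in> {-1, 1}" and x: "x \<in> carr X"
  shows "AE t in M. \<Omega> (\<lambda>t. w t * x t) t = w t * \<Omega> x t"
proof (rule \<Omega>_eqI[of _ _ "\<lambda>z t. w t * B x z t"])
  have w1: "cmod (w t) \<le> 1" for t using w(2)[of t] by auto
  show "(\<lambda>t. w t * x t) \<in> carr X" using X.mult_bounded(1)[OF w(1) _ x] w1 by simp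
  have mZ: "(\<lambda>t. w t * f t) \<in> carr Z" "nrm Z (\<lambda>t. w t * f t) \<le> nrm Z f" if "f \<in> carr Z" for f
    using Z.mult_bounded[OF w(1) _ that] w1 by auto
  then show "(\<lambda>t. w t * \<Omega> x t) \<in> carr Z" "\<And>z. z \<in> strip \<Longrightarrow> (\<lambda>t. w t * B x z t) \<in> carr Z"
    using \<Omega>_carr[OF x] calderonD(1)[OF B_H[OF x]] by auto
  show "AE t in M. B (\<lambda>t. w t * x t) z t = w t * B x z t" if "z \<in> strip" for z
    using w by (intro B_sign x that) auto
  fix \<phi> assume \<phi>: "contraction Z \<phi>"
  \<comment> \<open>The sign \<open>w\<close> is absorbed into the functional, so the weak
    derivative of \<open>w * B x\<close> is that of \<open>B x\<close> tested against another
    contraction.\<close>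
  have "contraction Z (\<lambda>f. \<phi> (\<lambda>t. w t * f t))"
    unfolding contraction_def
  proof (intro conjI ballI allI)
    fix f g assume "f \<in> carr Z" "g \<in> carr Z"
    then show "\<phi> (\<lambda>t. w t * (f t + g t)) = \<phi> (\<lambda>t. w t * f t) + \<phi> (\<lambda>t. w t * g t)"
      using Z.contraction_add[OF \<phi> mZ(1) mZ(1)] by (simp add: distrib_left)
  next
    fix c f assume "f \<in> carr Z"
    then show "\<phi> (\<lambda>t. w t * (c * f t)) = c * \<phi> (\<lambda>t. w t * f t)"
      using Z.contraction_cmult[OF \<phi> mZ(1), of f c] by (simp add: mult.left_commute)
  next
    fix f assume f: "f \<in> carr Z"
    show "cmod (\<phi> (\<lambda>t. w t * f t)) \<le> nrm Z f"
      using Z.contraction_le[OF \<phi> mZ(1)[OF f]] mZ(2)[OF f] by linarith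
  qed
  from \<Omega>_weak[OF x this]
  show "((\<lambda>z. \<phi> (\<lambda>t. w t * B x z t)) has_field_derivative \<phi> (\<lambda>t. w t * \<Omega> x t)) (at th)" .
qed

text \<open>Reversing signs off the support of \<open>x\<close> does not change \<open>x\<close> but
  negates \<open>\<Omega> x\<close> there.\<close>

lemma \<Omega>_supp:
  assumes x: "x \<in> carr X" shows "AE t in M. x t = 0 \<longrightarrow> \<Omega> x t = 0"
proof -
  define w where "w t = (if x t = 0 then -1 else 1 :: complex)" for t
  have [measurable]: "x \<in> borel_measurable M" by (rule X.measurable_carr[OF x])
  have "w \<in> borel_measurable M" unfolding w_def by measurable
  then have "AE t in M. \<Omega> (\<lambda>t. w t * x t) t = w t * \<Omega> x t"
    by (rule \<Omega>_sign) (auto simp: w_def x)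
  moreover have "(\<lambda>t. w t * x t) = x" by (auto simp: w_def)
  ultimately show ?thesis by (auto simp: w_def elim!: eventually_mono)
qed

text \<open>Compare \<open>exp (L (z - \<theta>))\<close> times the sum of the \<open>B x\<close> with \<open>B\<close> of the sum: both take the same value
  at \<open>\<theta>\<close>, and with \<open>L = ln (m0 / m1)\<close> the first one has equal bounds on both boundary lines.\<close>

theorem centralizer_sum_estimate:
  assumes xs: "set xs \<subseteq> carr X" and m: "m0 > 0" "m1 > 0"
    and CB: "\<And>x. x \<in> carr X \<Longrightarrow> hnrm (B x) \<le> CB * nrm X x" "CB \<ge> 0"
    and le: "\<And>y. nrm X0 (\<lambda>t. \<Sum>x\<leftarrow>xs. B x (Complex 0 y) t) \<le> C * m0"
      "\<And>y. nrm X1 (\<lambda>t. \<Sum>x\<leftarrow>xs. B x (Complex 1 y) t) \<le> C * m1"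
  defines "m \<equiv> m0 powr (1 - \<theta>) * m1 powr \<theta>"
  shows "nrm X (\<lambda>t. \<Sum>x\<leftarrow>xs. x t) \<le> C * m"
    and "(\<lambda>t. (\<Sum>x\<leftarrow>xs. \<Omega> x t) + of_real (ln (m0 / m1)) * (\<Sum>x\<leftarrow>xs. x t) - \<Omega> (\<lambda>t. \<Sum>x\<leftarrow>xs. x t) t) \<in> carr X"
    and "nrm X (\<lambda>t. (\<Sum>x\<leftarrow>xs. \<Omega> x t) + of_real (ln (m0 / m1)) * (\<Sum>x\<leftarrow>xs. x t) - \<Omega> (\<lambda>t. \<Sum>x\<leftarrow>xs. x t) t)
      \<le> (C + CB * C) / min \<theta> (1 - \<theta>) * m"
proof -
  define L where "L = ln (m0 / m1)"
  have L: "L = ln m0 - ln m1" using m by (simp add: L_def ln_div)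
  define F where "F z t = (\<Sum>x\<leftarrow>xs. B x z t)" for z t
  define c where "c z = exp (of_real L * (z - th))" for z
  define x where "x t = (\<Sum>x\<leftarrow>xs. x t)" for t
  have F_eq: "F z = (\<lambda>t. \<Sum>x\<leftarrow>xs. B x z t)" for z by (simp add: F_def fun_eq_iff)
  have xX: "x \<in> carr X" unfolding x_def using xs by (rule X.sum_list_carr)
  have FH: "F \<in> H" unfolding F_def using xs by (intro calderon_sum_list B_H) auto
  have cmod_c: "cmod (c z) = exp (L * (Re z - \<theta>))" for z by (simp add: c_def)
  have c_bd: "cmod (c z) \<le> exp \<bar>L\<bar>" if "z \<in> strip" for z
  proof -
    have "\<bar>Re z - \<theta>\<bar> \<le> 1" using that \<theta> by (auto simp: strip_def)
    then have "\<bar>L * (Re z - \<theta>)\<bar> \<le> \<bar>L\<bar> * 1" unfolding abs_mult by (intro mult_left_mono) auto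
    then show ?thesis unfolding cmod_c by simp
  qed
  define G1 where "G1 z t = c z * F z t" for z t
  have G1H: "G1 \<in> H" unfolding G1_def
    by (rule calderon_scalar(1)[OF FH _ _ c_bd]) (auto simp: c_def intro!: continuous_intros holomorphic_intros)
  have m_exp: "m = exp ((1 - \<theta>) * ln m0 + \<theta> * ln m1)"
    using m by (simp add: m_def powr_def exp_add)
  \<comment> \<open>This equation and the next one reflect the choice of \<open>L\<close>: the
    weighted bounds on the two lines both become \<open>m\<close>.\<close>
  have e0: "exp (- (L * \<theta>)) * m0 = m"
  proof -
    have "exp (- (L * \<theta>)) * m0 = exp (- (L * \<theta>)) * exp (ln m0)" using m by simp
    also have "\<dots> = m" unfolding m_exp L by (simp add: exp_add[symmetric] algebra_simps)
    finally show ?thesis .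
  qed
  have e1: "exp (L * (1 - \<theta>)) * m1 = m"
  proof -
    have "exp (L * (1 - \<theta>)) * m1 = exp (L * (1 - \<theta>)) * exp (ln m1)" using m by simp
    also have "\<dots> = m" unfolding m_exp L by (simp add: exp_add[symmetric] algebra_simps)
    finally show ?thesis .
  qed
  have G1_le: "hnrm G1 \<le> C * m"
  proof (rule hnrm_leI)
    fix y
    have "nrm X0 (G1 (Complex 0 y)) = exp (- (L * \<theta>)) * nrm X0 (F (Complex 0 y))"
      unfolding G1_def X0.nrm_cmult[OF calderonD(4)[OF FH]] by (simp add: cmod_c)
    also have "\<dots> \<le> exp (- (L * \<theta>)) * (C * m0)"
      using le(1)[of y] by (intro mult_left_mono) (auto simp: F_eq)
    also have "\<dots> = C * m" using e0 by (simp add: mult.left_commute)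
    finally show "nrm X0 (G1 (Complex 0 y)) \<le> C * m" .
    have "nrm X1 (G1 (Complex 1 y)) = exp (L * (1 - \<theta>)) * nrm X1 (F (Complex 1 y))"
      unfolding G1_def X1.nrm_cmult[OF calderonD(7)[OF FH]] by (simp add: cmod_c)
    also have "\<dots> \<le> exp (L * (1 - \<theta>)) * (C * m1)"
      using le(2)[of y] by (intro mult_left_mono) (auto simp: F_eq)
    also have "\<dots> = C * m" using e1 by (simp add: mult.left_commute)
    finally show "nrm X1 (G1 (Complex 1 y)) \<le> C * m" .
  qed
  have Fth: "AE t in M. F th t = x t"
    unfolding F_def x_def using xs
  proof (induction xs)
    case (Cons a xs)
    then have "AE t in M. (\<Sum>x\<leftarrow>xs. B x th t) = (\<Sum>x\<leftarrow>xs. x t)" "AE t in M. B a th t = a t"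
      using B_th by auto
    then show ?case by eventually_elim simp
  qed simp
  have G1th: "G1 th = F th" by (simp add: G1_def c_def fun_eq_iff)
  have "nrm X x = nrm X (F th)"
    using X.ae_cong(2)[OF X.measurable_carr[OF xX] _ , of "F th"] interp_carrI[OF FH] Fth
    by (auto simp: eq_commute)
  \<comment> \<open>\<open>G1\<close> represents the sum at \<open>\<theta>\<close> up to a null
    set, so its norm also bounds the sum. This in turn controls \<open>B x\<close>, which produces
    the summand \<open>CB * C\<close> of the constant.\<close>
  then have x_le: "nrm X x \<le> C * m" using interp_nrm_le[OF G1H] G1_le G1th by simp
  then show "nrm X (\<lambda>t. \<Sum>x\<leftarrow>xs. x t) \<le> C * m" unfolding x_def .
  define G where "G z t = G1 z t - B x z t" for z t
  have GH: "G \<in> H" and "hnrm G \<le> hnrm G1 + hnrm (B x)"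
    unfolding G_def using calderon_diff[OF G1H B_H[OF xX]] by auto
  then have G_le: "hnrm G \<le> C * m + CB * (C * m)"
    using G1_le CB(1)[OF xX] mult_left_mono[OF x_le CB(2)] by linarith
  have G0: "AE t in M. G th t = 0"
    using Fth B_th[OF xX] by eventually_elim (simp add: G_def G1th)
  have \<Omega>xs: "(\<lambda>t. \<Sum>x\<leftarrow>xs. \<Omega> x t) \<in> carr Z"
    using Z.sum_list_carr[of "map \<Omega> xs"] xs \<Omega>_carr by (auto simp: o_def)
  \<comment> \<open>Differentiating \<open>c * F\<close> at \<open>th\<close> yields
    \<open>L * F th\<close>; \<open>F th\<close> is exchanged for the almost everywhere equal
    \<open>x\<close> only at the end.\<close>
  define d where "d t = (\<Sum>x\<leftarrow>xs. \<Omega> x t) + of_real L * F th t - \<Omega> x t" for t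
  have dZ: "d \<in> carr Z"
    unfolding d_def using \<Omega>xs calderonD(1)[OF FH th_strip] \<Omega>_carr[OF xX] by simp
  have weak: "((\<lambda>z. \<phi> (G z)) has_field_derivative \<phi> d) (at th)" if \<phi>: "contraction Z \<phi>" for \<phi>
  proof -
    have F: "\<phi> (F z) = (\<Sum>x\<leftarrow>xs. \<phi> (B x z))" if "z \<in> strip" for z
      unfolding F_def using xs calderonD(1)[OF B_H that] by (intro Z.contraction_sum_list[OF \<phi>]) auto
    have sum: "((\<lambda>z. \<Sum>x\<leftarrow>xs. \<phi> (B x z)) has_field_derivative (\<Sum>x\<leftarrow>xs. \<phi> (\<Omega> x))) (at th)"
      using xs by (induction xs) (auto intro!: DERIV_add \<Omega>_weak[OF _ \<phi>])
    have c': "(c has_field_derivative of_real L) (at th)"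
      unfolding c_def by (auto intro!: derivative_eq_intros)
    have cth: "c th = 1" by (simp add: c_def)
    have "((\<lambda>z. c z * (\<Sum>x\<leftarrow>xs. \<phi> (B x z)) - \<phi> (B x z)) has_field_derivative
        (of_real L * (\<Sum>x\<leftarrow>xs. \<phi> (B x th)) + (\<Sum>x\<leftarrow>xs. \<phi> (\<Omega> x)) * c th) - \<phi> (\<Omega> x)) (at th)"
      by (intro DERIV_diff DERIV_mult c' sum \<Omega>_weak[OF xX \<phi>])
    also have "(of_real L * (\<Sum>x\<leftarrow>xs. \<phi> (B x th)) + (\<Sum>x\<leftarrow>xs. \<phi> (\<Omega> x)) * c th) - \<phi> (\<Omega> x) = \<phi> d"
    proof -
      have "\<phi> (\<lambda>t. \<Sum>x\<leftarrow>xs. \<Omega> x t) = (\<Sum>x\<leftarrow>xs. \<phi> (\<Omega> x))"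
        using xs \<Omega>_carr by (intro Z.contraction_sum_list[OF \<phi>]) auto
      then show ?thesis
        unfolding d_def cth F[OF th_strip, symmetric]
        using \<Omega>xs calderonD(1)[OF FH th_strip] \<Omega>_carr[OF xX]
        by (simp add: Z.contraction_diff[OF \<phi>] Z.contraction_add[OF \<phi>] Z.contraction_cmult[OF \<phi>])
    qed
    finally show ?thesis
    proof (rule has_field_derivative_transform_within_open[OF _ open_interior th_interior])
      fix z assume "z \<in> interior strip"
      then have z: "z \<in> strip" using interior_subset by blast
      show "c z * (\<Sum>x\<leftarrow>xs. \<phi> (B x z)) - \<phi> (B x z) = \<phi> (G z)"
        unfolding G_def G1_def F[OF z, symmetric]
        using calderonD(1)[OF FH z] calderonD(1)[OF B_H[OF xX] z]
        by (simp add: Z.contraction_diff[OF \<phi>] Z.contraction_cmult[OF \<phi>])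
    qed
  qed
  have "\<exists>d'. complex_deriv_in Z G d' th" using GH th_interior unfolding calderon_def by blast
  then have "complex_deriv_in Z G d th"
    using Z.complex_deriv_inI[OF _ calderonD(1)[OF GH th_strip] eventually_carr[OF calderonD(1)[OF GH] th_interior] dZ weak]
    by blast
  note dX = derivative_in_interp[OF GH G0 this]
  let ?D = "\<lambda>t. (\<Sum>x\<leftarrow>xs. \<Omega> x t) + of_real (ln (m0 / m1)) * (\<Sum>x\<leftarrow>xs. x t) - \<Omega> (\<lambda>t. \<Sum>x\<leftarrow>xs. x t) t"
  have D: "?D = (\<lambda>t. (\<Sum>x\<leftarrow>xs. \<Omega> x t) + of_real L * x t - \<Omega> x t)"
    unfolding L_def x_def ..
  have Dt: "?D t = (\<Sum>x\<leftarrow>xs. \<Omega> x t) + of_real L * x t - \<Omega> x t" for t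
    using fun_cong[OF D, of t] .
  have "?D \<in> carr Z"
    unfolding D using \<Omega>xs interp_sum_carr[OF xX] \<Omega>_carr[OF xX] by simp
  then have Dm: "?D \<in> borel_measurable M" by (rule Z.measurable_carr)
  have "AE t in M. ?D t = d t"
    unfolding Dt d_def using Fth by eventually_elim simp
  note DX = X.ae_cong[OF Dm dX(1) this]
  show "?D \<in> carr X" by (rule DX(1))
  have "nrm X ?D \<le> hnrm G / min \<theta> (1 - \<theta>)" using DX(2) dX(2) by simp
  also have "\<dots> \<le> (C * m + CB * (C * m)) / min \<theta> (1 - \<theta>)"
    using G_le \<theta> by (intro divide_right_mono) auto
  also have "\<dots> = (C + CB * C) / min \<theta> (1 - \<theta>) * m" by (simp add: field_simps)
  finally show "nrm X ?D \<le> (C + CB * C) / min \<theta> (1 - \<theta>) * m" .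
qed

text \<open>The preceding estimate for two vectors with \<open>m0 = m1 = 1\<close>, where the
  logarithm vanishes and \<open>m = 1\<close>.\<close>

corollary quasilinear:
  obtains K where "K \<ge> 0" "\<And>x y. x \<in> carr X \<Longrightarrow> y \<in> carr X \<Longrightarrow> (\<lambda>t. \<Omega> x t + \<Omega> y t - \<Omega> (\<lambda>t. x t + y t) t) \<in> carr X"
    "\<And>x y. x \<in> carr X \<Longrightarrow> y \<in> carr X \<Longrightarrow>
      nrm X (\<lambda>t. \<Omega> x t + \<Omega> y t - \<Omega> (\<lambda>t. x t + y t) t) \<le> K * (nrm X x + nrm X y)"
proof -
  obtain CB where CB: "CB > 0" "\<And>x. x \<in> carr X \<Longrightarrow> hnrm (B x) \<le> CB * nrm X x"
    by (rule B_bound) blast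
  define K where "K = (CB + CB * CB) / min \<theta> (1 - \<theta>)"
  have "K \<ge> 0" unfolding K_def using CB \<theta> by simp
  moreover have "(\<lambda>t. \<Omega> x t + \<Omega> y t - \<Omega> (\<lambda>t. x t + y t) t) \<in> carr X \<and>
      nrm X (\<lambda>t. \<Omega> x t + \<Omega> y t - \<Omega> (\<lambda>t. x t + y t) t) \<le> K * (nrm X x + nrm X y)"
    if x: "x \<in> carr X" and y: "y \<in> carr X" for x y
  proof -
    define C where "C = CB * (nrm X x + nrm X y)"
    note Bx = calderonD[OF B_H[OF x]] and By = calderonD[OF B_H[OF y]]
    have h: "hnrm (B x) + hnrm (B y) \<le> C"
      using CB(2)[OF x] CB(2)[OF y] by (simp add: C_def distrib_left)
    have 0: "nrm X0 (\<lambda>t. \<Sum>v\<leftarrow>[x, y]. B v (Complex 0 s) t) \<le> C * 1" for s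
      using X0.nrm_add[OF Bx(4) By(4), of s s] le_hnrm(1)[OF B_H[OF x], of s] le_hnrm(1)[OF B_H[OF y], of s] h
      by simp
    have 1: "nrm X1 (\<lambda>t. \<Sum>v\<leftarrow>[x, y]. B v (Complex 1 s) t) \<le> C * 1" for s
      using X1.nrm_add[OF Bx(7) By(7), of s s] le_hnrm(2)[OF B_H[OF x], of s] le_hnrm(2)[OF B_H[OF y], of s] h
      by simp
    have xy: "set [x, y] \<subseteq> carr X" using x y by simp
    note E = centralizer_sum_estimate[OF xy zero_less_one zero_less_one CB(2) less_imp_le[OF CB(1)] 0 1]
    have "(C + CB * C) / min \<theta> (1 - \<theta>) = K * (nrm X x + nrm X y)"
      by (simp add: K_def C_def algebra_simps add_divide_distrib)
    then show ?thesis using E(2,3) by simp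
  qed
  ultimately show ?thesis using that by blast
qed


section \<open>Linear approximations on disjoint sequences\<close>

text \<open>Triviality reduced to what survives averaging and restriction: the values
  \<open>w k\<close> of a linear map on the \<open>v k\<close>, tested on finite combinations.
  Positivity of \<open>C\<close> allows errors to be scaled into the unit ball.\<close>

definition local_linearization :: "(nat \<Rightarrow> 'a \<Rightarrow> complex) \<Rightarrow> (nat \<Rightarrow> 'a \<Rightarrow> complex) \<Rightarrow> real \<Rightarrow> bool" where
  "local_linearization v w C \<longleftrightarrow> C > 0 \<and>
     (\<forall>k. w k \<in> borel_measurable M \<and> supp_subset M (w k) (v k)) \<and>
     (\<forall>N a. (\<lambda>t. \<Omega> (\<lambda>t. \<Sum>k<N. a k * v k t) t - (\<Sum>k<N. a k * w k t)) \<in> carr X \<and>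
        nrm X (\<lambda>t. \<Omega> (\<lambda>t. \<Sum>k<N. a k * v k t) t - (\<Sum>k<N. a k * w k t))
          \<le> C * nrm X (\<lambda>t. \<Sum>k<N. a k * v k t))"

end

text \<open>Sign patterns are indexed by their sets of negative positions, so that an average over
  patterns is a sum over a power set.\<close>

definition set_sign :: "nat set \<Rightarrow> nat \<Rightarrow> complex" where
  "set_sign S k = (if k \<in> S then -1 else 1)"

lemma set_sign_cases: "set_sign S k \<in> {-1, 1}"
  by (simp add: set_sign_def)

text \<open>For \<open>i \<noteq> j\<close>, toggling membership of \<open>i\<close> is an
  involution of the power set that negates the product.\<close>

lemma set_sign_orthogonal:
  assumes A: "finite A" and i: "i \<in> A"
  shows "(\<Sum>S\<in>Pow A. set_sign S i * set_sign S j) = (if i = j then 2 ^ card A else 0)"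
proof (cases "i = j")
  case True
  have "set_sign S j * set_sign S j = 1" for S by (simp add: set_sign_def)
  then show ?thesis using True A by (simp add: card_Pow)
next
  case False
  let ?t = "\<lambda>S. (S - {i}) \<union> ({i} - S)"
  have tt: "?t (?t S) = S" and tP: "S \<in> Pow A \<Longrightarrow> ?t S \<in> Pow A" for S using i by auto
  have "(\<Sum>S\<in>Pow A. set_sign S i * set_sign S j) = (\<Sum>S\<in>Pow A. set_sign (?t S) i * set_sign (?t S) j)"
    by (rule sum.reindex_bij_witness[of _ ?t ?t]) (use tP in \<open>simp_all only: tt\<close>)
  also have "\<dots> = (\<Sum>S\<in>Pow A. - (set_sign S i * set_sign S j))"
    using False by (intro sum.cong) (auto simp: set_sign_def)
  finally show ?thesis using False by (simp add: sum_negf)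
qed

context centralizer
begin

text \<open>Averaging a linear approximation \<open>l\<close> over sign changes on the supports of the \<open>v k\<close> kills the
  part of \<open>l (v k)\<close> outside the support of \<open>v k\<close>, since \<open>\<Omega>\<close> commutes with these sign changes.\<close>

theorem trivial_imp_local_linearization:
  assumes triv: "trivial_on M X \<Omega> V" and v: "disjoint_seq M X v"
    and V: "\<And>N a. (\<lambda>t. \<Sum>k<N. a k * v k t) \<in> V"
  shows "\<exists>w C. local_linearization v w C"
proof -
  interpret V: disjoint_span M X v by unfold_locales (rule v)
  obtain l C0 where lm: "\<And>x. x \<in> V \<Longrightarrow> l x \<in> borel_measurable M"
    and ladd: "\<And>x y. x \<in> V \<Longrightarrow> y \<in> V \<Longrightarrow> AE t in M. l (\<lambda>t. x t + y t) t = l x t + l y t"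
    and lmult: "\<And>c x. x \<in> V \<Longrightarrow> AE t in M. l (\<lambda>t. c * x t) t = c * l x t"
    and lX: "\<And>x. x \<in> V \<Longrightarrow> (\<lambda>t. \<Omega> x t - l x t) \<in> carr X"
    and lC: "\<And>x. x \<in> V \<Longrightarrow> nrm X (\<lambda>t. \<Omega> x t - l x t) \<le> C0 * nrm X x"
    using triv unfolding trivial_on_def ae_eq_def by (elim exE conjE) (blast dest: PiE)
  have vV: "v k \<in> V" for k
  proof -
    have "(\<Sum>j<Suc k. (if j = k then 1 else 0) * v j t) = v k t" for t by simp
    then show ?thesis using V[where N="Suc k" and a="\<lambda>j. if j = k then 1 else 0"] by simp
  qed
  have l_sum: "AE t in M. l (\<lambda>t. \<Sum>k<N. a k * v k t) t = (\<Sum>k<N. a k * l (v k) t)" for N a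
  proof (induction N)
    case 0
    show ?case using lmult[OF vV[of 0], of 0] by simp
  next
    case (Suc N)
    have "(\<lambda>t. a N * v N t) \<in> V"
      using V[where N="Suc N" and a="\<lambda>k. if k = N then a N else 0"] by (simp add: if_distrib[of "\<lambda>c. c * _"] cong: if_cong)
    from ladd[OF V[where N=N and a=a] this] lmult[OF vV, of "a N" N] Suc.IH
    show ?case by (simp, eventually_elim) simp
  qed
  define w where "w k t = (if v k t = 0 then 0 else l (v k) t)" for k t
  have [measurable]: "v k \<in> borel_measurable M" "l (v k) \<in> borel_measurable M" for k
    using X.measurable_carr[OF V.u_carr] lm[OF vV] by auto
  have wm: "w k \<in> borel_measurable M" for k unfolding w_def by measurable
  define C where "C = max C0 1"
  have main: "(\<lambda>t. \<Omega> (\<lambda>t. \<Sum>k<N. a k * v k t) t - (\<Sum>k<N. a k * w k t)) \<in> carr X \<and>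
      nrm X (\<lambda>t. \<Omega> (\<lambda>t. \<Sum>k<N. a k * v k t) t - (\<Sum>k<N. a k * w k t))
        \<le> C * nrm X (\<lambda>t. \<Sum>k<N. a k * v k t)" for N a
  proof -
    define x where "x t = (\<Sum>k<N. a k * v k t)" for t
    have x: "x \<in> carr X" unfolding x_def by simp
    \<comment> \<open>The number of the block containing \<open>t\<close>. The extra label
      \<open>N\<close> collects the points outside the first \<open>N\<close> supports, and the
      averaging runs over subsets of \<open>{..N}\<close> so that it also separates this remainder
      from all \<open>k < N\<close>.\<close>
    define b where "b t = (if V.block t < N \<and> v (V.block t) t \<noteq> 0 then V.block t else N)" for t
    have [measurable]: "V.block \<in> measurable M (count_space UNIV)" by (rule V.block_measurable)
    have "(\<lambda>t. v (V.block t) t) \<in> borel_measurable M"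
      by (rule measurable_compose_countable[where g=V.block and f=v]) measurable
    then have bm: "b \<in> measurable M (count_space UNIV)" unfolding b_def by measurable
    have bN: "b t \<in> {..N}" for t by (simp add: b_def)
    define \<epsilon> where "\<epsilon> S t = set_sign S (b t)" for S t
    have \<epsilon>m: "\<epsilon> S \<in> borel_measurable M" for S
      unfolding \<epsilon>_def by (rule measurable_compose[OF bm]) simp
    have \<epsilon>1: "\<epsilon> S t \<in> {-1, 1}" for S t unfolding \<epsilon>_def by (rule set_sign_cases)
    have \<epsilon>2: "\<epsilon> S t * \<epsilon> S t = 1" for S t using \<epsilon>1[of S t] by auto
    have \<epsilon>n: "cmod (\<epsilon> S t) \<le> 1" for S t using \<epsilon>1[of S t] by auto
    define y where "y S t = (\<Sum>k<N. set_sign S k * a k * v k t)" for S t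
    have y: "y S \<in> V" "y S \<in> carr X" for S
      unfolding y_def using V[where N=N and a="\<lambda>k. set_sign S k * a k"] by auto
    have AE_b: "AE t in M. \<forall>k<N. v k t \<noteq> 0 \<longleftrightarrow> b t = k"
      using V.AE_block by eventually_elim (auto simp: b_def)
    have AE_y: "AE t in M. y S t = \<epsilon> S t * x t" for S
      using AE_b
    proof eventually_elim
      case (elim t)
      have "set_sign S k * a k * v k t = \<epsilon> S t * (a k * v k t)" if "k < N" for k
        using elim that by (cases "v k t = 0") (auto simp: \<epsilon>_def)
      then show ?case unfolding y_def x_def sum_distrib_left by (intro sum.cong) auto
    qed
    have \<epsilon>x: "(\<lambda>t. \<epsilon> S t * x t) \<in> carr X" for S
      using X.mult_bounded(1)[OF \<epsilon>m _ x] \<epsilon>n by simp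
    have y_le: "nrm X (y S) \<le> nrm X x" for S
      using X.ae_cong(2)[OF X.measurable_carr[OF y(2)] \<epsilon>x AE_y] X.mult_bounded(2)[OF \<epsilon>m _ x] \<epsilon>n by simp
    \<comment> \<open>Since \<open>y S\<close> is \<open>\<epsilon> S * x\<close>, undoing the sign
      turns \<open>\<Omega> (y S)\<close> back into \<open>\<Omega> x\<close>, while the terms of
      \<open>l\<close> acquire the products of signs to be averaged.\<close>
    define r where "r S t = \<epsilon> S t * (\<Omega> (y S) t - l (y S) t)" for S t
    have r: "r S \<in> carr X" "nrm X (r S) \<le> C * nrm X x" for S
    proof -
      show "r S \<in> carr X" unfolding r_def using X.mult_bounded(1)[OF \<epsilon>m _ lX[OF y(1)]] \<epsilon>n by simp
      have "nrm X (r S) \<le> nrm X (\<lambda>t. \<Omega> (y S) t - l (y S) t)"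
        unfolding r_def using X.mult_bounded(2)[OF \<epsilon>m _ lX[OF y(1)]] \<epsilon>n by simp
      also have "\<dots> \<le> C0 * nrm X (y S)" by (rule lC[OF y(1)])
      also have "\<dots> \<le> C * nrm X (y S)" using y(2) by (intro mult_right_mono) (auto simp: C_def)
      also have "\<dots> \<le> C * nrm X x" using y_le by (intro mult_left_mono) (auto simp: C_def)
      finally show "nrm X (r S) \<le> C * nrm X x" .
    qed
    have AE_r: "AE t in M. r S t = \<Omega> x t - (\<Sum>k<N. \<epsilon> S t * set_sign S k * (a k * l (v k) t))" for S
      using \<Omega>_cong[OF y(2)[of S] \<epsilon>x[of S] AE_y[of S]] \<Omega>_sign[OF \<epsilon>m[of S] \<epsilon>1[of S] x] l_sum[where N=N and a="\<lambda>k. set_sign S k * a k"]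
    proof eventually_elim
      case (elim t)
      have "l (y S) t = (\<Sum>k<N. set_sign S k * a k * l (v k) t)" using elim(3) unfolding y_def .
      then have "r S t = (\<epsilon> S t * \<epsilon> S t) * \<Omega> x t - \<epsilon> S t * (\<Sum>k<N. set_sign S k * a k * l (v k) t)"
        unfolding r_def using elim(1,2) by (simp add: right_diff_distrib mult.assoc)
      then show ?case unfolding \<epsilon>2 sum_distrib_left by (simp add: mult.assoc)
    qed
    let ?P = "Pow {..N}"
    define n where "n = (2::real) ^ Suc N"
    have cP: "card ?P = 2 ^ Suc N" by (simp add: card_Pow)
    define R where "R t = (\<Sum>S\<in>?P. r S t) / of_real n" for t
    have RX: "R \<in> carr X" unfolding R_def using r by simp
    have R_le: "nrm X R \<le> C * nrm X x"
    proof -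
      have "nrm X R = nrm X (\<lambda>t. \<Sum>S\<in>?P. r S t) / n"
        unfolding R_def using X.nrm_divide[of "\<lambda>t. \<Sum>S\<in>?P. r S t" "of_real n"] r by (simp add: n_def norm_power norm_mult)
      also have "\<dots> \<le> (\<Sum>S\<in>?P. nrm X (r S)) / n"
        using r by (intro divide_right_mono X.nrm_sum) (auto simp: n_def)
      also have "\<dots> \<le> (\<Sum>S\<in>?P. C * nrm X x) / n"
        using r by (intro divide_right_mono sum_mono) (auto simp: n_def)
      also have "\<dots> = C * nrm X x" using cP by (simp add: n_def)
      finally show ?thesis .
    qed
    have "AE t in M. \<forall>S\<in>?P. r S t = \<Omega> x t - (\<Sum>k<N. \<epsilon> S t * set_sign S k * (a k * l (v k) t))"
      by (rule AE_finite_allI) (use AE_r in auto)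
    then have AE_R: "AE t in M. \<Omega> x t - (\<Sum>k<N. a k * w k t) = R t"
      using AE_b
    proof eventually_elim
      case (elim t)
      \<comment> \<open>At a point of block \<open>b t\<close> the average keeps only the term with
        \<open>k = b t\<close>, which is the restriction of \<open>l (v k)\<close> to the support of
        \<open>v k\<close>.\<close>
      have orth: "(\<Sum>S\<in>?P. \<epsilon> S t * set_sign S k) = (if b t = k then of_real n else 0)" for k
        unfolding \<epsilon>_def using set_sign_orthogonal[of "{..N}" "b t" k] bN[of t] by (simp add: n_def)
      have "(\<Sum>S\<in>?P. r S t) = (\<Sum>S\<in>?P. \<Omega> x t - (\<Sum>k<N. \<epsilon> S t * set_sign S k * (a k * l (v k) t)))"
        using elim(1) by (intro sum.cong) auto
      also have "\<dots> = of_real n * \<Omega> x t - (\<Sum>k<N. (\<Sum>S\<in>?P. \<epsilon> S t * set_sign S k) * (a k * l (v k) t))"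
        unfolding sum_subtractf sum_distrib_right by (subst (2) sum.swap) (simp add: cP n_def)
      also have "(\<Sum>k<N. (\<Sum>S\<in>?P. \<epsilon> S t * set_sign S k) * (a k * l (v k) t)) = (\<Sum>k<N. of_real n * (a k * w k t))"
        unfolding orth using elim(2) by (intro sum.cong) (auto simp: w_def)
      finally have "(\<Sum>S\<in>?P. r S t) = of_real n * (\<Omega> x t - (\<Sum>k<N. a k * w k t))"
        by (simp add: sum_distrib_left right_diff_distrib)
      then show ?case by (simp add: R_def n_def)
    qed
    have "(\<lambda>t. \<Omega> x t - (\<Sum>k<N. a k * w k t)) \<in> borel_measurable M"
      using Z.measurable_carr[OF \<Omega>_carr[OF x]] wm by measurable
    from X.ae_cong[OF this RX AE_R] R_le
    have "(\<lambda>t. \<Omega> x t - (\<Sum>k<N. a k * w k t)) \<in> carr X \<and>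
        nrm X (\<lambda>t. \<Omega> x t - (\<Sum>k<N. a k * w k t)) \<le> C * nrm X x" by simp
    then show ?thesis unfolding x_def .
  qed
  have "local_linearization v w C"
    unfolding local_linearization_def supp_subset_def using main wm by (auto simp: C_def w_def)
  then show ?thesis by blast
qed

end

text \<open>Lets triviality on the span of \<open>u\<close> be used for a selection
  \<open>u (k j)\<close>: the coefficients are collected according to the index in
  \<open>u\<close>.\<close>

lemma combination_in_closed_span:
  assumes "seminormed X" and u: "\<And>k. u k \<in> carr X"
  shows "(\<lambda>t. \<Sum>j<(N::nat). a j * u (k j) t) \<in> closed_span X u"
proof -
  interpret seminormed X by fact
  define N' where "N' = Suc (\<Sum>j<N. k j)"
  define c where "c i = (\<Sum>j<N. if k j = i then a j else 0)" for i
  have kN: "k j < N'" if "j < N" for j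
    unfolding N'_def less_Suc_eq_le by (rule member_le_sum) (use that in auto)
  have "(\<Sum>i<N'. c i * u i t) = (\<Sum>j<N. a j * u (k j) t)" for t
  proof -
    have "(\<Sum>i<N'. c i * u i t) = (\<Sum>j<N. \<Sum>i<N'. if k j = i then a j * u i t else 0)"
      unfolding c_def sum_distrib_right by (subst sum.swap) (intro sum.cong refl, simp)
    also have "\<dots> = (\<Sum>j<N. a j * u (k j) t)"
      using kN by (intro sum.cong) auto
    finally show ?thesis .
  qed
  then have "nrm X (\<lambda>t. (\<Sum>j<N. a j * u (k j) t) - (\<Sum>i<N'. c i * u i t)) = 0" by simp
  moreover have "(\<lambda>t. \<Sum>j<N. a j * u (k j) t) \<in> carr X" using u by simp
  ultimately show ?thesis unfolding closed_span_def by (auto intro!: exI[of _ N'] exI[of _ c])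
qed

section \<open>Passing to successive vectors\<close>

text \<open>All vectors are cut by one and the same function \<open>h\<close>, and not separately,
  because \<open>\<Omega>\<close> is compatible with a multiplier with values 0 and 1. The reverse
  norm estimate is what carries a linear approximation to the cut vectors.\<close>

lemma gliding_hump:
  assumes X: "unconditional_basis_space M X" and u: "disjoint_seq M X u"
  obtains k h where "inj k" "\<And>i. h i \<in> {0, 1}" "successive_seq M X (\<lambda>j i. h i * u (k j) i)"
    "\<And>N a. nrm X (\<lambda>i. \<Sum>j<N. a j * u (k j) i) \<le> 2 * nrm X (\<lambda>i. \<Sum>j<N. a j * (h i * u (k j) i))"
proof -
  have M: "M = count_space UNIV" and "koethe_space M X"
    and tail: "\<And>x. x \<in> carr X \<Longrightarrow> (\<lambda>N. nrm X (\<lambda>i. x i - (if i < N then x i else 0))) \<longlonglongrightarrow> 0"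
    using X by (auto simp: unconditional_basis_space_def)
  interpret koethe M X by unfold_locales fact
  have uX [simp]: "u k \<in> carr X" for k using u by (simp add: disjoint_seq_def)
  have disj: "u j i = 0 \<or> u k i = 0" if "j \<noteq> k" for i j k
    using u that by (simp add: disjoint_seq_def M AE_count_space)
  have u_pos: "nrm X (u k) > 0" for k
  proof -
    have "\<not> (AE i in M. u k i = 0)" using u by (auto simp: disjoint_seq_def ae_eq_def)
    then have "nrm X (u k) \<noteq> 0" using nrm_eq_0_iff[OF uX] by blast
    with nrm_nonneg[OF uX[of k]] show ?thesis by linarith
  qed
  have cut: "(\<lambda>i. if P i then x i else 0) \<in> carr X" if "x \<in> carr X" for x P
    using ideal(1)[OF _ that, of "\<lambda>i. if P i then x i else 0"] by (auto simp: M)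
  let ?tail = "\<lambda>n x i. if i < n then 0 else x i :: complex"
  have "\<exists>k n'. n < n' \<and> (\<forall>i<n. u k i = 0) \<and> nrm X (?tail n' (u k)) \<le> (1/2)^(j + 2) * nrm X (u k)" for j n
  proof -
    \<comment> \<open>Disjointness allows at most one nonzero vector at each coordinate. Hence only
      finitely many vectors meet \<open>{..<n}\<close>, and another one vanishes there
      exactly.\<close>
    have "finite {k. u k i \<noteq> 0}" for i
    proof (cases "\<exists>k. u k i \<noteq> 0")
      case True
      then obtain k where k: "u k i \<noteq> 0" by blast
      then have "{k. u k i \<noteq> 0} \<subseteq> {k}" using disj by blast
      then show ?thesis by (rule finite_subset) simp
    qed simp
    then have "finite (\<Union>i<n. {k. u k i \<noteq> 0})" by simp
    then obtain k where "k \<notin> (\<Union>i<n. {k. u k i \<noteq> 0})"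
      using ex_new_if_finite[OF infinite_UNIV_nat] by blast
    then have k: "\<forall>i<n. u k i = 0" by auto
    have "(\<lambda>i. u k i - (if i < n' then u k i else 0)) = ?tail n' (u k)" for n' by auto
    then have "(\<lambda>n'. nrm X (?tail n' (u k))) \<longlonglongrightarrow> 0" using tail[OF uX, of k] by simp
    then have "\<forall>\<^sub>F n' in sequentially. nrm X (?tail n' (u k)) < (1/2)^(j + 2) * nrm X (u k)"
      by (rule order_tendstoD(2)) (use u_pos in simp)
    then obtain n' where "n < n'" "nrm X (?tail n' (u k)) < (1/2)^(j + 2) * nrm X (u k)"
      using eventually_conj[OF _ eventually_gt_at_top[of n]] eventually_happens'[OF sequentially_bot] by blast
    with k show ?thesis by (intro exI[of _ k] exI[of _ n']) auto
  qed
  then have "\<forall>j n. \<exists>k n'. n < n' \<and> (\<forall>i<n. u k i = 0) \<and> nrm X (?tail n' (u k)) \<le> (1/2)^(j + 2) * nrm X (u k)"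
    by blast
  then obtain kk nn where step: "\<And>j n. n < nn j n" "\<And>j n i. i < n \<Longrightarrow> u (kk j n) i = 0"
    "\<And>j n. nrm X (?tail (nn j n) (u (kk j n))) \<le> (1/2)^(j + 2) * nrm X (u (kk j n))"
    unfolding choice_iff by blast
  define ns where "ns = rec_nat 0 nn"
  define k where "k j = kk j (ns j)" for j
  have ns_Suc: "ns (Suc j) = nn j (ns j)" for j by (simp add: ns_def)
  have ns_mono: "strict_mono ns" using step(1) by (simp add: strict_mono_Suc_iff ns_Suc)
  have u_low: "u (k j) i = 0" if "i < ns j" for i j using step(2) that by (simp add: k_def)
  have u_tail: "nrm X (?tail (ns (Suc j)) (u (k j))) \<le> (1/2)^(j + 2) * nrm X (u (k j))" for j
    unfolding k_def ns_Suc by (rule step(3))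
  define v where "v j i = (if i < ns (Suc j) then u (k j) i else 0)" for j i
  define t where "t j i = (if i < ns (Suc j) then 0 else u (k j) i)" for j i
  have v_eq: "v j = (\<lambda>i. if i < ns (Suc j) then u (k j) i else 0)"
    and t_eq: "t j = (\<lambda>i. if \<not> i < ns (Suc j) then u (k j) i else 0)" for j
    by (auto simp: v_def t_def)
  have vX: "v j \<in> carr X" and tX: "t j \<in> carr X" for j
    unfolding v_eq t_eq by (intro cut uX)+
  have t_u: "nrm X (t j) \<le> (1/2)^(j + 2) * nrm X (u (k j))" for j
    using u_tail[of j] by (simp add: t_def[abs_def])
  \<comment> \<open>The removed tail has at most half the norm of \<open>u (k j)\<close>. One power
    of 1/2 is thereby spent on passing to \<open>v j\<close>; the remaining factors
    \<open>(1/2)^(j + 1)\<close> sum to less than 1, whence the constant 2 of the lemma.\<close>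
  have u_v: "nrm X (u (k j)) \<le> 2 * nrm X (v j)" for j
  proof -
    have "u (k j) = (\<lambda>i. v j i + t j i)" by (auto simp: v_def t_def)
    then have "nrm X (u (k j)) \<le> nrm X (v j) + nrm X (t j)" using nrm_add[OF vX tX, of j j] by simp
    moreover have "(1/2::real)^(j + 2) \<le> 1/2"
      using power_decreasing[of 1 "j + 2" "1/2::real"] by simp
    then have "(1/2)^(j + 2) * nrm X (u (k j)) \<le> 1/2 * nrm X (u (k j))"
      by (rule mult_right_mono) simp
    ultimately show ?thesis using t_u[of j] by linarith
  qed
  have t_v: "nrm X (t j) \<le> (1/2)^(j + 1) * nrm X (v j)" for j
  proof -
    have "nrm X (t j) \<le> (1/2)^(j + 2) * (2 * nrm X (v j))"
      using t_u[of j] u_v[of j] by (meson mult_left_mono order_trans zero_le_divide_1_iff zero_le_numeral zero_le_power)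
    then show ?thesis by (simp add: power_add mult.commute)
  qed
  have v_pos: "nrm X (v j) > 0" for j using u_v[of j] u_pos[of "k j"] by linarith
  have v_ne: "\<exists>i. v j i \<noteq> 0" for j
  proof (rule ccontr)
    assume "\<nexists>i. v j i \<noteq> 0"
    then have "v j = (\<lambda>_. 0)" by auto
    then show False using v_pos[of j] by simp
  qed
  have v_supp: "ns j \<le> i \<and> i < ns (Suc j) \<and> u (k j) i \<noteq> 0" if "v j i \<noteq> 0" for i j
    using that u_low[of i j] by (cases "i < ns j") (auto simp: v_def split: if_splits)
  have ns_le: "ns (Suc l) \<le> ns j" if "l < j" for l j
    using strict_mono_mono[OF ns_mono] that by (simp add: monoD Suc_leI)
  have "k l \<noteq> k j" if "l < j" for l j
  proof -
    obtain i where i: "v l i \<noteq> 0" using v_ne by blast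
    then have "i < ns j" "u (k l) i \<noteq> 0" using v_supp[OF i] ns_le[OF that] by auto
    then show ?thesis using u_low[of i j] by auto
  qed
  then have inj: "inj k" by (metis injI linorder_neqE_nat)
  \<comment> \<open>The indicator of the union of all kept pieces. It cuts each
    \<open>u (k j)\<close> exactly to \<open>v j\<close>, since the other kept pieces lie in
    supports disjoint from that of \<open>u (k j)\<close>.\<close>
  define h :: "nat \<Rightarrow> complex" where "h i = (if \<exists>j. v j i \<noteq> 0 then 1 else 0)" for i
  have hu: "h i * u (k j) i = v j i" for i j
  proof (cases "v j i = 0")
    case False
    then show ?thesis by (auto simp: h_def v_def split: if_splits)
  next
    case True
    have "h i = 0" if ne: "u (k j) i \<noteq> 0"
    proof -
      have "v l i = 0" for l
      proof (rule ccontr)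
        assume l: "v l i \<noteq> 0"
        then have "k l = k j" using v_supp[OF l] disj[of "k l" "k j" i] ne by auto
        then have "l = j" using inj by (simp add: inj_eq)
        then show False using l True by simp
      qed
      then show ?thesis by (simp add: h_def)
    qed
    then show ?thesis using True by (cases "u (k j) i = 0") auto
  qed
  have succ: "successive_seq M X v"
    unfolding successive_seq_def
  proof (intro conjI allI impI)
    show "v j \<in> carr X" for j by (rule vX)
    show "\<not> ae_eq M (v j) (\<lambda>_. 0)" for j
      using v_pos[of j] nrm_eq_0_iff[OF vX, of j] by (simp add: ae_eq_def)
    fix j l s r assume "j < l \<and> v j s \<noteq> 0 \<and> v l r \<noteq> 0"
    then show "s < r" using v_supp[of j s] v_supp[of l r] ns_le[of j l] by linarith
  qed
  have bound: "nrm X (\<lambda>i. \<Sum>j<N. a j * u (k j) i) \<le> 2 * nrm X (\<lambda>i. \<Sum>j<N. a j * v j i)" for N a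
  proof -
    define x where "x i = (\<Sum>j<N. a j * v j i)" for i
    have x: "x \<in> carr X" unfolding x_def using vX by simp
    \<comment> \<open>A single term is dominated pointwise by the whole combination, so the error
      \<open>a j * t j\<close> is bounded by a multiple of the norm of \<open>x\<close>.\<close>
    have coeff: "cmod (a j) * nrm X (v j) \<le> nrm X x" if j: "j < N" for j
    proof -
      have "cmod (a j * v j i) \<le> cmod (x i)" for i
      proof (cases "v j i = 0")
        case False
        have "v l i = 0" if "l \<noteq> j" for l
          using disj[of "k l" "k j" i] inj that v_supp[OF False] by (auto simp: inj_eq v_def)
        then have "x i = (\<Sum>l<N. if l = j then a j * v j i else 0)"
          unfolding x_def by (intro sum.cong) auto
        then show ?thesis using j by simp
      qed simp
      then have "nrm X (\<lambda>i. a j * v j i) \<le> nrm X x"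
        using ideal(2)[OF _ x, of "\<lambda>i. a j * v j i"] by (simp add: M)
      then show ?thesis using vX by (simp add: nrm_cmult)
    qed
    have "(\<lambda>i. \<Sum>j<N. a j * u (k j) i) = (\<lambda>i. x i + (\<Sum>j<N. a j * t j i))"
      unfolding x_def sum.distrib[symmetric] distrib_left[symmetric]
      by (intro ext sum.cong) (auto simp: v_def t_def)
    then have "nrm X (\<lambda>i. \<Sum>j<N. a j * u (k j) i) \<le> nrm X x + nrm X (\<lambda>i. \<Sum>j<N. a j * t j i)"
      using nrm_add[OF x, of "\<lambda>i. \<Sum>j<N. a j * t j i"] tX by simp
    also have "nrm X (\<lambda>i. \<Sum>j<N. a j * t j i) \<le> (\<Sum>j<N. nrm X (\<lambda>i. a j * t j i))"
      using tX by (intro nrm_sum) simp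
    also have "\<dots> \<le> (\<Sum>j<N. (1/2)^(j + 1) * nrm X x)"
    proof (rule sum_mono)
      fix j assume "j \<in> {..<N}"
      then have j: "j < N" by simp
      have "nrm X (\<lambda>i. a j * t j i) \<le> cmod (a j) * ((1/2)^(j + 1) * nrm X (v j))"
        unfolding nrm_cmult[OF tX] using t_v by (intro mult_left_mono) auto
      also have "\<dots> = (1/2)^(j + 1) * (cmod (a j) * nrm X (v j))" by simp
      also have "\<dots> \<le> (1/2)^(j + 1) * nrm X x" using coeff[OF j] by (intro mult_left_mono) auto
      finally show "nrm X (\<lambda>i. a j * t j i) \<le> (1/2)^(j + 1) * nrm X x" .
    qed
    also have "\<dots> = (\<Sum>j<N. (1/2)^(j + 1)) * nrm X x" by (simp add: sum_distrib_right)
    also have "(\<Sum>j<N. (1/2::real)^(j + 1)) = 1 - (1/2)^N" by (induction N) auto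
    also have "(1 - (1/2)^N) * nrm X x \<le> 1 * nrm X x" using x by (intro mult_right_mono) auto
    finally show ?thesis unfolding x_def by simp
  qed
  have h01: "h i \<in> {0, 1}" for i by (simp add: h_def)
  show ?thesis
    by (rule that[of k h, unfolded hu, OF inj h01 succ bound])
qed

context centralizer
begin

text \<open>With \<open>\<epsilon> = 2 h - 1\<close>, which takes the values 1 and -1, \<open>h y\<close> is the sum of \<open>y / 2\<close> and \<open>\<epsilon> y / 2\<close>.
  Quasilinearity therefore yields \<open>\<Omega> (h y) \<approx> h \<Omega> y\<close>.\<close>

lemma local_linearization_restrict:
  assumes lin: "local_linearization u w C" and u: "\<And>j. u j \<in> carr X"
    and h: "h \<in> borel_measurable M" "\<And>t. h t \<in> {0, 1}"
    and le: "\<And>N a. nrm X (\<lambda>t. \<Sum>j<N. a j * u j t) \<le> D * nrm X (\<lambda>t. \<Sum>j<N. a j * (h t * u j t))"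
    and D: "D > 0"
  shows "\<exists>C'. local_linearization (\<lambda>j t. h t * u j t) (\<lambda>j t. h t * w j t) C'"
proof -
  obtain K where K: "K \<ge> 0"
    and qX: "\<And>x y. x \<in> carr X \<Longrightarrow> y \<in> carr X \<Longrightarrow> (\<lambda>t. \<Omega> x t + \<Omega> y t - \<Omega> (\<lambda>t. x t + y t) t) \<in> carr X"
    and q: "\<And>x y. x \<in> carr X \<Longrightarrow> y \<in> carr X \<Longrightarrow>
      nrm X (\<lambda>t. \<Omega> x t + \<Omega> y t - \<Omega> (\<lambda>t. x t + y t) t) \<le> K * (nrm X x + nrm X y)"
    by (rule quasilinear) blast
  have C: "C > 0" and wm: "\<And>k. w k \<in> borel_measurable M" and ws: "\<And>k. supp_subset M (w k) (u k)"
    and lX: "\<And>N a. (\<lambda>t. \<Omega> (\<lambda>t. \<Sum>k<N. a k * u k t) t - (\<Sum>k<N. a k * w k t)) \<in> carr X"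
    and l: "\<And>N a. nrm X (\<lambda>t. \<Omega> (\<lambda>t. \<Sum>k<N. a k * u k t) t - (\<Sum>k<N. a k * w k t))
        \<le> C * nrm X (\<lambda>t. \<Sum>k<N. a k * u k t)"
    using lin by (auto simp: local_linearization_def)
  have h1: "cmod (h t) \<le> 1" for t using h(2)[of t] by auto
  have main: "(\<lambda>t. \<Omega> (\<lambda>t. \<Sum>k<N. a k * (h t * u k t)) t - (\<Sum>k<N. a k * (h t * w k t))) \<in> carr X \<and>
      nrm X (\<lambda>t. \<Omega> (\<lambda>t. \<Sum>k<N. a k * (h t * u k t)) t - (\<Sum>k<N. a k * (h t * w k t)))
        \<le> ((K + C) * D) * nrm X (\<lambda>t. \<Sum>k<N. a k * (h t * u k t))" for N a
  proof -
    define y where "y t = (\<Sum>k<N. a k * u k t)" for t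
    define x where "x t = (\<Sum>k<N. a k * (h t * u k t))" for t
    have y: "y \<in> carr X" unfolding y_def using u by simp
    have xy: "x t = h t * y t" for t unfolding x_def y_def by (simp add: sum_distrib_left mult.left_commute)
    define \<epsilon> where "\<epsilon> t = 2 * h t - 1" for t
    have \<epsilon>m: "\<epsilon> \<in> borel_measurable M" unfolding \<epsilon>_def using h(1) by measurable
    have \<epsilon>1: "\<epsilon> t \<in> {-1, 1}" for t using h(2)[of t] by (auto simp: \<epsilon>_def)
    have \<epsilon>n: "cmod (\<epsilon> t) \<le> 1" for t using \<epsilon>1[of t] by auto
    define y1 where "y1 t = 1/2 * y t" for t
    define y2 where "y2 t = \<epsilon> t * y1 t" for t
    have y1: "y1 \<in> carr X" "nrm X y1 = 1/2 * nrm X y"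
      unfolding y1_def using y X.nrm_cmult[OF y, of "1/2"] by simp_all
    have y2: "y2 \<in> carr X" "nrm X y2 \<le> 1/2 * nrm X y"
      unfolding y2_def using X.mult_bounded[OF \<epsilon>m _ y1(1)] \<epsilon>n y1(2) by auto
    have x12: "x = (\<lambda>t. y1 t + y2 t)"
      by (rule ext) (simp add: xy y1_def y2_def \<epsilon>_def algebra_simps)
    have x: "x \<in> carr X" unfolding x12 using y1 y2 by simp
    \<comment> \<open>The two sources of error: \<open>p\<close> is the defect of additivity for
      \<open>x = y1 + y2\<close>, and \<open>r\<close> is the given linearization error of
      \<open>y\<close> multiplied by \<open>h\<close>.\<close>
    define p where "p t = \<Omega> y1 t + \<Omega> y2 t - \<Omega> x t" for t
    define r where "r t = h t * (\<Omega> y t - (\<Sum>k<N. a k * w k t))" for t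
    have p: "p \<in> carr X" "nrm X p \<le> K * nrm X y"
    proof -
      show "p \<in> carr X" unfolding p_def x12 by (rule qX[OF y1(1) y2(1)])
      have "nrm X p \<le> K * (nrm X y1 + nrm X y2)" unfolding p_def x12 by (rule q[OF y1(1) y2(1)])
      also have "\<dots> \<le> K * nrm X y" using y1(2) y2(2) K by (intro mult_left_mono) auto
      finally show "nrm X p \<le> K * nrm X y" .
    qed
    have r: "r \<in> carr X" "nrm X r \<le> C * nrm X y"
      unfolding r_def using X.mult_bounded[OF h(1) _ lX[where N=N and a=a]] h1 l[where N=N and a=a]
      by (auto simp: y_def[symmetric] intro: order_trans)
    have "AE t in M. \<Omega> x t - (\<Sum>k<N. a k * (h t * w k t)) = r t - p t"
      using \<Omega>_cmult[OF y, of "1/2"] \<Omega>_sign[OF \<epsilon>m \<epsilon>1 y1(1)]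
    proof eventually_elim
      case (elim t)
      have "\<Omega> y1 t = 1/2 * \<Omega> y t" "\<Omega> y2 t = \<epsilon> t * \<Omega> y1 t"
        using elim by (simp_all add: y1_def[abs_def] y2_def[abs_def])
      then have "p t = h t * \<Omega> y t - \<Omega> x t" by (simp add: p_def \<epsilon>_def algebra_simps)
      moreover have "(\<Sum>k<N. a k * (h t * w k t)) = h t * (\<Sum>k<N. a k * w k t)"
        by (simp add: sum_distrib_left mult.left_commute)
      ultimately show ?case by (simp add: r_def algebra_simps)
    qed
    moreover have "(\<lambda>t. \<Omega> x t - (\<Sum>k<N. a k * (h t * w k t))) \<in> borel_measurable M"
      using Z.measurable_carr[OF \<Omega>_carr[OF x]] wm h(1) by measurable
    ultimately have
      "(\<lambda>t. \<Omega> x t - (\<Sum>k<N. a k * (h t * w k t))) \<in> carr X"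
      "nrm X (\<lambda>t. \<Omega> x t - (\<Sum>k<N. a k * (h t * w k t))) = nrm X (\<lambda>t. r t - p t)"
      using X.ae_cong[of _ "\<lambda>t. r t - p t"] r(1) p(1) by simp_all
    moreover have "nrm X (\<lambda>t. r t - p t) \<le> ((K + C) * D) * nrm X x"
    proof -
      have "nrm X (\<lambda>t. r t - p t) \<le> (K + C) * nrm X y"
        using X.nrm_diff[OF r(1) p(1)] r(2) p(2) by (simp add: algebra_simps)
      \<comment> \<open>Both errors are measured by the uncut vector \<open>y\<close>; the
        assumption \<open>le\<close> converts its norm into that of \<open>x\<close>.\<close>
      also have "\<dots> \<le> (K + C) * (D * nrm X x)"
        using le[where N=N and a=a] K C by (intro mult_left_mono) (auto simp: x_def[abs_def] y_def[abs_def])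
      finally show ?thesis by (simp add: mult.assoc)
    qed
    ultimately show ?thesis unfolding x_def by simp
  qed
  have "supp_subset M (\<lambda>t. h t * w k t) (\<lambda>t. h t * u k t)" for k
    using ws[of k] unfolding supp_subset_def by eventually_elim auto
  then have "local_linearization (\<lambda>j t. h t * u j t) (\<lambda>j t. h t * w j t) ((K + C) * D)"
    unfolding local_linearization_def using main wm h(1) K C D by auto
  then show ?thesis by blast
qed

end


section \<open>Growth of standard families\<close>

lemma list_all2_map_self:
  "(\<And>x. x \<in> set xs \<Longrightarrow> R (f x) (g x)) \<Longrightarrow> list_all2 R (map f xs) (map g xs)"
  by (simp add: list_all2_map1 list_all2_map2 list.rel_refl_strong)

lemma sum_list_sum_mult:
  fixes d :: "nat \<Rightarrow> complex"
  shows "(\<Sum>a\<leftarrow>as. \<Sum>k<N. a k * d k) = (\<Sum>k<N. (\<Sum>a\<leftarrow>as. a k) * d k)"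
  by (induction as) (simp_all add: distrib_right sum.distrib)

context seminormed
begin

text \<open>By the triangle inequality \<open>n\<close> vectors of the unit ball have a sum of norm
  at most \<open>n\<close>, which makes the real \<open>Sup\<close> a true supremum.\<close>

lemma growth_bdd:
  "bdd_above (insert 0 {nrm X (\<lambda>t. \<Sum>x\<leftarrow>xs. x t) | xs.
        xs \<in> F \<and> length xs = n \<and> (\<forall>x\<in>set xs. x \<in> carr X \<and> nrm X x \<le> 1)})"
proof (rule bdd_aboveI[of _ "real n"])
  fix r assume "r \<in> insert 0 {nrm X (\<lambda>t. \<Sum>x\<leftarrow>xs. x t) | xs.
        xs \<in> F \<and> length xs = n \<and> (\<forall>x\<in>set xs. x \<in> carr X \<and> nrm X x \<le> 1)}"
  then show "r \<le> real n"
    using nrm_sum_list[of _ 1] by fastforce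
qed

lemma growth_nonneg: "0 \<le> growth X F n"
  unfolding growth_def by (rule cSup_upper[OF insertI1 growth_bdd])

lemma growth_upper:
  assumes "xs \<in> F" "length xs = n" "\<And>x. x \<in> set xs \<Longrightarrow> x \<in> carr X \<and> nrm X x \<le> 1"
  shows "nrm X (\<lambda>t. \<Sum>x\<leftarrow>xs. x t) \<le> growth X F n"
  unfolding growth_def by (rule cSup_upper[OF _ growth_bdd]) (use assms in auto)

lemma growth_least:
  assumes "0 \<le> c" "\<And>xs. \<lbrakk>xs \<in> F; length xs = n; \<And>x. x \<in> set xs \<Longrightarrow> x \<in> carr X \<and> nrm X x \<le> 1\<rbrakk> \<Longrightarrow>
      nrm X (\<lambda>t. \<Sum>x\<leftarrow>xs. x t) \<le> c"
  shows "growth X F n \<le> c"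
  unfolding growth_def by (rule cSup_least) (use assms in auto)

text \<open>A common bound \<open>c\<close> is divided out to enter the unit ball. Membership is
  asked of the scaled family, since that is the one compared with the supremum; in the uses it
  follows from heredity.\<close>

lemma growth_scaled:
  assumes f: "\<And>x. x \<in> set xs \<Longrightarrow> f x \<in> carr X" "\<And>x. x \<in> set xs \<Longrightarrow> nrm X (f x) \<le> c" and c: "c > 0"
    and F: "map (\<lambda>x t. f x t / of_real c) xs \<in> F"
  shows "nrm X (\<lambda>t. \<Sum>x\<leftarrow>xs. f x t) \<le> c * growth X F (length xs)"
proof -
  have s: "(\<Sum>y\<leftarrow>map (\<lambda>x t. f x t / of_real c) xs. y t) = (\<Sum>x\<leftarrow>xs. f x t) / of_real c" for t
    by (induction xs) (simp_all add: add_divide_distrib)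
  have fX: "(\<lambda>t. \<Sum>x\<leftarrow>xs. f x t) \<in> carr X"
    using sum_list_carr[of "map f xs"] f by (auto simp: o_def)
  have "nrm X (\<lambda>t. \<Sum>y\<leftarrow>map (\<lambda>x t. f x t / of_real c) xs. y t) \<le> growth X F (length xs)"
  proof (rule growth_upper[OF F])
    fix y assume "y \<in> set (map (\<lambda>x t. f x t / of_real c) xs)"
    then obtain x where x: "x \<in> set xs" "y = (\<lambda>t. f x t / of_real c)" by auto
    then show "y \<in> carr X \<and> nrm X y \<le> 1"
      using f[OF x(1)] c by (simp add: nrm_divide divide_le_eq_1)
  qed simp
  then have "nrm X (\<lambda>t. \<Sum>x\<leftarrow>xs. f x t) / c \<le> growth X F (length xs)"
    unfolding s using nrm_divide[OF fX, of "of_real c"] c by simp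
  then show ?thesis using c by (simp add: field_simps)
qed

end

section \<open>The growth estimate for abstract families\<close>

context centralizer
begin

text \<open>The class enters only through its restrictions \<open>F0\<close>, \<open>F1\<close>,
  \<open>FX\<close>, \<open>TW\<close> and their closure properties, so that the Koethe and the
  basis settings are both instances. The estimate is first made for finite combinations, to which
  \<open>local_linearization\<close> applies; truncation then reaches all of the span.\<close>

theorem growth_estimate:
  fixes F0 F1 FX :: "('a \<Rightarrow> complex) list set" and TW :: "(nat \<Rightarrow> complex) list set"
  assumes v: "disjoint_seq M X v" and lin: "local_linearization v w C"
    and h0: "\<And>xs zs. \<lbrakk>xs \<in> FX; set zs \<subseteq> carr X0; list_all2 (supp_subset M) zs xs\<rbrakk> \<Longrightarrow> zs \<in> F0"
    and h1: "\<And>xs zs. \<lbrakk>xs \<in> FX; set zs \<subseteq> carr X1; list_all2 (supp_subset M) zs xs\<rbrakk> \<Longrightarrow> zs \<in> F1"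
    and hX: "\<And>xs zs. \<lbrakk>xs \<in> FX; set zs \<subseteq> carr X; list_all2 (supp_subset M) zs xs\<rbrakk> \<Longrightarrow> zs \<in> FX"
    and hT: "\<And>as bs. \<lbrakk>as \<in> TW; set bs \<subseteq> carr (span_space X v);
        list_all2 (supp_subset (count_space UNIV)) bs as\<rbrakk> \<Longrightarrow> bs \<in> TW"
    and lift: "\<And>as xs. \<lbrakk>as \<in> TW; list_all2 (expands X v) as xs\<rbrakk> \<Longrightarrow> xs \<in> FX"
  shows "\<exists>K. \<forall>n. \<bar>ln (growth X0 F0 n / growth X1 F1 n)\<bar> * growth (span_space X v) TW n
      \<le> K * (growth X0 F0 n powr (1 - \<theta>) * growth X1 F1 n powr \<theta>)"
proof -
  interpret V: disjoint_span M X v by unfold_locales (rule v)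
  interpret W: koethe "count_space UNIV" V.W by unfold_locales (rule V.span_koethe)
  obtain CB where CB: "CB > 0" "\<And>x. x \<in> carr X \<Longrightarrow> hnrm (B x) \<le> CB * nrm X x"
    by (rule B_bound) blast
  have C: "C > 0" and wm: "\<And>k. w k \<in> borel_measurable M" and ws: "\<And>k. supp_subset M (w k) (v k)"
    and lX: "\<And>N a. (\<lambda>t. \<Omega> (\<lambda>t. \<Sum>k<N. a k * v k t) t - (\<Sum>k<N. a k * w k t)) \<in> carr X"
    and l: "\<And>N a. nrm X (\<lambda>t. \<Omega> (\<lambda>t. \<Sum>k<N. a k * v k t) t - (\<Sum>k<N. a k * w k t))
        \<le> C * nrm X (\<lambda>t. \<Sum>k<N. a k * v k t)"
    using lin by (auto simp: local_linearization_def)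
  \<comment> \<open>The first term comes from \<open>centralizer_sum_estimate\<close>, the other two
    from the linearization errors: one from the sum of the errors of the members, one from the error
    of the sum.\<close>
  define K where "K = (CB + CB * CB) / min \<theta> (1 - \<theta>) + C * CB + C * CB"
  have K: "K \<ge> 0" unfolding K_def using CB C \<theta> by simp
  have sum_X: "nrm X (\<lambda>t. \<Sum>x\<leftarrow>xs. x t) \<le> CB * m"
    and sum_D: "(\<lambda>t. (\<Sum>x\<leftarrow>xs. \<Omega> x t) + of_real (ln (m0 / m1)) * (\<Sum>x\<leftarrow>xs. x t) - \<Omega> (\<lambda>t. \<Sum>x\<leftarrow>xs. x t) t) \<in> carr X"
      "nrm X (\<lambda>t. (\<Sum>x\<leftarrow>xs. \<Omega> x t) + of_real (ln (m0 / m1)) * (\<Sum>x\<leftarrow>xs. x t) - \<Omega> (\<lambda>t. \<Sum>x\<leftarrow>xs. x t) t)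
        \<le> (CB + CB * CB) / min \<theta> (1 - \<theta>) * m"
    if xs: "xs \<in> FX" "\<And>x. x \<in> set xs \<Longrightarrow> x \<in> carr X \<and> nrm X x \<le> 1"
      and m0: "m0 = growth X0 F0 (length xs)" "m0 > 0" and m1: "m1 = growth X1 F1 (length xs)" "m1 > 0"
      and m: "m = m0 powr (1 - \<theta>) * m1 powr \<theta>" for xs m0 m1 m
  proof -
    have sub: "set xs \<subseteq> carr X" using xs by auto
    have B_le: "hnrm (B x) \<le> CB" if "x \<in> set xs" for x
    proof -
      have "hnrm (B x) \<le> CB * nrm X x" using CB(2) xs(2)[OF that] by blast
      also have "\<dots> \<le> CB * 1" using xs(2)[OF that] CB(1) by (intro mult_left_mono) auto
      finally show ?thesis by simp
    qed
    have supp: "list_all2 (supp_subset M) (map (\<lambda>x t. B x z t / of_real CB) xs) xs" if "z \<in> strip" for z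
    proof -
      have "supp_subset M (\<lambda>t. B x z t / of_real CB) x" if x: "x \<in> set xs" for x
        using B_supp[of x z] xs(2)[OF x] \<open>z \<in> strip\<close> unfolding supp_subset_def
        by (auto elim!: eventually_mono)
      then show ?thesis using list_all2_map_self[of xs "supp_subset M" _ "\<lambda>x. x"] by simp
    qed
    have 0: "nrm X0 (\<lambda>t. \<Sum>x\<leftarrow>xs. B x (Complex 0 y) t) \<le> CB * m0" for y
      unfolding m0(1)
    proof (rule X0.growth_scaled[OF _ _ CB(1)])
      show "B x (Complex 0 y) \<in> carr X0" "nrm X0 (B x (Complex 0 y)) \<le> CB" if "x \<in> set xs" for x
        using calderonD(4)[OF B_H] le_hnrm(1)[OF B_H, of x y] B_le[OF that] xs(2)[OF that] by auto
      then show "map (\<lambda>x t. B x (Complex 0 y) t / of_real CB) xs \<in> F0"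
        by (intro h0[OF xs(1) _ supp]) auto
    qed
    have 1: "nrm X1 (\<lambda>t. \<Sum>x\<leftarrow>xs. B x (Complex 1 y) t) \<le> CB * m1" for y
      unfolding m1(1)
    proof (rule X1.growth_scaled[OF _ _ CB(1)])
      show "B x (Complex 1 y) \<in> carr X1" "nrm X1 (B x (Complex 1 y)) \<le> CB" if "x \<in> set xs" for x
        using calderonD(7)[OF B_H] le_hnrm(2)[OF B_H, of x y] B_le[OF that] xs(2)[OF that] by auto
      then show "map (\<lambda>x t. B x (Complex 1 y) t / of_real CB) xs \<in> F1"
        by (intro h1[OF xs(1) _ supp]) auto
    qed
    note E = centralizer_sum_estimate[OF sub m0(2) m1(2) CB(2) less_imp_le[OF CB(1)] 0 1]
    show "nrm X (\<lambda>t. \<Sum>x\<leftarrow>xs. x t) \<le> CB * m"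
      "(\<lambda>t. (\<Sum>x\<leftarrow>xs. \<Omega> x t) + of_real (ln (m0 / m1)) * (\<Sum>x\<leftarrow>xs. x t) - \<Omega> (\<lambda>t. \<Sum>x\<leftarrow>xs. x t) t) \<in> carr X"
      "nrm X (\<lambda>t. (\<Sum>x\<leftarrow>xs. \<Omega> x t) + of_real (ln (m0 / m1)) * (\<Sum>x\<leftarrow>xs. x t) - \<Omega> (\<lambda>t. \<Sum>x\<leftarrow>xs. x t) t)
        \<le> (CB + CB * CB) / min \<theta> (1 - \<theta>) * m"
      unfolding m using E by blast+
  qed
  define p where "p N a t = (\<Sum>k<N. a k * V.e k t)" for N and a :: "nat \<Rightarrow> complex" and t
  have finite_estimate: "\<bar>ln (m0 / m1)\<bar> * nrm X (\<lambda>t. \<Sum>a\<leftarrow>as. p N a t) \<le> K * m"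
    if as: "map (p N) as \<in> FX" "\<And>a. a \<in> set as \<Longrightarrow> nrm X (p N a) \<le> 1"
      and m0: "m0 = growth X0 F0 (length as)" "m0 > 0" and m1: "m1 = growth X1 F1 (length as)" "m1 > 0"
      and m: "m = m0 powr (1 - \<theta>) * m1 powr \<theta>" for as N m0 m1 m
  proof -
    define L where "L = ln (m0 / m1)"
    define q where "q a t = (\<Sum>k<N. a k * (w k t / of_real (nrm X (v k))))" for a :: "nat \<Rightarrow> complex" and t
    define r where "r a t = \<Omega> (p N a) t - q a t" for a t
    define s where "s k = (\<Sum>a\<leftarrow>as. a k)" for k
    have pX: "p N a \<in> carr X" for a unfolding p_def by simp
    have p_v: "p N a = (\<lambda>t. \<Sum>k<N. (a k / of_real (nrm X (v k))) * v k t)" for a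
      by (simp add: p_def V.e_def fun_eq_iff)
    have q_w: "q a = (\<lambda>t. \<Sum>k<N. (a k / of_real (nrm X (v k))) * w k t)" for a
      by (simp add: q_def fun_eq_iff)
    have r: "r a \<in> carr X" "nrm X (r a) \<le> C * nrm X (p N a)" for a
      unfolding r_def p_v q_w by (rule lX, rule l)
    \<comment> \<open>The support condition on \<open>w k\<close> pays off here. Where
      \<open>p N a\<close> vanishes, \<open>\<Omega> (p N a)\<close> does; and where
      \<open>w k\<close> is nonzero, \<open>v k\<close> is the only nonzero block, so the vanishing
      of \<open>p N a\<close> forces \<open>a k = 0\<close> for \<open>k < N\<close>.\<close>
    have r_supp: "supp_subset M (r a) (p N a)" for a
    proof -
      have "AE t in M. \<forall>k. w k t \<noteq> 0 \<longrightarrow> v k t \<noteq> 0"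
        using ws by (simp add: supp_subset_def AE_all_countable)
      then show ?thesis
        unfolding supp_subset_def using V.AE_disjoint \<Omega>_supp[OF pX, of a]
      proof eventually_elim
        case (elim t)
        show ?case
        proof (intro impI notI)
          assume rt: "r a t \<noteq> 0" and pt: "p N a t = 0"
          have "a k * (w k t / of_real (nrm X (v k))) = 0" if k: "k < N" for k
          proof (cases "w k t = 0")
            case False
            then have vk: "v k t \<noteq> 0" using elim(1) by blast
            have "v j t = 0" if "j \<noteq> k" for j using elim(2) that vk by blast
            then have "p N a t = (\<Sum>j<N. if j = k then a k * V.e k t else 0)"
              unfolding p_def by (intro sum.cong) (auto simp: V.e_eq_0_iff)
            then have "a k * V.e k t = 0" using pt k by simp
            then show ?thesis using vk by (simp add: V.e_eq_0_iff)
          qed simp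
          then have "q a t = 0" unfolding q_def by (intro sum.neutral) auto
          then show False using rt pt elim(3) by (simp add: r_def)
        qed
      qed
    qed
    have sum_p: "(\<Sum>a\<leftarrow>as. p N a t) = p N s t" for t
      unfolding p_def s_def by (rule sum_list_sum_mult)
    have sum_q: "(\<Sum>a\<leftarrow>as. q a t) = q s t" for t
      unfolding q_def s_def by (rule sum_list_sum_mult)
    have xs: "\<And>x. x \<in> set (map (p N) as) \<Longrightarrow> x \<in> carr X \<and> nrm X x \<le> 1" using as(2) pX by auto
    have len: "length (map (p N) as) = length as" by simp
    note E = sum_X sum_D
    note E' = E[OF as(1) xs, unfolded len, OF _ m0 m1 m]
    have ps: "nrm X (p N s) \<le> CB * m"
      using E'(1) sum_p by (simp add: o_def)
    define D where "D t = (\<Sum>a\<leftarrow>as. \<Omega> (p N a) t) + of_real L * p N s t - \<Omega> (p N s) t" for t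
    have "(\<lambda>t. (\<Sum>x\<leftarrow>map (p N) as. \<Omega> x t) + of_real (ln (m0 / m1)) * (\<Sum>x\<leftarrow>map (p N) as. x t)
        - \<Omega> (\<lambda>t. \<Sum>x\<leftarrow>map (p N) as. x t) t) = D"
      unfolding D_def L_def using sum_p by (simp add: o_def fun_eq_iff)
    then have D: "D \<in> carr X" "nrm X D \<le> (CB + CB * CB) / min \<theta> (1 - \<theta>) * m"
      using E'(2,3) by simp_all
    have r1: "nrm X (r a) \<le> C" if "a \<in> set as" for a
      using r(2)[of a] mult_left_mono[OF as(2)[OF that], of C] C by linarith
    \<comment> \<open>The errors have smaller supports than the family itself, so heredity makes
      them a family of the class.\<close>
    have "map (\<lambda>a t. r a t / of_real C) as \<in> FX"
    proof (rule hX[OF as(1)])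
      show "set (map (\<lambda>a t. r a t / of_real C) as) \<subseteq> carr X" using r(1) by auto
      show "list_all2 (supp_subset M) (map (\<lambda>a t. r a t / of_real C) as) (map (p N) as)"
      proof (rule list_all2_map_self)
        show "supp_subset M (\<lambda>t. r a t / of_real C) (p N a)" for a
          using r_supp[of a] unfolding supp_subset_def by eventually_elim simp
      qed
    qed
    then have "nrm X (\<lambda>t. \<Sum>a\<leftarrow>as. r a t) \<le> C * growth X FX (length as)"
      by (intro X.growth_scaled r(1) r1 C)
    \<comment> \<open>The interpolation inequality for the growth function, available from the first
      conclusion of \<open>centralizer_sum_estimate\<close>. It is applied to arbitrary families in
      \<open>FX\<close>, since the errors are not of the form \<open>p N a\<close>.\<close>
    also have "growth X FX (length as) \<le> CB * m"
    proof (rule X.growth_least)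
      show "0 \<le> CB * m" using CB(1) by (simp add: m)
      fix xs assume "xs \<in> FX" "length xs = length as" "\<And>x. x \<in> set xs \<Longrightarrow> x \<in> carr X \<and> nrm X x \<le> 1"
      then show "nrm X (\<lambda>t. \<Sum>x\<leftarrow>xs. x t) \<le> CB * m" using m0 m1 by (intro sum_X[OF _ _ _ _ _ _ m]) simp_all
    qed
    finally have R: "nrm X (\<lambda>t. \<Sum>a\<leftarrow>as. r a t) \<le> C * (CB * m)" using C by simp
    have RX: "(\<lambda>t. \<Sum>a\<leftarrow>as. r a t) \<in> carr X"
      using X.sum_list_carr[of "map r as"] r(1) by (auto simp: o_def)
    have "nrm X (r s) \<le> C * (CB * m)"
      using r(2)[of s] mult_left_mono[OF ps, of C] C by linarith
    have sum_r: "(\<Sum>a\<leftarrow>as. r a t) = (\<Sum>a\<leftarrow>as. \<Omega> (p N a) t) - q s t" for t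
      unfolding sum_q[symmetric] r_def by (induction as) simp_all
    \<comment> \<open>The linear parts cancel: \<open>q s\<close> occurs in the sum of the
      \<open>r a\<close> and in \<open>r s\<close>, and the \<open>\<Omega>\<close> terms of
      \<open>D\<close> are matched by those of the errors.\<close>
    have eq: "(\<lambda>t. of_real L * p N s t) = (\<lambda>t. (D t - (\<Sum>a\<leftarrow>as. r a t)) + r s t)"
      unfolding sum_r by (simp add: D_def r_def fun_eq_iff)
    have "\<bar>L\<bar> * nrm X (p N s) = nrm X (\<lambda>t. of_real L * p N s t)"
      by (simp add: X.nrm_cmult pX)
    also have "\<dots> \<le> nrm X (\<lambda>t. D t - (\<Sum>a\<leftarrow>as. r a t)) + nrm X (r s)"
      unfolding eq by (intro X.nrm_add X.diff_carr D RX r)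
    also have "\<dots> \<le> (nrm X D + nrm X (\<lambda>t. \<Sum>a\<leftarrow>as. r a t)) + nrm X (r s)"
      by (intro add_right_mono X.nrm_diff D RX)
    also have "\<dots> \<le> K * m"
      using D(2) R \<open>nrm X (r s) \<le> C * (CB * m)\<close> by (simp add: K_def algebra_simps)
    finally show ?thesis by (simp add: L_def sum_p)
  qed
  have "\<bar>ln (growth X0 F0 n / growth X1 F1 n)\<bar> * growth V.W TW n
      \<le> K * (growth X0 F0 n powr (1 - \<theta>) * growth X1 F1 n powr \<theta>)" (is "\<bar>?L\<bar> * _ \<le> K * ?m") for n
  \<comment> \<open>The first case includes vanishing growth: the quotient is then 0, and
    \<open>ln 0 = 0\<close> by convention. In the second case both growth values are
    positive.\<close>
  proof (cases "?L = 0")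
    case True
    then show ?thesis using K by simp
  next
    case False
    define m0 where "m0 = growth X0 F0 n"
    define m1 where "m1 = growth X1 F1 n"
    have "m0 \<noteq> 0" "m1 \<noteq> 0" using False by (auto simp: m0_def m1_def)
    then have pos: "m0 > 0" "m1 > 0"
      using X0.growth_nonneg[of F0 n] X1.growth_nonneg[of F1 n] by (auto simp: m0_def m1_def)
    have Lpos: "\<bar>?L\<bar> > 0" using False by simp
    have "growth V.W TW n \<le> K * ?m / \<bar>?L\<bar>"
    proof (rule W.growth_least)
      show "0 \<le> K * ?m / \<bar>?L\<bar>" using K by simp
      fix as assume as: "as \<in> TW" "length as = n" "\<And>a. a \<in> set as \<Longrightarrow> a \<in> carr V.W \<and> nrm V.W a \<le> 1"
      \<comment> \<open>Truncating coefficients shrinks supports in the span, so heredity there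
        keeps the truncated family in \<open>TW\<close> and lifting sends it to the finite
        combinations \<open>p N a\<close>.\<close>
      define tr where "tr N a k = (if k < N then a k else 0)" for N and a :: "nat \<Rightarrow> complex" and k :: nat
      define s where "s k = (\<Sum>a\<leftarrow>as. a k)" for k
      have sW: "s \<in> carr V.W" unfolding s_def using as(3) by (intro W.sum_list_carr) auto
      have tr_expands: "expands X v (tr N a) (p N a)" for N a
      proof -
        have "expands X v (tr N a) (\<lambda>t. \<Sum>k<N. tr N a k * V.e k t)"
          by (rule V.expands_finite) (simp add: tr_def)
        moreover have "(\<lambda>t. \<Sum>k<N. tr N a k * V.e k t) = p N a" by (simp add: p_def tr_def fun_eq_iff)
        ultimately show ?thesis by simp
      qed
      have tr: "tr N a \<in> carr V.W" "nrm V.W (tr N a) = nrm X (p N a)" for N a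
        using V.span_carrI[OF tr_expands] V.nrm_span[OF tr_expands] by auto
      have tr_le: "nrm X (p N a) \<le> 1" if "a \<in> set as" for N a
      proof -
        have "nrm V.W (tr N a) \<le> nrm V.W a"
          using as(3)[OF that] by (intro W.ideal(2)) (auto simp: tr_def)
        then show ?thesis using as(3)[OF that] tr(2)[of N a] by simp
      qed
      have fin: "nrm V.W (tr N s) \<le> K * ?m / \<bar>?L\<bar>" for N
      proof -
        have "map (tr N) as \<in> TW"
        proof (rule hT[OF as(1)])
          show "set (map (tr N) as) \<subseteq> carr V.W" using tr(1) by auto
          show "list_all2 (supp_subset (count_space UNIV)) (map (tr N) as) as"
            using list_all2_map_self[of as _ "tr N" "\<lambda>a. a"] by (simp add: supp_subset_def tr_def AE_count_space)
        qed
        then have "map (p N) as \<in> FX"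
          by (rule lift) (intro list_all2_map_self tr_expands)
        from finite_estimate[OF this tr_le, of m0 m1 ?m]
        have "\<bar>?L\<bar> * nrm X (\<lambda>t. \<Sum>a\<leftarrow>as. p N a t) \<le> K * ?m"
          using pos as(2) by (simp add: m0_def m1_def)
        moreover have "(\<lambda>t. \<Sum>a\<leftarrow>as. p N a t) = p N s"
          unfolding p_def s_def by (rule ext) (rule sum_list_sum_mult)
        ultimately show ?thesis using Lpos tr(2)[of N s] by (simp add: field_simps)
      qed
      obtain x where x: "expands X v s x" using V.span_carrE[OF sW] .
      \<comment> \<open>The bound \<open>fin\<close> does not depend on \<open>N\<close>, and the
        truncation error of the sum tends to 0 because the partial sums of its expansion
        converge.\<close>
      have lim: "(\<lambda>N. K * ?m / \<bar>?L\<bar> + nrm V.W (\<lambda>k. s k - tr N s k)) \<longlonglongrightarrow> K * ?m / \<bar>?L\<bar> + 0"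
        using V.span_truncation[OF x] unfolding tr_def by (intro tendsto_add tendsto_const)
      have "nrm V.W s \<le> K * ?m / \<bar>?L\<bar> + nrm V.W (\<lambda>k. s k - tr N s k)" for N
        using W.nrm_le_add_diff[OF sW tr(1), of N s] fin[of N] by linarith
      then have "nrm V.W s \<le> K * ?m / \<bar>?L\<bar> + 0"
        by (intro LIMSEQ_le_const[OF lim]) blast
      then show "nrm V.W (\<lambda>k. \<Sum>a\<leftarrow>as. a k) \<le> K * ?m / \<bar>?L\<bar>" unfolding s_def by simp
    qed
    then have "\<bar>?L\<bar> * growth V.W TW n \<le> \<bar>?L\<bar> * (K * ?m / \<bar>?L\<bar>)"
      by (rule mult_left_mono) simp
    then show ?thesis using Lpos by simp
  qed
  then show ?thesis by blast
qed

end

section \<open>The Koethe and the basis settings\<close>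

lemma induced_centralizer_locale:
  assumes "koethe_space M X0" "koethe_space M X1" "0 < \<theta>" "\<theta> < 1" "induced_centralizer M X0 X1 \<theta> \<Omega>"
  obtains B where "centralizer M X0 X1 \<theta> B \<Omega>"
proof -
  obtain B where "interp_selector M X0 X1 \<theta> B"
    "\<forall>x\<in>carr (interp_space X0 X1 \<theta>). complex_deriv_in (sum_space X0 X1) (B x) (\<Omega> x) (complex_of_real \<theta>)"
    using assms(5) unfolding induced_centralizer_def by blast
  then have "centralizer M X0 X1 \<theta> B \<Omega>"
    using assms(1-4) by unfold_locales auto
  then show ?thesis by (rule that)
qed

lemma growth_estimate_koethe:
  fixes S :: "'a family_class" and T :: "nat family_class"
  assumes ST: "standard_class S T" and X: "koethe_space M X0" "koethe_space M X1"
    and \<theta>: "0 < \<theta>" "\<theta> < 1" and \<Omega>: "induced_centralizer M X0 X1 \<theta> \<Omega>"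
    and sing: "\<not> disjointly_singular M (interp_space X0 X1 \<theta>) \<Omega>"
  shows "\<exists>u K. disjoint_seq M (interp_space X0 X1 \<theta>) u \<and>
     (let M0 = growth X0 (S M X0);
          M1 = growth X1 (S M X1);
          W = span_space (interp_space X0 X1 \<theta>) u;
          MW = growth W (T (count_space UNIV) W)
      in \<forall>n. \<bar>ln (M0 n / M1 n)\<bar> * MW n \<le> K * (M0 n powr (1 - \<theta>) * M1 n powr \<theta>))"
proof -
  obtain B where "centralizer M X0 X1 \<theta> B \<Omega>" using induced_centralizer_locale[OF X \<theta> \<Omega>] .
  then interpret centralizer M X0 X1 \<theta> B \<Omega> .
  obtain u where u: "disjoint_seq M X u" and triv: "trivial_on M X \<Omega> (closed_span X u)"
    using sing unfolding disjointly_singular_def by blast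
  interpret V: disjoint_span M X u by unfold_locales (rule u)
  obtain w C where lin: "local_linearization u w C"
    using trivial_imp_local_linearization[OF triv u
        combination_in_closed_span[where X=X and u=u and k="\<lambda>j. j", OF X.seminormed_axioms V.u_carr]] by blast
  have hS: "zs \<in> S M Y" if "koethe_space M Y" "xs \<in> S M X" "set zs \<subseteq> carr Y" "list_all2 (supp_subset M) zs xs" for xs zs Y
    using ST that X.koethe_space unfolding standard_class_def support_hereditary_def in_lists_conv_set by blast
  have hT: "bs \<in> T (count_space UNIV) V.W"
    if "as \<in> T (count_space UNIV) V.W" "set bs \<subseteq> carr V.W" "list_all2 (supp_subset (count_space UNIV)) bs as" for as bs
    using ST that V.span_koethe unfolding standard_class_def support_hereditary_def in_lists_conv_set by blast
  have lift: "xs \<in> S M X" if "as \<in> T (count_space UNIV) V.W" "list_all2 (expands X u) as xs" for as xs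
    using ST that X.koethe_space u unfolding standard_class_def lifts_from_spans_def by blast
  have "\<exists>K. \<forall>n. \<bar>ln (growth X0 (S M X0) n / growth X1 (S M X1) n)\<bar> * growth V.W (T (count_space UNIV) V.W) n
      \<le> K * (growth X0 (S M X0) n powr (1 - \<theta>) * growth X1 (S M X1) n powr \<theta>)"
    by (rule growth_estimate[OF u lin])
      (rule hS[OF X(1)] hS[OF X(2)] hS[OF X.koethe_space] hT lift; assumption)+
  then show ?thesis unfolding Let_def using u by blast
qed

text \<open>Here lifting is available only from spans of successive vectors, while the failure of
  singularity provides merely disjoint ones. The subspace obtained is therefore spanned by the cut
  vectors \<open>v\<close> and not by \<open>u\<close>. Heredity and lifting at \<open>X\<close>
  moreover require it to be a space with a 1-unconditional basis, hence
  \<open>interp_unconditional_basis\<close>.\<close>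

lemma growth_estimate_basis:
  fixes T :: "nat family_class"
  assumes T: "standard_basis_class T"
    and X: "unconditional_basis_space (count_space UNIV) X0" "unconditional_basis_space (count_space UNIV) X1"
    and \<theta>: "0 < \<theta>" "\<theta> < 1" and \<Omega>: "induced_centralizer (count_space UNIV) X0 X1 \<theta> \<Omega>"
    and sing: "\<not> disjointly_singular (count_space UNIV) (interp_space X0 X1 \<theta>) \<Omega>"
  shows "\<exists>u K. disjoint_seq (count_space UNIV) (interp_space X0 X1 \<theta>) u \<and>
     (let M0 = growth X0 (T (count_space UNIV) X0);
          M1 = growth X1 (T (count_space UNIV) X1);
          W = span_space (interp_space X0 X1 \<theta>) u;
          MW = growth W (T (count_space UNIV) W)
      in \<forall>n. \<bar>ln (M0 n / M1 n)\<bar> * MW n \<le> K * (M0 n powr (1 - \<theta>) * M1 n powr \<theta>))"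
proof -
  let ?M = "count_space UNIV :: nat measure"
  have KX: "koethe_space ?M X0" "koethe_space ?M X1"
    using X by (auto simp: unconditional_basis_space_def)
  obtain B where "centralizer ?M X0 X1 \<theta> B \<Omega>" using induced_centralizer_locale[OF KX \<theta> \<Omega>] .
  then interpret centralizer ?M X0 X1 \<theta> B \<Omega> .
  have UX: "unconditional_basis_space ?M X" by (rule interp_unconditional_basis[OF X \<theta>])
  obtain u where u: "disjoint_seq ?M X u" and triv: "trivial_on ?M X \<Omega> (closed_span X u)"
    using sing unfolding disjointly_singular_def by blast
  have uX: "u k \<in> carr X" for k using u by (simp add: disjoint_seq_def)
  obtain k h where k: "inj k" and h: "\<And>i. h i \<in> {0, 1}"
    and succ: "successive_seq ?M X (\<lambda>j i. h i * u (k j) i)"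
    and le: "\<And>N a. nrm X (\<lambda>i. \<Sum>j<N. a j * u (k j) i) \<le> 2 * nrm X (\<lambda>i. \<Sum>j<N. a j * (h i * u (k j) i))"
    using gliding_hump[OF UX u] by blast
  have uk: "disjoint_seq ?M X (\<lambda>j. u (k j))"
    using u k by (auto simp: disjoint_seq_def inj_eq)
  obtain w C where "local_linearization (\<lambda>j. u (k j)) w C"
    using trivial_imp_local_linearization[OF triv uk
        combination_in_closed_span[where X=X and u=u and k=k, OF X.seminormed_axioms uX]] by blast
  from local_linearization_restrict[OF this uX _ h le]
  obtain C' where lin: "local_linearization (\<lambda>j i. h i * u (k j) i) (\<lambda>j i. h i * w j i) C'" by auto
  define v where "v j i = h i * u (k j) i" for j i
  have lin: "local_linearization v (\<lambda>j i. h i * w j i) C'" using lin by (simp add: v_def[abs_def])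
  have succ: "successive_seq ?M X v" using succ by (simp add: v_def[abs_def])
  have v: "disjoint_seq ?M X v"
    using succ unfolding successive_seq_def disjoint_seq_def AE_count_space
    by (metis linorder_neqE_nat less_irrefl)
  interpret V: disjoint_span ?M X v by unfold_locales (rule v)
  have hS: "zs \<in> T ?M Y" if "unconditional_basis_space ?M Y" "unconditional_basis_space ?M Y'" "xs \<in> T ?M Y'"
    "set zs \<subseteq> carr Y" "list_all2 (supp_subset ?M) zs xs" for xs zs Y Y'
    using T that unfolding standard_basis_class_def support_hereditary_def in_lists_conv_set by blast
  have lift: "xs \<in> T ?M X" if "as \<in> T ?M V.W" "list_all2 (expands X v) as xs" for as xs
    using T that UX succ unfolding standard_basis_class_def lifts_from_spans_def by blast
  have "\<exists>K. \<forall>n. \<bar>ln (growth X0 (T ?M X0) n / growth X1 (T ?M X1) n)\<bar> * growth V.W (T ?M V.W) n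
      \<le> K * (growth X0 (T ?M X0) n powr (1 - \<theta>) * growth X1 (T ?M X1) n powr \<theta>)"
    by (rule growth_estimate[OF v lin])
      (rule hS[OF X(1) UX] hS[OF X(2) UX] hS[OF UX UX]
        hS[OF V.span_unconditional_basis V.span_unconditional_basis] lift; assumption)+
  then show ?thesis unfolding Let_def using v by blast
qed

theorem proposition5p1:
  shows "(\<forall>(S :: 'a family_class) (T :: nat family_class) (M :: 'a measure)
            (X0 :: 'a fspace) (X1 :: 'a fspace) (\<theta> :: real) \<Omega>.
          standard_class S T \<longrightarrow>
          koethe_space M X0 \<longrightarrow> koethe_space M X1 \<longrightarrow>
          0 < \<theta> \<longrightarrow> \<theta> < 1 \<longrightarrow>
          reflexive_space (interp_space X0 X1 \<theta>) \<longrightarrow>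
          induced_centralizer M X0 X1 \<theta> \<Omega> \<longrightarrow>
          \<not> disjointly_singular M (interp_space X0 X1 \<theta>) \<Omega> \<longrightarrow>
          (\<exists>u K. disjoint_seq M (interp_space X0 X1 \<theta>) u \<and>
             (let M0 = growth X0 (S M X0);
                  M1 = growth X1 (S M X1);
                  W = span_space (interp_space X0 X1 \<theta>) u;
                  MW = growth W (T (count_space UNIV) W)
              in \<forall>n. \<bar>ln (M0 n / M1 n)\<bar> * MW n \<le> K * (M0 n powr (1 - \<theta>) * M1 n powr \<theta>))))
       \<and>
         (\<forall>(T :: nat family_class) (X0 :: nat fspace) (X1 :: nat fspace) (\<theta> :: real) \<Omega>.
          standard_basis_class T \<longrightarrow>
          unconditional_basis_space (count_space UNIV) X0 \<longrightarrow>
          unconditional_basis_space (count_space UNIV) X1 \<longrightarrow>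
          0 < \<theta> \<longrightarrow> \<theta> < 1 \<longrightarrow>
          reflexive_space (interp_space X0 X1 \<theta>) \<longrightarrow>
          induced_centralizer (count_space UNIV) X0 X1 \<theta> \<Omega> \<longrightarrow>
          \<not> disjointly_singular (count_space UNIV) (interp_space X0 X1 \<theta>) \<Omega> \<longrightarrow>
          (\<exists>u K. disjoint_seq (count_space UNIV) (interp_space X0 X1 \<theta>) u \<and>
             (let M0 = growth X0 (T (count_space UNIV) X0);
                  M1 = growth X1 (T (count_space UNIV) X1);
                  W = span_space (interp_space X0 X1 \<theta>) u;
                  MW = growth W (T (count_space UNIV) W)
              in \<forall>n. \<bar>ln (M0 n / M1 n)\<bar> * MW n \<le> K * (M0 n powr (1 - \<theta>) * M1 n powr \<theta>))))"
  using growth_estimate_koethe growth_estimate_basis by blast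

end
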